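(* Let $\Gamma$ be a finitely generated group. A subshift $X\subset A^{\Gamma}$ (with $A$ a finite alphabet) is an EDS if and only if it is effective.
   Context: r.e. means recursively enumerable. EDS. A computable metric space is $(X,d,\mathcal{S})$ where $(X,d)$ is a separable metric space, $\mathcal{S}=\{s_i: i\ge 0\}$ is dense, and there is an algorithm which on input $(i,j,n)$ outputs $r\in\mathbb{Q}$ with $|d(s_i,s_j)-r|\le 2^{-n}$. Basic balls are open balls centered at points of $\mathcal{S}$ with positive rational radius; fix a computable enumeration $(B_n)_{n\in\mathbb{N}}$ of them and put $U_I=\bigcup_{n\in I}B_n$. A compact set $K\subset X$ is recursively compact if there is an algorithm which, given a finite $I\subset\mathbb{N}$, halts iff $K\subset U_I$. A map $f\colon Y\subset X\to X'$ between computable metric spaces is computable if there is an algorithm which, given $m$, enumerates $I_m$ with $f^{-1}(B'_m)=U_{I_m}\cap Y$, where $(B'_m)_m$ enumerates the basic balls of $X'$. An action of a finitely generated group by homeomorphisms on a recursively compact subset of a computable metric space is computable if for some (equivalently any) finite generating set each generator acts by a computable map. An action of a finitely generated group on a compact metrizable space is an effective dynamical system (EDS) if it is topologically conjugate (via an equivariant homeomorphism, not necessarily computable) to a computable action on some recursively compact subset of a computable metric space. Effective subshifts. $\Gamma$ acts on $A^\Gamma$ (prodiscrete topology) by $(gx)(h)=x(g^{-1}h)$; a $\Gamma$-subshift is a closed $\Gamma$-invariant subset, regarded as a dynamical system with the shift action. Let $S$ be a finite generating set of $\Gamma$, $F(S)$ the free group on $S$, $\phi\colon F(S)\to\Gamma$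 the canonical epimorphism. The pullback of $X\subset A^\Gamma$ is $\widehat X=\{x\circ\phi:x\in X\}\subset A^{F(S)}$. $X$ is effective if for some (equivalently any) finite generating set $S$ the set $\widehat X$ is effectively closed in $A^{F(S)}$, i.e. the set of patterns $p\colon W\to A$, $W\subset F(S)$ finite, such that no $y\in\widehat X$ satisfies $y|_W=p$ is r.e. *)

theory Defs
  imports
    "HOL-Analysis.Analysis"
    "HOL-Algebra.Group_Action"
    "HOL-Algebra.Generated_Groups"
    "HOL-Library.Countable_Set"
    "HOL-Library.Nat_Bijection"
begin

section \<open>Partial recursive functions\<close>

text \<open>
  Terms carry no arity: a term is a program that may be run on argument lists of any length, and
  a term that is not applicable to its arguments has no value.  In \<open>RPrec f g\<close> the recursion
  variable is the first argument and \<open>g\<close> receives the counter, the previous value and the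
  parameters, in this order; in \<open>RMu f\<close> the variable that is minimised is the first argument.
\<close>

datatype recf =
    RZero
  | RSucc
  | RProj nat
  | RComp recf "recf list"
  | RPrec recf recf
  | RMu recf

inductive evals :: "recf \<Rightarrow> nat list \<Rightarrow> nat \<Rightarrow> bool" where
  zero: "evals RZero xs 0"
| succ: "evals RSucc (x # xs) (Suc x)"
| proj: "i < length xs \<Longrightarrow> evals (RProj i) xs (xs ! i)"
| comp: "list_all2 (\<lambda>g y. evals g xs y) gs ys \<Longrightarrow> evals f ys z \<Longrightarrow> evals (RComp f gs) xs z"
| prec_0: "evals f xs z \<Longrightarrow> evals (RPrec f g) (0 # xs) z"
| prec_Suc: "evals (RPrec f g) (n # xs) y \<Longrightarrow> evals g (n # y # xs) z \<Longrightarrow>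
    evals (RPrec f g) (Suc n # xs) z"
| mu: "evals f (n # xs) 0 \<Longrightarrow> (\<forall>i<n. \<exists>y. evals f (i # xs) (Suc y)) \<Longrightarrow> evals (RMu f) xs n"

definition halts :: "recf \<Rightarrow> nat list \<Rightarrow> bool" where
  "halts f xs \<longleftrightarrow> (\<exists>y. evals f xs y)"

inductive_cases evals_elims:
  "evals RZero xs z" "evals RSucc xs z" "evals (RProj i) xs z" "evals (RComp f gs) xs z"
  "evals (RPrec f g) (0 # xs) z" "evals (RPrec f g) (Suc n # xs) z" "evals (RMu f) xs z"

lemma evals_deterministic: "evals f xs y \<Longrightarrow> evals f xs z \<Longrightarrow> y = z"
proof (induction arbitrary: z rule: evals.induct)
  case (zero xs)
  then show ?case by cases simp
next
  case (succ x xs)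
  then show ?case by cases simp
next
  case (proj i xs)
  from proj.prems show ?case by cases simp
next
  case (comp xs gs ys f z')
  from comp.prems obtain ys' where ys': "list_all2 (\<lambda>g y. evals g xs y) gs ys'" "evals f ys' z"
    by (rule evals_elims(4))
  have "ys = ys'"
  proof (rule nth_equalityI)
    show len: "length ys = length ys'"
      using list_all2_lengthD[OF comp.IH(1)] list_all2_lengthD[OF ys'(1)] by simp
    show "ys ! i = ys' ! i" if "i < length ys" for i
      using that len list_all2_nthD2[OF comp.IH(1), of i] list_all2_nthD2[OF ys'(1), of i] by simp
  qed
  then show ?case using comp.IH(2) ys'(2) by simp
next
  case (prec_Suc f g n xs y z')
  from prec_Suc.prems obtain y' where "evals (RPrec f g) (n # xs) y'" "evals g (n # y' # xs) z"
    by (rule evals_elims(6))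
  then show ?case using prec_Suc.IH by simp
next
  case (mu f n xs)
  from mu.prems have z: "evals f (z # xs) 0" "\<forall>i<z. \<exists>y. evals f (i # xs) (Suc y)"
    by (blast elim: evals_elims(7))+
  have "\<not> n < z" using z(2) mu.IH(1) by blast
  moreover have "\<not> z < n" using z(1) mu.IH(2) by blast
  ultimately show ?case by simp
next
  case (prec_0 f xs z' g)
  from prec_0.prems have "evals f xs z" by (rule evals_elims(5))
  then show ?case by (rule prec_0.IH)
qed

definition re_set :: "nat set \<Rightarrow> bool" where
  "re_set P \<longleftrightarrow> (\<exists>f. \<forall>n. n \<in> P \<longleftrightarrow> halts f [n])"

text \<open>A single algorithm which, given \<open>m\<close>, enumerates the set \<open>I m\<close>.\<close>

definition uniformly_re :: "(nat \<Rightarrow> nat set) \<Rightarrow> bool" where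
  "uniformly_re I \<longleftrightarrow> (\<exists>f. \<forall>m n. n \<in> I m \<longleftrightarrow> halts f [m, n])"

definition rat_decode :: "nat \<Rightarrow> rat" where
  "rat_decode c = (case prod_decode c of (a, b) \<Rightarrow> of_int (int_decode a) / of_nat (Suc b))"


section \<open>Computable metric spaces\<close>

definition computable_metric_space :: "'x metric \<Rightarrow> (nat \<Rightarrow> 'x) \<Rightarrow> bool" where
  "computable_metric_space m s \<longleftrightarrow>
     range s \<subseteq> mspace m \<and>
     mtopology_of m closure_of range s = mspace m \<and>
     (\<exists>f. \<forall>i j n. \<exists>c. evals f [i, j, n] c \<and>
        \<bar>mdist m (s i) (s j) - of_rat (rat_decode c)\<bar> \<le> (1 / 2) ^ n)"

definition basic_ball :: "'x metric \<Rightarrow> (nat \<Rightarrow> 'x) \<Rightarrow> nat \<Rightarrow> 'x set" where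
  "basic_ball m s n =
     (case prod_decode n of (i, k) \<Rightarrow> case prod_decode k of (a, b) \<Rightarrow>
        mball_of m (s i) (real (Suc a) / real (Suc b)))"

definition basic_open :: "'x metric \<Rightarrow> (nat \<Rightarrow> 'x) \<Rightarrow> nat set \<Rightarrow> 'x set" where
  "basic_open m s I = (\<Union>n\<in>I. basic_ball m s n)"

definition recursively_compact :: "'x metric \<Rightarrow> (nat \<Rightarrow> 'x) \<Rightarrow> 'x set \<Rightarrow> bool" where
  "recursively_compact m s K \<longleftrightarrow>
     compactin (mtopology_of m) K \<and>
     (\<exists>f. \<forall>I. finite I \<longrightarrow> (halts f [set_encode I] \<longleftrightarrow> K \<subseteq> basic_open m s I))"

definition computable_map ::
    "'x metric \<Rightarrow> (nat \<Rightarrow> 'x) \<Rightarrow> 'x set \<Rightarrow> 'y metric \<Rightarrow> (nat \<Rightarrow> 'y) \<Rightarrow> ('x \<Rightarrow> 'y) \<Rightarrow> bool" where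
  "computable_map m s Y m' s' f \<longleftrightarrow>
     Y \<subseteq> mspace m \<and> f \<in> Y \<rightarrow> mspace m' \<and>
     (\<exists>I. uniformly_re I \<and>
        (\<forall>k. {y \<in> Y. f y \<in> basic_ball m' s' k} = basic_open m s (I k) \<inter> Y))"


section \<open>Actions and effective dynamical systems\<close>

definition finite_generating_set :: "('g, 'z) monoid_scheme \<Rightarrow> 'g set \<Rightarrow> bool" where
  "finite_generating_set G S \<longleftrightarrow> finite S \<and> S \<subseteq> carrier G \<and> generate G S = carrier G"

definition finitely_generated :: "('g, 'z) monoid_scheme \<Rightarrow> bool" where
  "finitely_generated G \<longleftrightarrow> (\<exists>S. finite_generating_set G S)"

definition homeo_action ::
    "('g, 'z) monoid_scheme \<Rightarrow> 'x topology \<Rightarrow> ('g \<Rightarrow> 'x \<Rightarrow> 'x) \<Rightarrow> bool" where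
  "homeo_action G T \<alpha> \<longleftrightarrow>
     group_action G (topspace T) \<alpha> \<and> (\<forall>g\<in>carrier G. homeomorphic_map T T (\<alpha> g))"

definition conjugate_actions ::
    "('g, 'z) monoid_scheme \<Rightarrow> 'x topology \<Rightarrow> ('g \<Rightarrow> 'x \<Rightarrow> 'x) \<Rightarrow>
     'y topology \<Rightarrow> ('g \<Rightarrow> 'y \<Rightarrow> 'y) \<Rightarrow> bool" where
  "conjugate_actions G T \<alpha> T' \<beta> \<longleftrightarrow>
     (\<exists>h. homeomorphic_map T T' h \<and>
        (\<forall>g\<in>carrier G. \<forall>x\<in>topspace T. h (\<alpha> g x) = \<beta> g (h x)))"

definition computable_action ::
    "('g, 'z) monoid_scheme \<Rightarrow> 'x metric \<Rightarrow> (nat \<Rightarrow> 'x) \<Rightarrow> 'x set \<Rightarrow> ('g \<Rightarrow> 'x \<Rightarrow> 'x) \<Rightarrow> bool" where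
  "computable_action G m s K \<beta> \<longleftrightarrow>
     computable_metric_space m s \<and> recursively_compact m s K \<and>
     homeo_action G (subtopology (mtopology_of m) K) \<beta> \<and>
     (\<exists>S. finite_generating_set G S \<and> (\<forall>g\<in>S. computable_map m s K m s (\<beta> g)))"

text \<open>
  HOL cannot quantify existentially over types, so the points of the computable metric space are
  taken from the fixed type \<^typ>\<open>nat set\<close>; metric and carrier are arbitrary.  A separable metric
  space has at most continuum many points, so nothing is lost: see \<open>EDS_I\<close> below.
\<close>

definition EDS ::
    "('g, 'z) monoid_scheme \<Rightarrow> 'x topology \<Rightarrow> ('g \<Rightarrow> 'x \<Rightarrow> 'x) \<Rightarrow> bool" where
  "EDS G T \<alpha> \<longleftrightarrow>
     compact_space T \<and> metrizable_space T \<and> homeo_action G T \<alpha> \<and>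
     (\<exists>(m :: nat set metric) s K \<beta>. computable_action G m s K \<beta> \<and>
        conjugate_actions G T \<alpha> (subtopology (mtopology_of m) K) \<beta>)"

lemma inj_on_basic_balls:
  assumes "computable_metric_space m s"
  shows "inj_on (\<lambda>x. {n. x \<in> basic_ball m s n}) (mspace m)"
proof (rule inj_onI, rule ccontr)
  interpret M: Metric_space "mspace m" "mdist m" by simp
  fix x y
  assume xy: "x \<in> mspace m" "y \<in> mspace m" "x \<noteq> y"
    and eq: "{n. x \<in> basic_ball m s n} = {n. y \<in> basic_ball m s n}"
  define \<delta> where "\<delta> = mdist m x y"
  have "\<delta> > 0" using xy by (simp add: \<delta>_def)
  then obtain b where b: "inverse (real (Suc b)) < \<delta> / 2"
    using reals_Archimedean[of "\<delta> / 2"] by auto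
  let ?e = "1 / real (Suc b)"
  have "x \<in> M.mtopology closure_of range s"
    using assms xy by (simp add: computable_metric_space_def mtopology_of_def)
  then obtain i where i: "s i \<in> M.mball x ?e"
    unfolding M.metric_closure_of by (auto dest!: spec[of _ ?e])
  have 1: "basic_ball m s (prod_encode (i, prod_encode (0, b))) = M.mball (s i) ?e"
    by (simp add: basic_ball_def mball_of_def)
  have "x \<in> M.mball (s i) ?e" using i by (simp add: M.commute)
  moreover from this have "y \<in> M.mball (s i) ?e" using eq 1 by blast
  moreover have "\<delta> \<le> mdist m x (s i) + mdist m (s i) y"
    unfolding \<delta>_def using i xy by (intro M.triangle) auto
  ultimately show False using b by (simp add: M.commute inverse_eq_divide)
qed

lemma EDS_I:
  fixes m :: "'y metric"
  assumes T: "compact_space T" "metrizable_space T" "homeo_action G T \<alpha>"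
    and act: "computable_action G m s K \<beta>"
    and conj: "conjugate_actions G T \<alpha> (subtopology (mtopology_of m) K) \<beta>"
  shows "EDS G T \<alpha>"
proof -
  define f where "f = (\<lambda>x. {n. x \<in> basic_ball m s n})"
  let ?M = "mspace m"
  define g where "g = inv_into ?M f"
  define m' where "m' = metric (f ` ?M, \<lambda>u v. mdist m (g u) (g v))"
  define s' where "s' = f \<circ> s"
  define K' where "K' = f ` K"
  define \<beta>' where "\<beta>' \<gamma> = restrict (f \<circ> \<beta> \<gamma> \<circ> g) K'" for \<gamma>
  have cm: "computable_metric_space m s" and rc: "recursively_compact m s K"
    and ha: "homeo_action G (subtopology (mtopology_of m) K) \<beta>"
    using act by (auto simp: computable_action_def)
  have sM: "s i \<in> ?M" for i using cm by (auto simp: computable_metric_space_def)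
  have inj: "inj_on f ?M" unfolding f_def by (rule inj_on_basic_balls[OF cm])
  have gf [simp]: "g (f x) = x" if "x \<in> ?M" for x
    unfolding g_def using inv_into_f_f[OF inj that] .
  have f_eq: "f x = f y \<longleftrightarrow> x = y" if "x \<in> ?M" "y \<in> ?M" for x y
    using inj_on_eq_iff[OF inj that] .
  have KM: "K \<subseteq> ?M"
    using rc compactin_subset_topspace by (fastforce simp: recursively_compact_def)
  have M': "Metric_space (f ` ?M) (\<lambda>u v. mdist m (g u) (g v))"
  proof
    fix x y assume "x \<in> f ` ?M" "y \<in> f ` ?M"
    then obtain a b where "x = f a" "y = f b" "a \<in> ?M" "b \<in> ?M" by blast
    then show "mdist m (g x) (g y) = 0 \<longleftrightarrow> x = y" using f_eq by simp
  next
    fix x y z assume "x \<in> f ` ?M" "y \<in> f ` ?M" "z \<in> f ` ?M"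
    then show "mdist m (g x) (g z) \<le> mdist m (g x) (g y) + mdist m (g y) (g z)"
      by (auto intro: mdist_triangle)
  qed (auto simp: mdist_commute)
  have m' [simp]: "mspace m' = f ` ?M" "mdist m' = (\<lambda>u v. mdist m (g u) (g v))"
    unfolding m'_def
    by (simp_all add: Metric_space.mspace_metric[OF M'] Metric_space.mdist_metric[OF M'])
  have homeo: "homeomorphic_map (mtopology_of m) (mtopology_of m') f"
  proof -
    interpret Metric_space12 ?M "mdist m" "f ` ?M" "\<lambda>u v. mdist m (g u) (g v)"
      using M' by (simp add: Metric_space12_def)
    show ?thesis
      using isometry_imp_homeomorphic_map[of f] by (simp add: mtopology_of_def)
  qed
  have homeoK: "homeomorphic_map (subtopology (mtopology_of m) K) (subtopology (mtopology_of m') K') f"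
    using KM by (intro homeomorphic_map_subtopologies homeo) (auto simp: K'_def f_eq subset_iff)
  have ball: "basic_ball m' s' n = f ` basic_ball m s n" for n
    using sM by (auto simp: basic_ball_def s'_def split: prod.split)
  have ball_M: "basic_ball m s n \<subseteq> ?M" for n
    by (auto simp: basic_ball_def split: prod.splits)
  have bopen: "basic_open m' s' I = f ` basic_open m s I" for I
    by (auto simp: basic_open_def ball)
  have bopen_M: "basic_open m s I \<subseteq> ?M" for I
    using ball_M by (auto simp: basic_open_def)
  have "range s' \<subseteq> mspace m'" using sM by (auto simp: s'_def)
  moreover have "mtopology_of m' closure_of range s' = mspace m'"
  proof -
    have "f ` (mtopology_of m closure_of range s) = mtopology_of m' closure_of (f ` range s)"
      using homeomorphic_map_closure_of[OF homeo, of "range s"] sM by auto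
    then show ?thesis
      using cm by (simp add: computable_metric_space_def s'_def image_comp)
  qed
  moreover have "mdist m' (s' i) (s' j) = mdist m (s i) (s j)" for i j
    using sM by (simp add: s'_def)
  ultimately have cm': "computable_metric_space m' s'"
    using cm unfolding computable_metric_space_def by simp
  have "compactin (mtopology_of m') K'"
    using rc homeomorphic_map_compactness[OF homeo, of K] KM
    by (simp add: recursively_compact_def K'_def)
  moreover have "K' \<subseteq> basic_open m' s' I \<longleftrightarrow> K \<subseteq> basic_open m s I" for I
    unfolding K'_def bopen using inj_on_image_subset_iff[OF inj KM bopen_M] .
  ultimately have rc': "recursively_compact m' s' K'"
    using rc by (simp add: recursively_compact_def)
  have bij: "bij_betw f K K'"
    using inj_on_subset[OF inj KM] by (simp add: bij_betw_def K'_def)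
  have topK: "topspace (subtopology (mtopology_of m) K) = K"
    and topK': "topspace (subtopology (mtopology_of m') K') = K'"
    using KM by (auto simp: K'_def)
  have act_hom: "\<beta> \<in> hom G (BijGroup K)" and grp: "group G"
    and act_homeo: "\<gamma> \<in> carrier G \<Longrightarrow>
      homeomorphic_map (subtopology (mtopology_of m) K) (subtopology (mtopology_of m) K) (\<beta> \<gamma>)" for \<gamma>
    using ha unfolding homeo_action_def topK
    by (auto simp: group_action_def group_hom_def group_hom_axioms_def)
  have bij_\<beta>: "bij_betw (\<beta> \<gamma>) K K" if "\<gamma> \<in> carrier G" for \<gamma>
    using hom_in_carrier[OF act_hom that] by (simp add: BijGroup_def Bij_def)
  have \<beta>K: "\<beta> \<gamma> x \<in> K" if "\<gamma> \<in> carrier G" "x \<in> K" for \<gamma> x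
    using bij_\<beta>[OF that(1)] that(2) by (auto dest: bij_betwE)
  have gK [simp]: "g (f x) = x" if "x \<in> K" for x using that KM gf by blast
  have \<beta>'f: "\<beta>' \<gamma> (f x) = f (\<beta> \<gamma> x)" if "x \<in> K" for \<gamma> x
    using that by (simp add: \<beta>'_def K'_def)
  have g_homeo: "homeomorphic_map (subtopology (mtopology_of m') K') (subtopology (mtopology_of m) K) g"
  proof -
    obtain g' where g': "homeomorphic_maps (subtopology (mtopology_of m) K) (subtopology (mtopology_of m') K') f g'"
      using homeoK by (auto simp: homeomorphic_map_maps)
    then have "homeomorphic_map (subtopology (mtopology_of m') K') (subtopology (mtopology_of m) K) g'"
      and "\<forall>x\<in>K. g' (f x) = x"
      unfolding homeomorphic_maps_map topK by auto
    then show ?thesis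
      by (elim homeomorphic_map_eq) (auto simp: topK' K'_def)
  qed
  have \<beta>'_homeo: "homeomorphic_map (subtopology (mtopology_of m') K') (subtopology (mtopology_of m') K') (\<beta>' \<gamma>)"
    if "\<gamma> \<in> carrier G" for \<gamma>
  proof (rule homeomorphic_map_eq)
    show "homeomorphic_map (subtopology (mtopology_of m') K') (subtopology (mtopology_of m') K') (f \<circ> \<beta> \<gamma> \<circ> g)"
      using homeomorphic_map_compose[OF g_homeo homeomorphic_map_compose[OF act_homeo[OF that] homeoK]]
      by (simp add: comp_assoc)
  qed (auto simp: \<beta>'_def topK')
  have \<beta>'_Bij: "\<beta>' \<gamma> \<in> Bij K'" if "\<gamma> \<in> carrier G" for \<gamma>
    using homeomorphic_imp_injective_map[OF \<beta>'_homeo[OF that]]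
      homeomorphic_imp_surjective_map[OF \<beta>'_homeo[OF that]]
    unfolding topK' by (simp add: Bij_def bij_betw_def) (simp add: \<beta>'_def)
  have "\<beta>' \<in> hom G (BijGroup K')"
  proof (rule homI)
    fix \<gamma> \<delta> assume \<gamma>\<delta>: "\<gamma> \<in> carrier G" "\<delta> \<in> carrier G"
    have "\<beta> (\<gamma> \<otimes>\<^bsub>G\<^esub> \<delta>) = compose K (\<beta> \<gamma>) (\<beta> \<delta>)"
      using hom_mult[OF act_hom \<gamma>\<delta>] \<gamma>\<delta>[THEN hom_in_carrier[OF act_hom]] by (simp add: BijGroup_def)
    then have "\<beta>' (\<gamma> \<otimes>\<^bsub>G\<^esub> \<delta>) = compose K' (\<beta>' \<gamma>) (\<beta>' \<delta>)"
      using \<gamma>\<delta> by (auto simp: \<beta>'_def K'_def compose_def fun_eq_iff \<beta>K)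
    then show "\<beta>' (\<gamma> \<otimes>\<^bsub>G\<^esub> \<delta>) = \<beta>' \<gamma> \<otimes>\<^bsub>BijGroup K'\<^esub> \<beta>' \<delta>"
      using \<gamma>\<delta> \<beta>'_Bij by (simp add: BijGroup_def)
  qed (use \<beta>'_Bij in \<open>simp add: BijGroup_def\<close>)
  then have ha': "homeo_action G (subtopology (mtopology_of m') K') \<beta>'"
    using grp \<beta>'_homeo group_BijGroup unfolding homeo_action_def topK'
    by (auto simp: group_action_def group_hom_def group_hom_axioms_def)
  have cmap: "computable_map m' s' K' m' s' (\<beta>' \<gamma>)"
    if \<gamma>: "\<gamma> \<in> carrier G" and c: "computable_map m s K m s (\<beta> \<gamma>)" for \<gamma>
  proof -
    obtain I where I: "uniformly_re I"
      "\<And>k. {y \<in> K. \<beta> \<gamma> y \<in> basic_ball m s k} = basic_open m s (I k) \<inter> K"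
      using c by (auto simp: computable_map_def)
    have "{y \<in> K'. \<beta>' \<gamma> y \<in> basic_ball m' s' k} = basic_open m' s' (I k) \<inter> K'" for k
    proof -
      have "f (\<beta> \<gamma> x) \<in> f ` basic_ball m s k \<longleftrightarrow> \<beta> \<gamma> x \<in> basic_ball m s k" if "x \<in> K" for x
        using inj_on_image_mem_iff[OF inj _ ball_M] \<beta>K[OF \<gamma> that] KM by blast
      then have *: "\<beta>' \<gamma> (f x) \<in> basic_ball m' s' k \<longleftrightarrow> \<beta> \<gamma> x \<in> basic_ball m s k" if "x \<in> K" for x
        using that by (simp only: ball \<beta>'f)
      have "{y \<in> K'. \<beta>' \<gamma> y \<in> basic_ball m' s' k} = f ` {y \<in> K. \<beta> \<gamma> y \<in> basic_ball m s k}"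
        unfolding K'_def using * by blast
      also have "\<dots> = basic_open m' s' (I k) \<inter> K'"
        unfolding I(2) bopen K'_def using inj_on_image_Int[OF inj bopen_M KM] .
      finally show ?thesis .
    qed
    moreover have "\<beta>' \<gamma> \<in> K' \<rightarrow> mspace m'" "K' \<subseteq> mspace m'"
      using \<beta>K[OF \<gamma>] by (auto simp: K'_def \<beta>'f intro!: imageI subsetD[OF KM])
    ultimately show ?thesis using I(1) by (auto simp: computable_map_def)
  qed
  have "computable_action G m' s' K' \<beta>'"
    unfolding computable_action_def
  proof (intro conjI cm' rc' ha')
    obtain S where "finite_generating_set G S" "\<forall>\<gamma>\<in>S. computable_map m s K m s (\<beta> \<gamma>)"
      using act by (auto simp: computable_action_def)
    moreover from this have "S \<subseteq> carrier G" by (simp add: finite_generating_set_def)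
    ultimately show "\<exists>S. finite_generating_set G S \<and> (\<forall>\<gamma>\<in>S. computable_map m' s' K' m' s' (\<beta>' \<gamma>))"
      using cmap by blast
  qed
  moreover have "conjugate_actions G T \<alpha> (subtopology (mtopology_of m') K') \<beta>'"
  proof -
    obtain h where h: "homeomorphic_map T (subtopology (mtopology_of m) K) h"
      "\<And>\<gamma> x. \<gamma> \<in> carrier G \<Longrightarrow> x \<in> topspace T \<Longrightarrow> h (\<alpha> \<gamma> x) = \<beta> \<gamma> (h x)"
      using conj by (auto simp: conjugate_actions_def)
    have "h x \<in> K" if "x \<in> topspace T" for x
      using homeomorphic_imp_surjective_map[OF h(1)] that topK by blast
    then show ?thesis
      unfolding conjugate_actions_def using homeomorphic_map_compose[OF h(1) homeoK] h(2) \<beta>'f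
      by (intro exI[of _ "f \<circ> h"]) auto
  qed
  ultimately show ?thesis using T unfolding EDS_def by blast
qed


section \<open>Free groups\<close>

text \<open>
  \<open>F(S)\<close> consists of the reduced words over \<open>S\<close> and formal inverses; the letter \<open>(False, s)\<close>
  stands for \<open>s\<close> and \<open>(True, s)\<close> for its inverse.
\<close>

type_synonym 'g word = "(bool \<times> 'g) list"

definition letter_inv :: "bool \<times> 'g \<Rightarrow> bool \<times> 'g" where
  "letter_inv a = (\<not> fst a, snd a)"

definition reduced :: "'g word \<Rightarrow> bool" where
  "reduced w \<longleftrightarrow> successively (\<lambda>a b. b \<noteq> letter_inv a) w"

fun push :: "bool \<times> 'g \<Rightarrow> 'g word \<Rightarrow> 'g word" where
  "push a [] = [a]"
| "push a (b # w) = (if b = letter_inv a then w else a # b # w)"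

definition free_group :: "'g set \<Rightarrow> 'g word monoid" where
  "free_group S =
     \<lparr>carrier = {w \<in> lists (UNIV \<times> S). reduced w}, mult = foldr push, one = []\<rparr>"

definition letter_val :: "('g, 'z) monoid_scheme \<Rightarrow> bool \<times> 'g \<Rightarrow> 'g" where
  "letter_val G a = (if fst a then inv\<^bsub>G\<^esub> (snd a) else snd a)"

definition word_val :: "('g, 'z) monoid_scheme \<Rightarrow> 'g word \<Rightarrow> 'g" where
  "word_val G w = foldr (\<lambda>a g. letter_val G a \<otimes>\<^bsub>G\<^esub> g) w \<one>\<^bsub>G\<^esub>"

lemma letter_inv_inv [simp]: "letter_inv (letter_inv a) = a"
  by (simp add: letter_inv_def)

lemma reduced_push: "reduced w \<Longrightarrow> reduced (push a w)"
  by (induction a w rule: push.induct) (auto simp: reduced_def successively_Cons)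

lemma set_push: "set (push a w) \<subseteq> insert a (set w)"
  by (induction a w rule: push.induct) auto

lemma push_push: "reduced w \<Longrightarrow> push a (push (letter_inv a) w) = w"
  by (cases w; cases "tl w") (auto simp: reduced_def)

lemma push_reduced: "reduced (a # w) \<Longrightarrow> push a w = a # w"
  by (cases w) (auto simp: reduced_def)

lemma reduced_foldr_push: "reduced w \<Longrightarrow> reduced (foldr push v w)"
  by (induction v) (auto intro: reduced_push)

lemma set_foldr_push: "set (foldr push v w) \<subseteq> set v \<union> set w"
proof (induction v)
  case (Cons a v)
  then show ?case using set_push[of a "foldr push v w"] by auto
qed simp

lemma foldr_push_push:
  assumes "reduced w" shows "foldr push (push a v) w = push a (foldr push v w)"
  using push_push[OF reduced_foldr_push[OF assms], of a] by (cases v) auto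

lemma foldr_push_assoc:
  "reduced w \<Longrightarrow> foldr push (foldr push u v) w = foldr push u (foldr push v w)"
  by (induction u) (auto simp: foldr_push_push)

lemma foldr_push_inverse:
  "reduced w \<Longrightarrow> foldr push (rev (map letter_inv w)) w = []"
proof (induction w)
  case (Cons a w)
  then show ?case by (cases w) (auto simp: reduced_def)
qed simp

lemma reduced_inverse: "reduced w \<Longrightarrow> reduced (rev (map letter_inv w))"
  unfolding reduced_def successively_rev successively_map
  by (erule successively_mono) (auto simp: letter_inv_def)

lemma group_free_group: "group (free_group S)"
proof (rule groupI)
  fix x assume x: "x \<in> carrier (free_group S)"
  have "rev (map letter_inv x) \<in> carrier (free_group S)"
    using x by (force simp: free_group_def reduced_inverse letter_inv_def)
  moreover have "rev (map letter_inv x) \<otimes>\<^bsub>free_group S\<^esub> x = \<one>\<^bsub>free_group S\<^esub>"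
    using x by (simp add: free_group_def foldr_push_inverse)
  ultimately show "\<exists>y\<in>carrier (free_group S). y \<otimes>\<^bsub>free_group S\<^esub> x = \<one>\<^bsub>free_group S\<^esub>" ..
next
  fix x y assume "x \<in> carrier (free_group S)" "y \<in> carrier (free_group S)"
  then show "x \<otimes>\<^bsub>free_group S\<^esub> y \<in> carrier (free_group S)"
    using set_foldr_push[of x y] by (force simp: free_group_def reduced_foldr_push)
qed (auto simp: free_group_def foldr_push_assoc reduced_def)

lemma (in group) word_val_closed:
  "w \<in> lists (UNIV \<times> carrier G) \<Longrightarrow> word_val G w \<in> carrier G"
  by (induction w) (auto simp: word_val_def letter_val_def)

lemma (in group) word_val_Cons: "word_val G (a # w) = letter_val G a \<otimes> word_val G w"
  by (simp add: word_val_def)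

lemma (in group) word_val_push:
  assumes "snd a \<in> carrier G" "w \<in> lists (UNIV \<times> carrier G)"
  shows "word_val G (push a w) = letter_val G a \<otimes> word_val G w"
proof (cases w)
  case (Cons b v)
  have v: "word_val G v \<in> carrier G" using assms Cons by (auto intro: word_val_closed)
  show ?thesis
    using assms v
    by (auto simp: Cons word_val_Cons letter_val_def letter_inv_def m_assoc[symmetric])
qed (simp add: word_val_def)

lemma (in group) word_val_hom:
  assumes "S \<subseteq> carrier G" shows "word_val G \<in> hom (free_group S) G"
proof -
  have mult: "word_val G (foldr push u w) = word_val G u \<otimes> word_val G w"
    if "u \<in> lists (UNIV \<times> carrier G)" "w \<in> lists (UNIV \<times> carrier G)" for u w
    using that(1)
  proof (induction u)
    case Nil
    show ?case using word_val_closed[OF that(2)] by (simp add: word_val_def)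
  next
    case (Cons a u)
    have *: "foldr push u w \<in> lists (UNIV \<times> carrier G)"
      using set_foldr_push[of u w] Cons.hyps that(2) by blast
    have a: "snd a \<in> carrier G" "letter_val G a \<in> carrier G"
      using Cons.hyps by (auto simp: letter_val_def)
    show ?case
      using word_val_push[OF a(1) *] Cons a word_val_closed[OF that(2)] word_val_closed[of u]
      by (simp add: word_val_Cons m_assoc)
  qed
  have "w \<in> lists (UNIV \<times> carrier G)" if "w \<in> carrier (free_group S)" for w
    using that assms by (auto simp: free_group_def)
  then show ?thesis
    by (intro homI) (auto intro: word_val_closed mult simp: free_group_def)
qed

lemma (in group) word_val_surj:
  assumes "S \<subseteq> carrier G" "generate G S = carrier G"
  shows "word_val G ` carrier (free_group S) = carrier G"
proof -
  interpret F: group "free_group S" by (rule group_free_group)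
  interpret \<phi>: group_hom "free_group S" G "word_val G"
    using word_val_hom[OF assms(1)] by unfold_locales
  have "S \<subseteq> word_val G ` carrier (free_group S)"
  proof
    fix s assume "s \<in> S"
    then have "[(False, s)] \<in> carrier (free_group S)" "word_val G [(False, s)] = s"
      using assms(1) by (auto simp: free_group_def reduced_def word_val_def letter_val_def)
    then show "s \<in> word_val G ` carrier (free_group S)" by force
  qed
  then have "carrier G \<subseteq> word_val G ` carrier (free_group S)"
    using generate_subgroup_incl \<phi>.img_is_subgroup assms(2) by blast
  then show ?thesis using \<phi>.hom_closed by blast
qed



section \<open>Effective subshifts\<close>

definition full_shift_topology ::
    "('g, 'z) monoid_scheme \<Rightarrow> 'b set \<Rightarrow> ('g \<Rightarrow> 'b) topology" where
  "full_shift_topology G A = product_topology (\<lambda>_. discrete_topology A) (carrier G)"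

definition shift :: "('g, 'z) monoid_scheme \<Rightarrow> 'g \<Rightarrow> ('g \<Rightarrow> 'b) \<Rightarrow> 'g \<Rightarrow> 'b" where
  "shift G g x = (\<lambda>h\<in>carrier G. x (inv\<^bsub>G\<^esub> g \<otimes>\<^bsub>G\<^esub> h))"

definition subshift :: "('g, 'z) monoid_scheme \<Rightarrow> 'b set \<Rightarrow> ('g \<Rightarrow> 'b) set \<Rightarrow> bool" where
  "subshift G A X \<longleftrightarrow>
     closedin (full_shift_topology G A) X \<and> (\<forall>g\<in>carrier G. \<forall>x\<in>X. shift G g x \<in> X)"

definition subshift_topology ::
    "('g, 'z) monoid_scheme \<Rightarrow> 'b set \<Rightarrow> ('g \<Rightarrow> 'b) set \<Rightarrow> ('g \<Rightarrow> 'b) topology" where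
  "subshift_topology G A X = subtopology (full_shift_topology G A) X"

definition shift_action ::
    "('g, 'z) monoid_scheme \<Rightarrow> ('g \<Rightarrow> 'b) set \<Rightarrow> 'g \<Rightarrow> ('g \<Rightarrow> 'b) \<Rightarrow> 'g \<Rightarrow> 'b" where
  "shift_action G X g = restrict (shift G g) X"

definition pullback ::
    "('g, 'z) monoid_scheme \<Rightarrow> 'g set \<Rightarrow> ('g \<Rightarrow> 'b) set \<Rightarrow> ('g word \<Rightarrow> 'b) set" where
  "pullback G S X = (\<lambda>x. compose (carrier (free_group S)) x (word_val G)) ` X"

definition patterns :: "'g set \<Rightarrow> 'b set \<Rightarrow> ('g word \<rightharpoonup> 'b) set" where
  "patterns S A = {p. finite (dom p) \<and> dom p \<subseteq> carrier (free_group S) \<and> ran p \<subseteq> A}"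

text \<open>
  \<^term>\<open>to_nat_on\<close> numbers the finite sets \<open>S\<close> and \<open>A\<close> arbitrarily; two numberings of a finite
  set differ by a finite permutation, so the choice does not affect recursive enumerability.
\<close>

definition word_code :: "'g set \<Rightarrow> 'g word \<Rightarrow> nat" where
  "word_code S w = list_encode (map (\<lambda>(e, g). prod_encode (of_bool e, to_nat_on S g)) w)"

definition pattern_code :: "'g set \<Rightarrow> 'b set \<Rightarrow> ('g word \<rightharpoonup> 'b) \<Rightarrow> nat" where
  "pattern_code S A p =
     set_encode {prod_encode (word_code S w, to_nat_on A a) | w a. p w = Some a}"

definition effectively_closed :: "'g set \<Rightarrow> 'b set \<Rightarrow> ('g word \<Rightarrow> 'b) set \<Rightarrow> bool" where
  "effectively_closed S A Y \<longleftrightarrow>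
     re_set (pattern_code S A `
       {p \<in> patterns S A. \<not> (\<exists>y\<in>Y. (Some \<circ> y) |` dom p = p)})"

definition effective_subshift ::
    "('g, 'z) monoid_scheme \<Rightarrow> 'b set \<Rightarrow> ('g \<Rightarrow> 'b) set \<Rightarrow> bool" where
  "effective_subshift G A X \<longleftrightarrow>
     subshift G A X \<and>
     (\<exists>S. finite_generating_set G S \<and> effectively_closed S A (pullback G S X))"

end

theory Submission
  imports Defs
begin

text \<open>
  If \<open>X\<close> is effective, numbering the reduced words realises the pullback of \<open>X\<close> as a compact set
  \<open>K\<close> in Baire space. A finite union of basic balls depends on finitely many coordinates, so it
  covers \<open>K\<close> iff every finite pattern outside of it is forbidden; a generator acts by a recursive
  reindexing of the coordinates.

  Conversely, let \<open>X\<close> be conjugate to a computable action on \<open>K\<close>. The set of points with a given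
  symbol at the identity is clopen, hence cut out of \<open>K\<close> by a finite union of basic balls. The
  inverse of a computable self-homeomorphism of a recursively compact set is computable, so the
  preimage of these balls under any word is semidecidable uniformly in the word, and a pattern is
  forbidden iff the preimages that contradict it cover \<open>K\<close>.
\<close>

section \<open>Recursive functions of fixed arity\<close>

text \<open>Compactness makes both sides speak of coverings: a finite pattern is forbidden iff the
  open sets that contradict it cover the system, and this is confirmed by a finite subcover. The
  main obstacle is that the conjugacy need not be computable. It enters the algorithm only through
  the images of the sets of points with symbol \<open>b\<close> at the identity; each image is cut
  out of \<open>K\<close> by finitely many balls, and as the alphabet is finite the resulting table
  is a constant of the program. All other coordinates are reached by the action: the value of
  \<open>x\<close> at the group element of \<open>w\<close> is the value at the identity of
  \<open>x\<close> shifted by the inverse of that element. This is why inverses of generators must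
  act computably, and why the enumeration of preimages has to be uniform in the word. Past the basic
  closure rules hardly any program is written down: semidecidable predicates are projections of
  decidable ones, and the normal form section is the bridge to \<open>evals\<close>.\<close>

definition recursive_nary :: "nat \<Rightarrow> (nat list \<Rightarrow> nat) \<Rightarrow> bool" where
  "recursive_nary k F \<longleftrightarrow> (\<exists>r. \<forall>xs. length xs = k \<longrightarrow> evals r xs (F xs))"

lemma recursive_nary_cong:
  "recursive_nary k F \<Longrightarrow> (\<And>xs. length xs = k \<Longrightarrow> F xs = G xs) \<Longrightarrow> recursive_nary k G"
  by (auto simp: recursive_nary_def)

lemma recursive_nary_proj: "i < k \<Longrightarrow> recursive_nary k (\<lambda>xs. xs ! i)"
  unfolding recursive_nary_def by (auto intro!: exI[of _ "RProj i"] evals.proj)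

lemma recursive_nary_zero: "recursive_nary k (\<lambda>xs. 0)"
  unfolding recursive_nary_def by (auto intro!: exI[of _ RZero] evals.zero)

lemma recursive_nary_comp:
  assumes "recursive_nary j F" "length Gs = j" "\<forall>G\<in>set Gs. recursive_nary k G"
  shows "recursive_nary k (\<lambda>xs. F (map (\<lambda>G. G xs) Gs))"
proof -
  from assms(1) obtain f where f: "\<And>xs. length xs = j \<Longrightarrow> evals f xs (F xs)"
    by (auto simp: recursive_nary_def)
  have "\<exists>gs. \<forall>xs. length xs = k \<longrightarrow> list_all2 (\<lambda>g y. evals g xs y) gs (map (\<lambda>G. G xs) Gs)"
    using assms(3)
  proof (induction Gs)
    case (Cons G Gs)
    then obtain gs g where "\<forall>xs. length xs = k \<longrightarrow> list_all2 (\<lambda>g y. evals g xs y) gs (map (\<lambda>G. G xs)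
        Gs)"
      "\<forall>xs. length xs = k \<longrightarrow> evals g xs (G xs)" by (auto simp: recursive_nary_def)
    then show ?case by (intro exI[of _ "g # gs"]) simp
  qed (auto intro: exI[of _ "[]"])
  then obtain gs where "\<And>xs. length xs = k \<Longrightarrow> list_all2 (\<lambda>g y. evals g xs y) gs (map (\<lambda>G. G xs) Gs)"
    by blast
  then show ?thesis
    unfolding recursive_nary_def using f assms(2) by (intro exI[of _ "RComp f gs"])
        (auto intro!: evals.comp)
qed

lemma recursive_nary_Suc: "recursive_nary k F \<Longrightarrow> recursive_nary k (\<lambda>xs. Suc (F xs))"
proof -
  have "recursive_nary 1 (\<lambda>xs. Suc (xs ! 0))"
    unfolding recursive_nary_def by (auto intro!: exI[of _ RSucc] evals.succ simp: length_Suc_conv)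
  from recursive_nary_comp[OF this, of "[F]"] show "recursive_nary k F \<Longrightarrow> ?thesis" by simp
qed

lemma recursive_nary_const: "recursive_nary k (\<lambda>xs. c)"
  by (induction c) (auto intro: recursive_nary_zero recursive_nary_Suc)

lemma recursive_nary_comp1:
  "recursive_nary 1 (\<lambda>xs. f (xs ! 0)) \<Longrightarrow> recursive_nary k F \<Longrightarrow> recursive_nary k (\<lambda>xs. f (F xs))"
  using recursive_nary_comp[of 1 "\<lambda>xs. f (xs ! 0)" "[F]"] by simp

lemma recursive_nary_comp2:
  "recursive_nary 2 (\<lambda>xs. f (xs ! 0) (xs ! 1)) \<Longrightarrow> recursive_nary k F \<Longrightarrow> recursive_nary k G \<Longrightarrow>
    recursive_nary k (\<lambda>xs. f (F xs) (G xs))"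
  using recursive_nary_comp[of 2 "\<lambda>xs. f (xs ! 0) (xs ! 1)" "[F, G]"] by simp

lemma recursive_nary_prec:
  assumes "recursive_nary k A" "recursive_nary (Suc (Suc k)) B" "recursive_nary k N"
  shows "recursive_nary k (\<lambda>xs. rec_nat (A xs) (\<lambda>i y. B (i # y # xs)) (N xs))"
proof -
  from assms obtain a b where a: "\<And>xs. length xs = k \<Longrightarrow> evals a xs (A xs)"
    and b: "\<And>xs. length xs = Suc (Suc k) \<Longrightarrow> evals b xs (B xs)"
    by (auto simp: recursive_nary_def)
  define F where "F xs = rec_nat (A (tl xs)) (\<lambda>i y. B (i # y # tl xs)) (hd xs)" for xs
  have "evals (RPrec a b) (n # xs) (F (n # xs))" if "length xs = k" for n xs
    using that by (induction n) (auto simp: F_def intro!: evals.prec_0 evals.prec_Suc a b)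
  then have F: "recursive_nary (Suc k) F"
    unfolding recursive_nary_def by (auto intro!: exI[of _ "RPrec a b"] simp: length_Suc_conv)
  \<comment> \<open>\<open>RPrec\<close> expects the recursion variable in front of the parameters,
    so the arguments are \<open>N xs\<close> followed by all projections, which rebuild
    \<open>xs\<close>.\<close>
  have "recursive_nary k (\<lambda>xs. F (map (\<lambda>G. G xs) (N # map (\<lambda>i xs. xs ! i) [0..<k])))"
    by (rule recursive_nary_comp[OF F]) (use assms(3) in \<open>auto intro: recursive_nary_proj\<close>)
  moreover have "map (\<lambda>G. G xs) (map (\<lambda>i xs. xs ! i) [0..<k]) = xs" if "length xs = k" for xs ::
      "nat list"
    using that by (auto intro: nth_equalityI)
  ultimately show ?thesis by (elim recursive_nary_cong) (simp add: F_def)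
qed

lemma recursive_nary_prec1:
  assumes "recursive_nary 1 (\<lambda>xs. c)" "recursive_nary 3 (\<lambda>xs. b (xs ! 0) (xs ! 1) (xs ! 2))"
  shows "recursive_nary 1 (\<lambda>xs. rec_nat c (\<lambda>i y. b i y (xs ! 0)) (xs ! 0))"
  using recursive_nary_prec[OF assms(1), of "\<lambda>xs. b (xs ! 0) (xs ! 1) (xs ! 2)" "\<lambda>xs. xs ! 0"]
      assms(2)
  by (simp add: numeral_eq_Suc recursive_nary_proj)

lemma recursive_nary_prec2:
  assumes "recursive_nary 2 (\<lambda>xs. a (xs ! 0) (xs ! 1))"
      "recursive_nary 4 (\<lambda>xs. b (xs ! 0) (xs ! 1) (xs ! 2) (xs ! 3))"
  shows "recursive_nary 2 (\<lambda>xs. rec_nat (a (xs ! 0) (xs ! 1)) (\<lambda>i y. b i y (xs ! 0) (xs ! 1)) (xs !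
      1))"
  using recursive_nary_prec[OF assms(1), of "\<lambda>xs. b (xs ! 0) (xs ! 1) (xs ! 2) (xs ! 3)"
      "\<lambda>xs. xs ! 1"] assms(2)
  by (simp add: numeral_eq_Suc recursive_nary_proj)

section \<open>Arithmetic by primitive recursion, and the inverse of the pairing function\<close>

lemma recursive_nary_add: "recursive_nary 2 (\<lambda>xs. xs ! 0 + xs ! 1)"
proof -
  have "rec_nat m (\<lambda>i y. Suc y) n = m + n" for m n :: nat by (induction n) auto
  moreover have "recursive_nary 2 (\<lambda>xs. rec_nat (xs ! 0) (\<lambda>i y. Suc y) (xs ! 1))"
    by (rule recursive_nary_prec2[of "\<lambda>x y. x" "\<lambda>i y m n. Suc y"]) (intro recursive_nary_proj
        recursive_nary_Suc; simp)+
  ultimately show ?thesis by simp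
qed

lemma recursive_nary_mult: "recursive_nary 2 (\<lambda>xs. xs ! 0 * xs ! 1)"
proof -
  have "rec_nat 0 (\<lambda>i y. y + m) n = m * n" for m n :: nat by (induction n) auto
  moreover have "recursive_nary 2 (\<lambda>xs. rec_nat 0 (\<lambda>i y. y + xs ! 0) (xs ! 1))"
    by (rule recursive_nary_prec2[of "\<lambda>x y. 0" "\<lambda>i y m n. y + m"])
       (intro recursive_nary_proj recursive_nary_zero recursive_nary_comp2[OF recursive_nary_add];
           simp)+
  ultimately show ?thesis by simp
qed

lemma recursive_nary_pred: "recursive_nary 1 (\<lambda>xs. xs ! 0 - 1)"
proof -
  have "rec_nat 0 (\<lambda>i y. i) n = n - 1" for n :: nat by (induction n) auto
  moreover have "recursive_nary 1 (\<lambda>xs. rec_nat 0 (\<lambda>i y. i) (xs ! 0))"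
    by (rule recursive_nary_prec1[of 0 "\<lambda>i y n. i"]) (intro recursive_nary_proj recursive_nary_zero;
        simp)+
  ultimately show ?thesis by simp
qed

lemma recursive_nary_diff: "recursive_nary 2 (\<lambda>xs. xs ! 0 - xs ! 1)"
proof -
  have "rec_nat m (\<lambda>i y. y - 1) n = m - n" for m n :: nat by (induction n) auto
  moreover have "recursive_nary 2 (\<lambda>xs. rec_nat (xs ! 0) (\<lambda>i y. y - 1) (xs ! 1))"
    by (rule recursive_nary_prec2[of "\<lambda>x y. x" "\<lambda>i y m n. y - 1"])
       (intro recursive_nary_proj recursive_nary_comp1[OF recursive_nary_pred]; simp)+
  ultimately show ?thesis by simp
qed

lemma recursive_nary_triangle: "recursive_nary 1 (\<lambda>xs. triangle (xs ! 0))"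
proof -
  have "rec_nat 0 (\<lambda>i y. y + Suc i) n = triangle n" for n :: nat by (induction n) auto
  moreover have "recursive_nary 1 (\<lambda>xs. rec_nat 0 (\<lambda>i y. y + Suc i) (xs ! 0))"
    by (rule recursive_nary_prec1[of 0 "\<lambda>i y n. y + Suc i"])
       (intro recursive_nary_proj recursive_nary_zero recursive_nary_Suc
           recursive_nary_comp2[OF recursive_nary_add]; simp)+
  ultimately show ?thesis by simp
qed

lemma recursive_nary_prod_encode: "recursive_nary 2 (\<lambda>xs. prod_encode (xs ! 0, xs ! 1))"
  unfolding prod_encode_def prod.case
  by (intro recursive_nary_comp2[OF recursive_nary_add]
      recursive_nary_comp1[OF recursive_nary_triangle] recursive_nary_proj) auto

text \<open>The index of the antidiagonal of the pair. Since \<open>prod_encode (m, n)\<close> is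
  \<open>triangle (m + n) + m\<close>, both components are recovered from it by subtraction.\<close>

definition prod_diag :: "nat \<Rightarrow> nat" where
  "prod_diag n = fst (prod_decode n) + snd (prod_decode n)"

lemma triangle_prod_diag: "triangle (prod_diag n) + fst (prod_decode n) = n"
proof -
  have "prod_encode (fst (prod_decode n), snd (prod_decode n)) = n" by simp
  then show ?thesis unfolding prod_encode_def prod_diag_def by (simp add: split_beta)
qed

lemma triangle_mono: "m \<le> n \<Longrightarrow> triangle m \<le> triangle n"
  by (induction rule: dec_induct) auto

text \<open>The triangular numbers cut the naturals into consecutive intervals, one per
  antidiagonal, so the index can be tracked without decoding.\<close>

lemma prod_diag_iff: "prod_diag n = k \<longleftrightarrow> triangle k \<le> n \<and> n < triangle (Suc k)"
proof -
  have "fst (prod_decode n) \<le> prod_diag n" by (simp add: prod_diag_def)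
  then have a: "triangle (prod_diag n) \<le> n" "n < triangle (Suc (prod_diag n))"
    using triangle_prod_diag[of n] by simp_all
  have "i \<le> j" if "triangle i \<le> n" "n < triangle (Suc j)" for i j
    using triangle_mono[of "Suc j" i] that by (cases "i \<le> j") auto
  with a show ?thesis by (auto intro: antisym)
qed

lemma recursive_nary_prod_diag: "recursive_nary 1 (\<lambda>xs. prod_diag (xs ! 0))"
proof -
  \<comment> \<open>Truncated subtraction makes the second summand 1 exactly when
    \<open>Suc i\<close> has reached \<open>triangle (Suc y)\<close>, that is, when the next
    antidiagonal begins.\<close>
  let ?b = "\<lambda>i y. y + (1 - (triangle (Suc y) - Suc i))"
  have "rec_nat 0 ?b n = prod_diag n" for n
  proof (induction n)
    case 0
    have "prod_diag 0 = 0" by (simp add: prod_diag_iff)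
    then show ?case by simp
  next
    case (Suc n)
    have "triangle (prod_diag n) \<le> n" "n < triangle (Suc (prod_diag n))"
      using prod_diag_iff[of n] by blast+
    then have k: "triangle (prod_diag n) \<le> n" "n < triangle (prod_diag n) + Suc (prod_diag n)"
      by simp_all
    have "prod_diag (Suc n) = prod_diag n + (1 - (triangle (Suc (prod_diag n)) - Suc n))"
    proof (cases "triangle (Suc (prod_diag n)) \<le> Suc n")
      case True
      with k have "prod_diag (Suc n) = Suc (prod_diag n)" by (simp add: prod_diag_iff)
      with True show ?thesis by simp
    next
      case False
      with k have "prod_diag (Suc n) = prod_diag n" by (simp add: prod_diag_iff)
      with False show ?thesis by simp
    qed
    with Suc.IH show ?case by simp
  qed
  moreover have "recursive_nary 1 (\<lambda>xs. rec_nat 0 (\<lambda>i y. ?b i y) (xs ! 0))"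
    by (rule recursive_nary_prec1[of 0 "\<lambda>i y n. ?b i y"])
       (intro recursive_nary_proj recursive_nary_zero recursive_nary_comp2[OF recursive_nary_add]
           recursive_nary_comp2[OF recursive_nary_diff] recursive_nary_const
           recursive_nary_comp1[OF recursive_nary_triangle] recursive_nary_Suc; simp)+
  ultimately show ?thesis by simp
qed

lemma recursive_nary_fst_decode: "recursive_nary 1 (\<lambda>xs. fst (prod_decode (xs ! 0)))"
proof -
  have "n - triangle (prod_diag n) = fst (prod_decode n)" for n using triangle_prod_diag[of n]
      by simp
  moreover have "recursive_nary 1 (\<lambda>xs. xs ! 0 - triangle (prod_diag (xs ! 0)))"
    by (intro recursive_nary_comp2[OF recursive_nary_diff] recursive_nary_proj
        recursive_nary_comp1[OF recursive_nary_triangle]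
        recursive_nary_comp1[OF recursive_nary_prod_diag]) auto
  ultimately show ?thesis by simp
qed

lemma recursive_nary_snd_decode: "recursive_nary 1 (\<lambda>xs. snd (prod_decode (xs ! 0)))"
proof -
  have "prod_diag n - fst (prod_decode n) = snd (prod_decode n)" for n by (simp add: prod_diag_def)
  moreover have "recursive_nary 1 (\<lambda>xs. prod_diag (xs ! 0) - fst (prod_decode (xs ! 0)))"
    by (intro recursive_nary_comp2[OF recursive_nary_diff] recursive_nary_proj
        recursive_nary_comp1[OF recursive_nary_fst_decode]
        recursive_nary_comp1[OF recursive_nary_prod_diag]) auto
  ultimately show ?thesis by simp
qed


section \<open>Recursive functions between coded types\<close>

text \<open>
  Codes are bijective, so that a quantifier over a coded type is a quantifier over its codes.
\<close>

class coded =
  fixes enc :: "'a \<Rightarrow> nat"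
  assumes bij_enc: "bij enc"
begin

definition dcd :: "nat \<Rightarrow> 'a" where "dcd = inv_into UNIV enc"

lemma enc_dcd [simp]: "enc (dcd n) = n"
  using bij_enc by (simp add: dcd_def bij_is_surj surj_f_inv_f)

lemma dcd_enc [simp]: "dcd (enc x) = x"
  using bij_enc by (simp add: dcd_def bij_is_inj)

lemma enc_eq_iff [simp]: "enc x = enc y \<longleftrightarrow> x = y"
  using bij_enc by (simp add: bij_is_inj inj_eq)

end

instantiation nat :: coded
begin
definition enc_nat_def [simp]: "enc n = (n::nat)"
instance by standard (auto simp: bij_def inj_def surj_def)
end

instantiation prod :: (coded, coded) coded
begin
definition enc_prod :: "'a \<times> 'b \<Rightarrow> nat" where "enc_prod p = prod_encode (enc (fst p), enc (snd p))"
instance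
proof
  show "bij (enc :: 'a \<times> 'b \<Rightarrow> nat)"
    by (rule bij_betw_byWitness[where f' =
        "\<lambda>n. (dcd (fst (prod_decode n)), dcd (snd (prod_decode n)))"])
       (auto simp: enc_prod_def)
qed
end

lemma enc_Pair [simp]: "enc (x, y) = prod_encode (enc x, enc y)"
  by (simp add: enc_prod_def)

instantiation list :: (coded) coded
begin
definition enc_list :: "'a list \<Rightarrow> nat" where "enc_list xs = list_encode (map enc xs)"
instance
proof
  have [simp]: "dcd \<circ> enc = (id :: 'a \<Rightarrow> 'a)" "enc \<circ> dcd = (id :: nat \<Rightarrow> nat)" by auto
  show "bij (enc :: 'a list \<Rightarrow> nat)"
    by (rule bij_betw_byWitness[where f' = "\<lambda>n. map dcd (list_decode n)"]) (auto simp: enc_list_def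
        o_def)
qed
end

lemma enc_Nil [simp]: "enc [] = 0" and enc_Cons [simp]:
    "enc (x # xs) = Suc (prod_encode (enc x, enc xs))"
  by (simp_all add: enc_list_def)

lemma enc_nat_list: "enc (xs :: nat list) = list_encode xs"
  by (simp add: enc_list_def map_idI)

definition recursive :: "('a::coded \<Rightarrow> 'b::coded) \<Rightarrow> bool" where
  "recursive f \<longleftrightarrow> (\<exists>r. \<forall>x. evals r [enc x] (enc (f x)))"

lemma recursive_iff_nary: "recursive f \<longleftrightarrow> recursive_nary 1 (\<lambda>xs. enc (f (dcd (xs ! 0))))"
proof
  assume "recursive f"
  then obtain r where "\<And>x. evals r [enc x] (enc (f x))" by (auto simp: recursive_def)
  from this[of "dcd _"] show "recursive_nary 1 (\<lambda>xs. enc (f (dcd (xs ! 0))))"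
    unfolding recursive_nary_def by (intro exI[of _ r]) (auto simp: length_Suc_conv)
next
  assume "recursive_nary 1 (\<lambda>xs. enc (f (dcd (xs ! 0))))"
  then obtain r where r: "\<And>xs. length xs = 1 \<Longrightarrow> evals r xs (enc (f (dcd (xs ! 0))))"
    unfolding recursive_nary_def by blast
  have "evals r [enc x] (enc (f x))" for x using r[of "[enc x]"] by simp
  then show "recursive f" by (auto simp: recursive_def)
qed

text \<open>Moves a function into an arbitrary coded type to one into \<open>nat\<close>, where
  arithmetic is available.\<close>

lemma recursive_via_enc: "recursive (\<lambda>x. enc (f x)) \<longleftrightarrow> recursive f"
  by (simp add: recursive_def)

lemma recursive_id: "recursive (\<lambda>x. x)"
  unfolding recursive_iff_nary by (simp add: recursive_nary_proj)

lemma recursive_dcd: "recursive f \<Longrightarrow> recursive (\<lambda>x. dcd (f x))"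
  by (simp add: recursive_def)

lemma recursive_enc: "recursive f \<Longrightarrow> recursive (\<lambda>x. enc (f x))"
  by (simp add: recursive_def)

lemma recursive_const: "recursive (\<lambda>x. c)"
  unfolding recursive_iff_nary by (simp add: recursive_nary_const)

lemma recursive_comp:
  assumes "recursive F" "recursive f" shows "recursive (\<lambda>x. F (f x))"
  using recursive_nary_comp1[OF assms(1)[unfolded recursive_iff_nary] assms(2)[unfolded
      recursive_iff_nary]]
  by (simp add: recursive_iff_nary)

lemma recursive_via_nary2:
  assumes "recursive_nary 2 (\<lambda>xs. F (xs ! 0) (xs ! 1))" "recursive f" "recursive g" shows
      "recursive (\<lambda>x. F (f x) (g x))"
  using recursive_nary_comp2[OF assms(1) assms(2)[unfolded recursive_iff_nary] assms(3)[unfolded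
      recursive_iff_nary]]
  by (simp add: recursive_iff_nary)

lemma recursive_via_nary1:
  assumes "recursive_nary 1 (\<lambda>xs. F (xs ! 0))" "recursive f" shows "recursive (\<lambda>x. F (f x))"
  using recursive_nary_comp1[OF assms(1) assms(2)[unfolded recursive_iff_nary]]
  by (simp add: recursive_iff_nary)

lemma recursive_Suc: "recursive f \<Longrightarrow> recursive (\<lambda>x. Suc (f x))"
  by (intro recursive_via_nary1[of Suc] recursive_nary_Suc recursive_nary_proj) auto

lemmas recursive_add = recursive_via_nary2[OF recursive_nary_add]
    and recursive_mult = recursive_via_nary2[OF recursive_nary_mult]
    and recursive_diff = recursive_via_nary2[OF recursive_nary_diff]

lemma recursive_Pair: "recursive f \<Longrightarrow> recursive g \<Longrightarrow> recursive (\<lambda>x. (f x, g x))"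
  using recursive_via_nary2[of "\<lambda>x y. prod_encode (x, y)", OF recursive_nary_prod_encode
      recursive_enc recursive_enc, of f g]
  by (simp add: recursive_def)

lemma recursive_fst: "recursive f \<Longrightarrow> recursive (\<lambda>x. fst (f x))"
  using recursive_via_nary1[OF recursive_nary_fst_decode recursive_enc, of f]
      by (simp add: recursive_def enc_prod_def)

lemma recursive_snd: "recursive f \<Longrightarrow> recursive (\<lambda>x. snd (f x))"
  using recursive_via_nary1[OF recursive_nary_snd_decode recursive_enc, of f]
      by (simp add: recursive_def enc_prod_def)

lemma recursive_Cons: "recursive f \<Longrightarrow> recursive g \<Longrightarrow> recursive (\<lambda>x. f x # g x)"
  using recursive_Suc[OF recursive_enc[OF recursive_Pair], of f g] by (simp add: recursive_def)

lemma recursive_prod_encode: "recursive f \<Longrightarrow> recursive (\<lambda>x. prod_encode (f x))"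
  using recursive_enc[of f] by (simp add: enc_prod_def)

lemma recursive_prod_decode: "recursive f \<Longrightarrow> recursive (\<lambda>x. prod_decode (f x))"
  by (simp add: recursive_def enc_prod_def)

lemma recursive_list_encode: "recursive f \<Longrightarrow> recursive (\<lambda>x. list_encode (f x))"
  by (simp add: recursive_def enc_nat_list)

lemma recursive_list_decode: "recursive f \<Longrightarrow> recursive (\<lambda>x. list_decode (f x))"
  by (simp add: recursive_def enc_nat_list)

lemma recursive_tl: "recursive f \<Longrightarrow> recursive (\<lambda>x. tl (f x))"
proof -
  \<comment> \<open>One formula serves both cases: for the empty list truncated subtraction leaves
    0, which decodes to \<open>(0, 0)\<close>.\<close>
  have *: "enc (tl xs) = snd (prod_decode (enc xs - 1))" for xs :: "'b list"
  proof (cases xs)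
    case Nil
    have "prod_encode (0, 0) = 0" by (simp add: prod_encode_def)
    then have "prod_decode 0 = (0, 0)" by (metis prod_encode_inverse)
    with Nil show ?thesis by simp
  qed simp
  show "recursive f \<Longrightarrow> ?thesis"
    by (subst recursive_via_enc[symmetric], unfold *) (intro recursive_snd recursive_prod_decode
        recursive_diff recursive_enc recursive_const)
qed

definition hd0 :: "nat list \<Rightarrow> nat" where
  "hd0 xs = (case xs of [] \<Rightarrow> 0 | x # _ \<Rightarrow> x)"

lemma hd0_simps [simp]: "hd0 [] = 0" "hd0 (x # xs) = x"
  by (simp_all add: hd0_def)

lemma recursive_hd0: "recursive f \<Longrightarrow> recursive (\<lambda>x. hd0 (f x))"
proof -
  have *: "hd0 xs = fst (prod_decode (enc xs - 1))" for xs :: "nat list"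
  proof (cases xs)
    case Nil
    have "prod_encode (0, 0) = 0" by (simp add: prod_encode_def)
    then have "prod_decode 0 = (0, 0)" by (metis prod_encode_inverse)
    with Nil show ?thesis by simp
  qed simp
  show "recursive f \<Longrightarrow> ?thesis"
    by (unfold *) (intro recursive_fst recursive_prod_decode recursive_diff recursive_enc
        recursive_const)
qed

lemma recursive_rec_nat:
  assumes a: "recursive a" and b: "recursive (\<lambda>p. b (fst p) (fst (snd p)) (snd (snd p)))" and n:
      "recursive n"
  shows "recursive (\<lambda>x. rec_nat (a x) (\<lambda>i y. b x i y) (n x))"
proof -
  \<comment> \<open>The step \<open>b\<close> read through the codes, with counter, previous value
    and parameter in the order of \<open>RPrec\<close>.\<close>
  define B where "B xs = enc (b (dcd (xs ! 2)) (xs ! 0) (dcd (xs ! 1)))" for xs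
  let ?F = "\<lambda>p. b (fst p) (fst (snd p)) (snd (snd p))"
  have "recursive_nary 3 (\<lambda>xs. enc (?F (dcd (prod_encode (xs ! 2, prod_encode (xs ! 0, xs ! 1))))))"
    by (rule recursive_nary_comp1[OF b[unfolded recursive_iff_nary]])
       (intro recursive_nary_comp2[OF recursive_nary_prod_encode] recursive_nary_proj; simp)
  moreover have "(dcd (prod_encode (k, prod_encode (i, j))) :: 'a \<times> nat \<times> 'b) = (dcd k, i, dcd j)"
      for i j k
    by (subst enc_eq_iff[symmetric]) (simp del: enc_eq_iff)
  ultimately have B: "recursive_nary (Suc (Suc 1)) B"
    by (simp add: B_def[abs_def] numeral_eq_Suc)
  have "rec_nat (enc (a (dcd k))) (\<lambda>i y. B [i, y, k]) m = enc (rec_nat (a (dcd k)) (\<lambda>i y. b (dcd k)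
      i y) m)" for m k
    by (induction m) (auto simp: B_def)
  then show ?thesis
    unfolding recursive_iff_nary
    by (rule_tac recursive_nary_cong[OF recursive_nary_prec[OF a[unfolded recursive_iff_nary] B
        n[unfolded recursive_iff_nary]]])
       (auto simp: length_Suc_conv)
qed


section \<open>Decidable and semidecidable predicates\<close>

definition decidable :: "('a::coded \<Rightarrow> bool) \<Rightarrow> bool" where
  "decidable P \<longleftrightarrow> recursive (\<lambda>x. of_bool (P x) :: nat)"

lemma decidable_comp: "decidable P \<Longrightarrow> recursive f \<Longrightarrow> decidable (\<lambda>x. P (f x))"
  unfolding decidable_def by (rule recursive_comp)

lemma decidable_not: "decidable P \<Longrightarrow> decidable (\<lambda>x. \<not> P x)"
proof -
  have "(of_bool (\<not> P x) :: nat) = 1 - of_bool (P x)" for x by simp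
  then show "decidable P \<Longrightarrow> ?thesis" unfolding decidable_def by (simp only:)
      (intro recursive_diff recursive_const)
qed

lemma decidable_conj: "decidable P \<Longrightarrow> decidable Q \<Longrightarrow> decidable (\<lambda>x. P x \<and> Q x)"
proof -
  have "(of_bool (P x \<and> Q x) :: nat) = of_bool (P x) * of_bool (Q x)" for x by simp
  then show "decidable P \<Longrightarrow> decidable Q \<Longrightarrow> ?thesis" unfolding decidable_def by (simp only:)
      (intro recursive_mult)
qed

lemma decidable_disj: "decidable P \<Longrightarrow> decidable Q \<Longrightarrow> decidable (\<lambda>x. P x \<or> Q x)"
  using decidable_not[OF decidable_conj[OF decidable_not decidable_not], of P Q] by simp

lemma decidable_imp: "decidable P \<Longrightarrow> decidable Q \<Longrightarrow> decidable (\<lambda>x. P x \<longrightarrow> Q x)"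
  using decidable_disj[OF decidable_not, of P Q] by simp

lemma decidable_le: "recursive f \<Longrightarrow> recursive g \<Longrightarrow> decidable (\<lambda>x. f x \<le> (g x :: nat))"
proof -
  have "(of_bool (f x \<le> g x) :: nat) = 1 - (f x - g x)" for x by simp
  then show "recursive f \<Longrightarrow> recursive g \<Longrightarrow> ?thesis" unfolding decidable_def by (simp only:)
      (intro recursive_diff recursive_const)
qed

lemma decidable_less: "recursive f \<Longrightarrow> recursive g \<Longrightarrow> decidable (\<lambda>x. f x < (g x :: nat))"
  using decidable_not[OF decidable_le, of g f] by (simp add: not_le)

lemma decidable_eq: "recursive f \<Longrightarrow> recursive g \<Longrightarrow> decidable (\<lambda>x. f x = g x)"
proof -
  have "f x = g x \<longleftrightarrow> enc (f x) \<le> enc (g x) \<and> enc (g x) \<le> enc (f x)" for x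
    by (metis antisym enc_eq_iff order_refl)
  then show "recursive f \<Longrightarrow> recursive g \<Longrightarrow> ?thesis"
    by (simp only:) (intro decidable_conj decidable_le recursive_enc)
qed

lemma decidable_const: "decidable (\<lambda>x. b)"
  unfolding decidable_def by (rule recursive_const)

lemma recursive_if:
  "decidable P \<Longrightarrow> recursive f \<Longrightarrow> recursive g \<Longrightarrow> recursive (\<lambda>x. if P x then f x else g x)"
proof -
  have "enc (if P x then f x else g x) = of_bool (P x) * enc (f x) + (1 - of_bool (P x)) * enc (g
      x)" for x
    by simp
  then show "decidable P \<Longrightarrow> recursive f \<Longrightarrow> recursive g \<Longrightarrow> ?thesis"
    by (subst recursive_via_enc[symmetric]) (unfold decidable_def, simp only:, intro recursive_add
        recursive_mult recursive_diff recursive_const recursive_enc)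
qed

section \<open>Sums, bounded quantifiers, division and access to lists\<close>

lemma recursive_sum:
  fixes f :: "'a::coded \<Rightarrow> nat \<Rightarrow> nat"
  assumes f: "recursive (\<lambda>p. f (fst p) (snd p))" and n: "recursive n"
  shows "recursive (\<lambda>x. \<Sum>i<n x. f x i)"
proof -
  have "(\<Sum>i<m. f x i) = rec_nat 0 (\<lambda>i y. y + f x i) m" for x m by (induction m) simp_all
  then show ?thesis using n
    by (simp only:) (intro recursive_rec_nat recursive_const recursive_add recursive_snd
        recursive_id recursive_comp[OF f, of "\<lambda>p. (fst p, fst (snd p))", simplified] recursive_Pair
        recursive_fst)
qed

lemma recursive_power:
  assumes "recursive f" "recursive n"
  shows "recursive (\<lambda>x. (f x :: nat) ^ n x)"
proof -
  have "m ^ n = rec_nat 1 (\<lambda>i y. m * y) n" for m n :: nat by (induction n) simp_all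
  then show ?thesis
    by (simp only:) (intro recursive_rec_nat recursive_const recursive_mult recursive_snd
        recursive_id recursive_comp[OF assms(1)] assms(2) recursive_fst)
qed

lemma decidable_all_less:
  assumes n: "recursive n" and P: "decidable (\<lambda>p. P (fst p) (snd p))"
  shows "decidable (\<lambda>x. \<forall>i<n x. P x (i::nat))"
proof -
  \<comment> \<open>The sum counts the counterexamples below the bound.\<close>
  have "(\<forall>i<m. P x i) \<longleftrightarrow> (\<Sum>i<m. of_bool (\<not> P x i)) \<le> (0::nat)" for x m
    by (subst le_zero_eq, subst sum_eq_0_iff) auto
  then show ?thesis
    by (simp only:) (intro decidable_le recursive_sum recursive_const n
        decidable_not[OF P, unfolded decidable_def])
qed

lemma decidable_ex_less:
  assumes "recursive n" "decidable (\<lambda>p. P (fst p) (snd p))"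
  shows "decidable (\<lambda>x. \<exists>i<n x. P x (i::nat))"
  using decidable_not[OF decidable_all_less[OF assms(1) decidable_not[OF assms(2)]]] by simp

lemma recursive_div:
  assumes "recursive f" "recursive g"
  shows "recursive (\<lambda>x. f x div (g x :: nat))"
proof -
  \<comment> \<open>The quotient is the number of positive multiples of \<open>n\<close> up to
    \<open>m\<close>; the guard \<open>n > 0\<close> yields the value 0 that \<open>div\<close> has
    at a zero divisor.\<close>
  have "m div n = (\<Sum>q<m. of_bool (n > 0 \<and> Suc q * n \<le> m))" for m n :: nat
  proof (cases "n = 0")
    case False
    then have "Suc q * n \<le> m \<longleftrightarrow> q < m div n" for q
      by (simp add: less_eq_div_iff_mult_less_eq Suc_le_eq[symmetric])
    moreover have "{q. q < m \<and> q < m div n} = {..<m div n}" by auto (metis div_le_dividend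
        order_less_le_trans)
    ultimately show ?thesis using False by (simp add: sum_of_bool_eq Int_def)
  qed simp
  moreover have "decidable (\<lambda>p. 0 < g (fst p) \<and> Suc (snd p) * g (fst p) \<le> f (fst p))"
    by (intro recursive_const recursive_mult recursive_Suc recursive_id decidable_conj
        decidable_less decidable_le recursive_comp[OF assms(1)] recursive_comp[OF assms(2)]
        recursive_fst recursive_snd)
  ultimately show ?thesis using assms(1)
    by (simp only:) (intro recursive_sum, auto simp: decidable_def)
qed

lemma recursive_mod: "recursive f \<Longrightarrow> recursive g \<Longrightarrow> recursive (\<lambda>x. f x mod (g x :: nat))"
  unfolding minus_div_mult_eq_mod[symmetric] by (intro recursive_diff recursive_mult recursive_div)

lemma decidable_set_decode: "recursive f \<Longrightarrow> recursive g \<Longrightarrow> decidable (\<lambda>x. f x \<in> set_decode (g x))"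
proof -
  have "n \<in> set_decode c \<longleftrightarrow> (c div 2 ^ n) mod 2 = 1" for n c
    by (simp add: set_decode_def odd_iff_mod_2_eq_one)
  then show "recursive f \<Longrightarrow> recursive g \<Longrightarrow> ?thesis"
    by (simp only:) (intro decidable_eq recursive_mod recursive_div recursive_power recursive_const)
qed

lemma recursive_funpow:
  fixes F :: "'b::coded \<Rightarrow> 'b"
  assumes "recursive F" "recursive f" "recursive n" shows "recursive (\<lambda>x. (F ^^ n x) (f x))"
proof -
  have "(F ^^ k) y = rec_nat y (\<lambda>i z. F z) k" for k y by (induction k) simp_all
  then show ?thesis using assms(2,3)
    by (simp only:) (intro recursive_rec_nat recursive_comp[OF assms(1)] recursive_snd recursive_id)
qed

lemma recursive_drop: "recursive f \<Longrightarrow> recursive n \<Longrightarrow> recursive (\<lambda>x. drop (n x) (f x))"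
proof -
  have "drop n xs = (tl ^^ n) xs" for n and xs :: "'b list"
    by (induction n arbitrary: xs) (auto simp: drop_Suc funpow_swap1)
  then show "recursive f \<Longrightarrow> recursive n \<Longrightarrow> ?thesis" by (simp only:)
      (intro recursive_funpow recursive_tl recursive_id)
qed

definition nth0 :: "nat list \<Rightarrow> nat \<Rightarrow> nat" where
  "nth0 xs i = (if i < length xs then xs ! i else 0)"

lemma nth0_conv_drop: "nth0 xs i = hd0 (drop i xs)"
  by (cases "i < length xs") (auto simp: nth0_def Cons_nth_drop_Suc[symmetric])

lemma recursive_nth0: "recursive f \<Longrightarrow> recursive n \<Longrightarrow> recursive (\<lambda>x. nth0 (f x) (n x))"
  unfolding nth0_conv_drop by (intro recursive_hd0 recursive_drop)

lemma decidable_less_length: "recursive n \<Longrightarrow> recursive f \<Longrightarrow> decidable (\<lambda>x. n x < length (f x))"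
proof -
  have "n < length xs \<longleftrightarrow> drop n xs \<noteq> []" for n and xs :: "'b list" by auto
  then show "recursive n \<Longrightarrow> recursive f \<Longrightarrow> ?thesis" by (simp only:) (intro decidable_not decidable_eq
      recursive_drop recursive_const)
qed

lemma length_le_enc: "length xs \<le> enc xs"
proof (induction xs)
  case (Cons x xs)
  then show ?case using le_prod_encode_2[of "enc xs" "enc x"] by simp
qed simp

lemma recursive_length:
  assumes "recursive f"
  shows "recursive (\<lambda>x. length (f x))"
proof -
  \<comment> \<open>The code bounds the length, so the length is a bounded count of
    positions.\<close>
  have *: "(\<Sum>i<enc xs. of_bool (i < length xs)) = length xs" for xs :: "'b list"
  proof -
    have "{..<enc xs} \<inter> {i. i < length xs} = {..<length xs}" using length_le_enc[of xs] by auto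
    then show ?thesis by (simp add: sum_of_bool_eq)
  qed
  have "decidable (\<lambda>p. snd p < length (f (fst p)))"
    by (intro decidable_less_length recursive_snd recursive_id recursive_comp[OF assms]
        recursive_fst)
  then have "recursive (\<lambda>x. \<Sum>i<enc (f x). of_bool (i < length (f x)) :: nat)"
    by (intro recursive_sum recursive_enc assms) (simp add: decidable_def)
  then show ?thesis by (simp only: *)
qed

text \<open>The Sigma_1 form, for which closure under projection and bounded quantification is plain
  logic. \<open>semidecidable_halts\<close> and \<open>semidecidable_imp_halts\<close> identify it
  with halting.\<close>

definition semidecidable :: "('a::coded \<Rightarrow> bool) \<Rightarrow> bool" where
  "semidecidable P \<longleftrightarrow> (\<exists>Q. decidable Q \<and> (\<forall>x. P x \<longleftrightarrow> (\<exists>t::nat. Q (x, t))))"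

lemma semidecidableI: "decidable (\<lambda>p. Q (fst p) (snd p)) \<Longrightarrow> semidecidable (\<lambda>x. \<exists>t::nat. Q x t)"
  unfolding semidecidable_def by (intro exI[of _ "\<lambda>p. Q (fst p) (snd p)"]) simp

lemma semidecidableE:
  assumes "semidecidable P"
  obtains Q where "decidable (\<lambda>p. Q (fst p) (snd p :: nat))" "P = (\<lambda>x. \<exists>t. Q x t)"
proof -
  from assms obtain Q where "decidable Q" "\<And>x. P x \<longleftrightarrow> (\<exists>t::nat. Q (x, t))"
      by (auto simp: semidecidable_def)
  then show ?thesis by (intro that[of "\<lambda>x t. Q (x, t)"]) (auto simp: fun_eq_iff)
qed

lemma semidecidable_dec: "decidable P \<Longrightarrow> semidecidable P"
  using semidecidableI[of "\<lambda>x t. P x"] decidable_comp[of P fst] recursive_fst[OF recursive_id]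
      by auto

lemma semidecidable_comp: "semidecidable P \<Longrightarrow> recursive f \<Longrightarrow> semidecidable (\<lambda>x. P (f x))"
proof (elim semidecidableE)
  fix Q assume Q: "decidable (\<lambda>p. Q (fst p) (snd p :: nat))" "P = (\<lambda>x. \<exists>t. Q x t)" and f:
      "recursive f"
  have "decidable (\<lambda>p. Q (fst (f (fst p), snd p)) (snd (f (fst p), snd p)))"
    by (rule decidable_comp[OF Q(1)]) (intro recursive_Pair recursive_snd recursive_id
        recursive_comp[OF f] recursive_fst)
  then show ?thesis unfolding Q(2) by (intro semidecidableI) simp
qed

text \<open>The value sought and the witness of semidecidability are packed into one number.\<close>

lemma semidecidable_ex_nat:
  assumes "semidecidable (\<lambda>p. P (fst p) (snd p))"
  shows "semidecidable (\<lambda>x. \<exists>y::nat. P x y)"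
proof -
  from assms obtain Q where Q: "decidable (\<lambda>p. Q (fst p) (snd p :: nat))"
    "(\<lambda>p. P (fst p) (snd p)) = (\<lambda>x. \<exists>t. Q x t)" by (rule semidecidableE)
  have P: "P x y \<longleftrightarrow> (\<exists>t. Q (x, y) t)" for x y using fun_cong[OF Q(2), of "(x, y)"] by simp
  let ?f = "\<lambda>p. ((fst p, fst (prod_decode (snd p))), snd (prod_decode (snd p)))"
  have "decidable (\<lambda>p. Q (fst (?f p)) (snd (?f p)))"
    by (rule decidable_comp[OF Q(1)]) (intro recursive_Pair recursive_fst recursive_snd
        recursive_prod_decode recursive_id)
  then have "semidecidable (\<lambda>x. \<exists>t. Q (x, fst (prod_decode t)) (snd (prod_decode t)))"
    by (intro semidecidableI) simp
  moreover have "(\<exists>y. P x y) \<longleftrightarrow> (\<exists>t. Q (x, fst (prod_decode t)) (snd (prod_decode t)))" for x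
    unfolding P by (metis fst_conv prod_encode_inverse snd_conv)
  ultimately show ?thesis by simp
qed

lemma semidecidable_ex:
  fixes P :: "'a::coded \<Rightarrow> 'b::coded \<Rightarrow> bool"
  assumes "semidecidable (\<lambda>p. P (fst p) (snd p))"
  shows "semidecidable (\<lambda>x. \<exists>y. P x y)"
proof -
  let ?f = "\<lambda>p. (fst p, dcd (snd p)) :: 'a \<times> 'b"
  have "semidecidable (\<lambda>p. P (fst (?f p)) (snd (?f p)))"
    by (rule semidecidable_comp[OF assms, where f = ?f]) (intro recursive_Pair recursive_fst
        recursive_dcd recursive_snd recursive_id)
  then have "semidecidable (\<lambda>x. \<exists>t. P x (dcd t))" by (intro semidecidable_ex_nat) simp
  moreover have "(\<exists>y. P x y) \<longleftrightarrow> (\<exists>t. P x (dcd t))" for x by (metis dcd_enc)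
  ultimately show ?thesis by simp
qed

lemma semidecidable_conj: "semidecidable P \<Longrightarrow> semidecidable Q \<Longrightarrow> semidecidable (\<lambda>x. P x \<and> Q x)"
proof (elim semidecidableE)
  fix P' Q' assume P: "decidable (\<lambda>p. P' (fst p) (snd p :: nat))" "P = (\<lambda>x. \<exists>t. P' x t)"
    and Q: "decidable (\<lambda>p. Q' (fst p) (snd p :: nat))" "Q = (\<lambda>x. \<exists>t. Q' x t)"
  let ?f = "\<lambda>p. (fst (fst p), snd (fst p))" and ?g = "\<lambda>p. (fst (fst p), snd p)"
  have "decidable (\<lambda>p. P' (fst (?f p)) (snd (?f p)) \<and> Q' (fst (?g p)) (snd (?g p)))"
    by (intro decidable_conj decidable_comp[OF P(1), of ?f] decidable_comp[OF Q(1), of ?g]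
        recursive_Pair recursive_fst recursive_snd recursive_id)
  then have "semidecidable (\<lambda>x. \<exists>t s. P' x t \<and> Q' x s)"
    by (intro semidecidable_ex_nat semidecidable_dec) simp
  then show ?thesis by (simp add: P(2) Q(2))
qed

lemma semidecidable_disj: "semidecidable P \<Longrightarrow> semidecidable Q \<Longrightarrow> semidecidable (\<lambda>x. P x \<or> Q x)"
proof (elim semidecidableE)
  fix P' Q' assume P: "decidable (\<lambda>p. P' (fst p) (snd p :: nat))" "P = (\<lambda>x. \<exists>t. P' x t)"
    and Q: "decidable (\<lambda>p. Q' (fst p) (snd p :: nat))" "Q = (\<lambda>x. \<exists>t. Q' x t)"
  have "semidecidable (\<lambda>x. \<exists>t. P' x t \<or> Q' x t)"
    by (intro semidecidableI decidable_disj P Q)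
  then show ?thesis by (simp add: P(2) Q(2) ex_disj_distrib)
qed

text \<open>Bounded collection: finitely many witnesses have a common bound \<open>T\<close>, and
  once \<open>T\<close> is given all inner quantifiers are bounded, hence decidable.\<close>

lemma semidecidable_all_less:
  assumes n: "recursive n" and P: "semidecidable (\<lambda>p. P (fst p) (snd p))"
  shows "semidecidable (\<lambda>x. \<forall>i<n x. P x (i::nat))"
proof -
  from P obtain Q where Q: "decidable (\<lambda>p. Q (fst p) (snd p :: nat))"
    "(\<lambda>p. P (fst p) (snd p)) = (\<lambda>x. \<exists>t. Q x t)" by (rule semidecidableE)
  have P: "P x y \<longleftrightarrow> (\<exists>t. Q (x, y) t)" for x y using fun_cong[OF Q(2), of "(x, y)"] by simp
  let ?f = "\<lambda>p. ((fst (fst (fst p)), snd (fst p)), snd p)"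
  have "decidable (\<lambda>p. Q (fst (?f p)) (snd (?f p)))"
    by (intro decidable_comp[OF Q(1), of ?f] recursive_Pair recursive_fst recursive_snd
        recursive_id)
  then have "semidecidable (\<lambda>x. \<exists>T. \<forall>i<n x. \<exists>t<T. Q (x, i) t)"
    by (intro semidecidableI decidable_all_less decidable_ex_less recursive_snd recursive_fst
        recursive_id recursive_comp[OF n]) simp
  moreover have "(\<forall>i<n x. P x i) \<longleftrightarrow> (\<exists>T. \<forall>i<n x. \<exists>t<T. Q (x, i) t)" for x
  proof
    assume "\<forall>i<n x. P x i"
    then obtain t where t: "\<And>i. i < n x \<Longrightarrow> Q (x, i) (t i)" unfolding P by metis
    have "t i < Suc (Max (t ` {..<n x}))" if "i < n x" for i
      using that by (auto simp: less_Suc_eq_le intro!: Max_ge)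
    with t show "\<exists>T. \<forall>i<n x. \<exists>t<T. Q (x, i) t" by blast
  qed (auto simp: P)
  ultimately show ?thesis by simp
qed

lemma semidecidable_ex_less:
  assumes "recursive n" "semidecidable (\<lambda>p. P (fst p) (snd p))"
  shows "semidecidable (\<lambda>x. \<exists>i<n x. P x (i::nat))"
  by (intro semidecidable_ex semidecidable_conj assms(2) semidecidable_dec decidable_less
      recursive_snd recursive_fst recursive_id recursive_comp[OF assms(1)])


section \<open>Kleene normal form\<close>

lemma semidecidable_comp2:
  "semidecidable (\<lambda>p. P (fst p) (snd p)) \<Longrightarrow> recursive f \<Longrightarrow> recursive g \<Longrightarrow>
    semidecidable (\<lambda>x. P (f x) (g x))"
  using semidecidable_comp[of "\<lambda>p. P (fst p) (snd p)", OF _ recursive_Pair[of f g]] by simp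

lemma evals_RZero_iff: "evals RZero xs z \<longleftrightarrow> z = 0"
  by (auto elim: evals_elims intro: evals.intros)

lemma evals_RSucc_iff: "evals RSucc xs z \<longleftrightarrow> xs \<noteq> [] \<and> z = Suc (hd0 xs)"
  by (cases xs) (auto elim: evals_elims intro: evals.intros)

lemma evals_RProj_iff: "evals (RProj i) xs z \<longleftrightarrow> i < length xs \<and> z = nth0 xs i"
  by (auto simp: nth0_def elim: evals_elims intro: evals.intros)

lemma evals_RComp_iff:
  "evals (RComp f gs) xs z \<longleftrightarrow> (\<exists>ys. list_all2 (\<lambda>g y. evals g xs y) gs ys \<and> evals f ys z)"
  by (auto elim: evals_elims intro: evals.intros)

lemma evals_RMu_iff:
  "evals (RMu f) xs z \<longleftrightarrow> evals f (z # xs) 0 \<and> (\<forall>i<z. \<exists>y. evals f (i # xs) (Suc y))"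
  by (auto elim: evals_elims intro: evals.intros)

text \<open>The list \<open>ys\<close> is the history of intermediate values. It replaces recursion
  by a quantifier over lists and a bounded universal quantifier, both of which preserve
  semidecidability.\<close>

lemma evals_RPrec_iff:
  "evals (RPrec f g) xs z \<longleftrightarrow> xs \<noteq> [] \<and>
     (\<exists>ys. evals f (tl xs) (nth0 ys 0) \<and>
        (\<forall>i<hd0 xs. evals g (i # nth0 ys i # tl xs) (nth0 ys (Suc i))) \<and> z = nth0 ys (hd0 xs))"
proof (cases xs)
  case Nil
  then show ?thesis by (auto elim: evals.cases)
next
  case (Cons n p)
  have A: "\<exists>h. evals f p (h 0) \<and> (\<forall>i<n. evals g (i # h i # p) (h (Suc i))) \<and> z = h n"
    if "evals (RPrec f g) (n # p) z"
    using that
  proof (induction n arbitrary: z)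
    case 0
    then have "evals f p z" by (rule evals_elims)
    then show ?case by (intro exI[of _ "\<lambda>_. z"]) simp
  next
    case (Suc n)
    from Suc.prems obtain y where y: "evals (RPrec f g) (n # p) y" "evals g (n # y # p) z"
      by (rule evals_elims)
    from Suc.IH[OF y(1)] obtain h where "evals f p (h 0)"
      "\<forall>i<n. evals g (i # h i # p) (h (Suc i))" "y = h n" by blast
    with y(2) show ?case by (intro exI[of _ "h(Suc n := z)"]) (auto simp: less_Suc_eq)
  qed
  \<comment> \<open>\<open>A\<close> yields the history as a function on all naturals; its values up
    to \<open>n\<close> are stored in a list.\<close>
  have "nth0 (map h [0..<Suc n]) i = h i" if "i \<le> n" for h i
    using that unfolding nth0_def by (simp del: upt_Suc)
  then have B: "\<exists>ys. \<forall>i\<le>n. nth0 ys i = h i" for h by blast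
  have C: "evals (RPrec f g) (j # p) (nth0 ys j)"
    if "evals f p (nth0 ys 0)" "\<forall>i<n. evals g (i # nth0 ys i # p) (nth0 ys (Suc i))" "j \<le> n"
        for ys j
    using that(3)
    by (induction j) (auto intro: evals.prec_0 that(1) evals.prec_Suc[OF _ that(2)[rule_format]])
  show ?thesis
  proof
    assume "evals (RPrec f g) xs z"
    with A Cons obtain h where h: "evals f p (h 0)" "\<forall>i<n. evals g (i # h i # p) (h (Suc i))"
        "z = h n"
      by blast
    from B obtain ys where "\<forall>i\<le>n. nth0 ys i = h i" by blast
    with h have "evals f p (nth0 ys 0) \<and> (\<forall>i<n. evals g (i # nth0 ys i # p) (nth0 ys (Suc i))) \<and> z =
        nth0 ys n"
      by (simp add: Suc_leI)
    with Cons show "xs \<noteq> [] \<and> (\<exists>ys. evals f (tl xs) (nth0 ys 0) \<and>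
        (\<forall>i<hd0 xs. evals g (i # nth0 ys i # tl xs) (nth0 ys (Suc i))) \<and> z = nth0 ys (hd0 xs))"
      by auto
  qed (use C[of _ n] Cons in auto)
qed

text \<open>
  Induction over the program, with a separate search for every program: neither a universal
  program nor a step-counting semantics is needed.
\<close>

lemma semidecidable_evals_pair: "semidecidable (\<lambda>p :: nat list \<times> nat. evals r (fst p) (snd p))"
proof (induction r)
  case RZero
  show ?case unfolding evals_RZero_iff by (intro semidecidable_dec decidable_eq recursive_snd
      recursive_id recursive_const)
next
  case RSucc
  show ?case unfolding evals_RSucc_iff
    by (intro semidecidable_dec decidable_conj decidable_not decidable_eq recursive_Suc
        recursive_hd0 recursive_snd recursive_fst recursive_id recursive_const)
next
  case (RProj i)
  show ?case unfolding evals_RProj_iff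
    by (intro semidecidable_dec decidable_conj decidable_less decidable_eq recursive_length
        recursive_nth0 recursive_snd recursive_fst recursive_id recursive_const)
next
  case (RComp f gs)
  \<comment> \<open>The inner programs form a fixed finite list, so induction on it unfolds
    \<open>list_all2\<close> into one conjunct per program.\<close>
  have gs: "semidecidable (\<lambda>p. list_all2 (\<lambda>g y. evals g (fst p) y) gs (snd p))"
    using RComp.IH(2)
  proof (induction gs)
    case Nil
    show ?case unfolding list.rel_sel[of _ "[]"]
      by simp (intro semidecidable_dec decidable_eq recursive_snd recursive_id recursive_const)
  next
    case (Cons g gs)
    have "semidecidable (\<lambda>p. snd p \<noteq> [] \<and> evals g (fst p) (hd0 (snd p)) \<and>
        list_all2 (\<lambda>g y. evals g (fst p) y) gs (tl (snd p)))"
      by (intro semidecidable_conj semidecidable_dec decidable_not decidable_eq recursive_snd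
          recursive_id recursive_const semidecidable_comp2[OF Cons.prems[of g]]
          semidecidable_comp2[OF Cons.IH] recursive_hd0 recursive_tl recursive_fst Cons.prems) auto
    moreover have "list_all2 P (g # gs) ys \<longleftrightarrow> ys \<noteq> [] \<and> P g (hd0 ys) \<and> list_all2 P gs (tl ys)"
        for P ys
      by (cases ys) auto
    ultimately show ?case by simp
  qed
  show ?case unfolding evals_RComp_iff
    by (intro semidecidable_ex semidecidable_conj semidecidable_comp2[OF gs]
        semidecidable_comp2[OF RComp.IH(1)] recursive_fst recursive_snd recursive_id)
next
  case (RPrec f g)
  show ?case unfolding evals_RPrec_iff
    by (intro semidecidable_ex semidecidable_conj semidecidable_dec decidable_not decidable_eq
        semidecidable_all_less recursive_hd0 recursive_tl recursive_nth0 recursive_Cons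
        recursive_Suc recursive_const recursive_snd recursive_fst recursive_id
        semidecidable_comp2[OF RPrec.IH(1)] semidecidable_comp2[OF RPrec.IH(2)])
next
  case (RMu f)
  show ?case unfolding evals_RMu_iff
    by (intro semidecidable_ex semidecidable_conj semidecidable_all_less recursive_Suc
        recursive_const recursive_Cons recursive_snd recursive_fst recursive_id
        semidecidable_comp2[OF RMu.IH])
qed

lemma semidecidable_evals: "recursive f \<Longrightarrow> recursive g \<Longrightarrow> semidecidable (\<lambda>x. evals r (f x) (g x))"
  by (rule semidecidable_comp2[OF semidecidable_evals_pair])

lemma semidecidable_halts: "recursive f \<Longrightarrow> semidecidable (\<lambda>x. halts r (f x))"
  unfolding halts_def by (intro semidecidable_ex semidecidable_evals recursive_snd recursive_id
      recursive_comp[of f, OF _ recursive_fst[OF recursive_id]])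

lemma semidecidable_imp_halts:
  assumes "semidecidable P" obtains r where "\<And>x. P x \<longleftrightarrow> halts r [enc x]"
proof -
  from assms obtain Q where Q: "decidable (\<lambda>p. Q (fst p) (snd p :: nat))" "P = (\<lambda>x. \<exists>t. Q x t)"
    by (rule semidecidableE)
  \<comment> \<open>\<open>RMu\<close> stops at the first value 0, so \<open>Q\<close> enters
    negated; the program is total, so the search cannot block before the first witness. The
    minimised variable has to come first, whence the swapped pair below.\<close>
  let ?F = "\<lambda>p. of_bool (\<not> Q (fst p) (snd p)) :: nat"
  have F: "recursive ?F" using decidable_not[OF Q(1)] by (simp add: decidable_def)
  have "recursive_nary 2 (\<lambda>xs. ?F (dcd (prod_encode (xs ! 1, xs ! 0))))"
    using recursive_nary_comp1[OF F[unfolded recursive_iff_nary]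
        recursive_nary_comp2[OF recursive_nary_prod_encode recursive_nary_proj[of 1]
        recursive_nary_proj[of 0]]] by simp
  then obtain q where q: "\<And>xs. length xs = 2 \<Longrightarrow> evals q xs (?F (dcd (prod_encode (xs ! 1, xs ! 0))))"
    unfolding recursive_nary_def by blast
  have "dcd (prod_encode (enc x, t)) = (x, t)" for x :: 'a and t :: nat
    by (subst enc_eq_iff[symmetric]) (simp del: enc_eq_iff)
  then have q': "evals q [t, enc x] (of_bool (\<not> Q x t))" for t x
    using q[of "[t, enc x]"] by simp
  have q'': "evals q [t, enc x] y \<longleftrightarrow> y = of_bool (\<not> Q x t)" for t x y
    using evals_deterministic[OF q'] q' by blast
  have "P x \<longleftrightarrow> halts (RMu q) [enc x]" for x
  proof -
    have zero: "0 = (of_bool (\<not> b) :: nat) \<longleftrightarrow> b" and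
      suc: "(\<exists>y. Suc y = of_bool (\<not> b)) \<longleftrightarrow> \<not> b" for b by (cases b; simp)+
    have "halts (RMu q) [enc x] \<longleftrightarrow> (\<exists>z. Q x z \<and> (\<forall>i<z. \<not> Q x i))"
      unfolding halts_def evals_RMu_iff q'' zero suc ..
    then show ?thesis unfolding Q(2) using exists_least_iff[of "Q x"] by blast
  qed
  then show ?thesis by (rule that)
qed

lemma re_set_iff_semidecidable: "re_set P \<longleftrightarrow> semidecidable (\<lambda>n. n \<in> P)"
proof
  assume "re_set P"
  then obtain f where "\<And>n. n \<in> P \<longleftrightarrow> halts f [n]" by (auto simp: re_set_def)
  then show "semidecidable (\<lambda>n. n \<in> P)" by (simp only:) (intro semidecidable_halts recursive_Cons
      recursive_id recursive_const)
next
  assume "semidecidable (\<lambda>n. n \<in> P)"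
  then show "re_set P" by (rule semidecidable_imp_halts) (auto simp: re_set_def)
qed

text \<open>The predicate has one argument, a coded pair, where \<open>uniformly_re\<close> passes
  two; composition with a program for \<open>prod_encode\<close> mediates.\<close>

lemma uniformly_re_iff_semidecidable: "uniformly_re I \<longleftrightarrow> semidecidable (\<lambda>p. snd p \<in> I (fst p))"
proof
  assume "uniformly_re I"
  then obtain f where "\<And>m n. n \<in> I m \<longleftrightarrow> halts f [m, n]" by (auto simp: uniformly_re_def)
  then show "semidecidable (\<lambda>p. snd p \<in> I (fst p))"
    by (simp only:) (intro semidecidable_halts recursive_Cons recursive_fst recursive_snd
        recursive_id recursive_const)
next
  assume "semidecidable (\<lambda>p. snd p \<in> I (fst p))"
  then obtain r where r: "\<And>p. snd p \<in> I (fst p) \<longleftrightarrow> halts r [enc p]" by (rule semidecidable_imp_halts)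
      blast
  from recursive_nary_prod_encode obtain q where q:
      "\<And>xs. length xs = 2 \<Longrightarrow> evals q xs (prod_encode (xs ! 0, xs ! 1))"
    unfolding recursive_nary_def by blast
  have "n \<in> I m \<longleftrightarrow> halts (RComp r [q]) [m, n]" for m n
  proof -
    have "evals q [m, n] y \<longleftrightarrow> y = prod_encode (m, n)" for y
      using q[of "[m, n]"] evals_deterministic[of q "[m, n]"] by auto
    then have "halts (RComp r [q]) [m, n] \<longleftrightarrow> halts r [prod_encode (m, n)]"
      by (auto simp: halts_def evals_RComp_iff list_all2_Cons1)
    then show ?thesis using r[of "(m, n)"] by simp
  qed
  then show "uniformly_re I" by (auto simp: uniformly_re_def)
qed

lemma decidable_finite: "finite F \<Longrightarrow> decidable (\<lambda>x. x \<in> F)"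
  by (induction F rule: finite_induct) (auto intro!: decidable_disj decidable_eq recursive_id
      recursive_const decidable_const)


section \<open>Codes of words and patterns\<close>

lemma power_le_of_set_decode: "n \<in> set_decode c \<Longrightarrow> 2 ^ n \<le> c"
  unfolding set_decode_def by (rule ccontr) simp

text \<open>Lets quantifiers over a decoded set be bounded by its code.\<close>

lemma less_of_set_decode: "n \<in> set_decode c \<Longrightarrow> n < c"
  using power_le_of_set_decode[of n c] less_exp[of n] by linarith

lemma decidable_ball_set_decode:
  assumes "recursive f" "decidable (\<lambda>p. P (fst p) (snd p))"
  shows "decidable (\<lambda>x. \<forall>n\<in>set_decode (f x). P x n)"
proof -
  have "(\<forall>n\<in>set_decode c. Q n) \<longleftrightarrow> (\<forall>n<c. n \<in> set_decode c \<longrightarrow> Q n)" for c Q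
    using less_of_set_decode by blast
  then show ?thesis
    by (simp only:) (intro decidable_all_less decidable_imp decidable_set_decode assms(2)
        recursive_snd recursive_id recursive_comp[OF assms(1)] recursive_fst assms(1))
qed

lemma decidable_bex_set_decode:
  assumes "recursive f" "decidable (\<lambda>p. P (fst p) (snd p))"
  shows "decidable (\<lambda>x. \<exists>n\<in>set_decode (f x). P x n)"
  using decidable_not[OF decidable_ball_set_decode[OF assms(1) decidable_not[OF assms(2)]]] by simp

lemma semidecidable_ball_set_decode:
  assumes "recursive f" "semidecidable (\<lambda>p. P (fst p) (snd p))"
  shows "semidecidable (\<lambda>x. \<forall>n\<in>set_decode (f x). P x n)"
proof -
  have "(\<forall>n\<in>set_decode c. Q n) \<longleftrightarrow> (\<forall>n<c. n \<notin> set_decode c \<or> Q n)" for c Q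
    using less_of_set_decode by blast
  then show ?thesis
    by (simp only:) (intro semidecidable_all_less semidecidable_disj semidecidable_dec decidable_not
        decidable_set_decode assms(2) recursive_snd recursive_id recursive_comp[OF assms(1)]
        recursive_fst assms(1))
qed

lemma semidecidable_bex_set_decode:
  assumes "recursive f" "semidecidable (\<lambda>p. P (fst p) (snd p))"
  shows "semidecidable (\<lambda>x. \<exists>n\<in>set_decode (f x). P x n)"
  unfolding Bex_def
  by (intro semidecidable_ex semidecidable_conj semidecidable_dec decidable_set_decode assms(2)
      recursive_snd recursive_id recursive_comp[OF assms(1)] recursive_fst)

definition letter_code :: "'g set \<Rightarrow> bool \<times> 'g \<Rightarrow> nat" where
  "letter_code S a = prod_encode (of_bool (fst a), to_nat_on S (snd a))"

lemma word_code_conv: "word_code S w = list_encode (map (letter_code S) w)"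
  by (simp add: word_code_def letter_code_def[abs_def] split_beta')

definition valid_letter :: "nat \<Rightarrow> nat \<Rightarrow> bool" where
  "valid_letter k l \<longleftrightarrow> fst (prod_decode l) < 2 \<and> snd (prod_decode l) < k"

text \<open>\<open>letter_inv\<close> on codes: a valid letter has sign 0 or 1, so unequal signs
  over one generator mean inverse letters.\<close>

definition cancelling :: "nat \<Rightarrow> nat \<Rightarrow> bool" where
  "cancelling l l' \<longleftrightarrow> fst (prod_decode l) \<noteq> fst (prod_decode l') \<and> snd (prod_decode l) =
    snd (prod_decode l')"

definition valid_word :: "nat \<Rightarrow> nat list \<Rightarrow> bool" where
  "valid_word k ws \<longleftrightarrow> (\<forall>i<length ws. valid_letter k (nth0 ws i)) \<and>
     (\<forall>i<length ws. Suc i < length ws \<longrightarrow> \<not> cancelling (nth0 ws i) (nth0 ws (Suc i)))"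

lemma decidable_cancelling: "recursive f \<Longrightarrow> recursive g \<Longrightarrow> decidable (\<lambda>x. cancelling (f x) (g x))"
  unfolding cancelling_def by (intro decidable_conj decidable_not decidable_eq recursive_fst
      recursive_snd recursive_prod_decode)

lemma decidable_valid_letter: "recursive f \<Longrightarrow> decidable (\<lambda>x. valid_letter k (f x))"
  unfolding valid_letter_def by (intro decidable_conj decidable_less recursive_fst recursive_snd
      recursive_prod_decode recursive_const)

lemma decidable_valid_word:
  assumes "recursive f" shows "decidable (\<lambda>x. valid_word k (f x))"
  unfolding valid_word_def
  by (intro decidable_conj decidable_all_less decidable_imp decidable_not decidable_less
      recursive_length assms decidable_cancelling decidable_valid_letter recursive_nth0
      recursive_comp[OF assms] recursive_fst recursive_snd recursive_id recursive_Suc)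

lemma bij_betw_letter_code:
  assumes "finite S"
  shows "bij_betw (letter_code S) (UNIV \<times> S) {l. valid_letter (card S) l}"
proof -
  have S: "bij_betw (to_nat_on S) S {..<card S}" by (rule to_nat_on_finite[OF assms])
  have "inj_on (letter_code S) (UNIV \<times> S)"
    using bij_betw_imp_inj_on[OF S] by (auto simp: inj_on_def letter_code_def)
  moreover have "letter_code S ` (UNIV \<times> S) = {l. valid_letter (card S) l}"
  proof (intro Set.set_eqI iffI)
    fix l assume "l \<in> letter_code S ` (UNIV \<times> S)"
    then show "l \<in> {l. valid_letter (card S) l}"
      using bij_betwE[OF S] by (auto simp: letter_code_def valid_letter_def)
  next
    fix l assume "l \<in> {l. valid_letter (card S) l}"
    then have l: "fst (prod_decode l) < 2" "snd (prod_decode l) \<in> to_nat_on S ` S"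
      using bij_betw_imp_surj_on[OF S] by (auto simp: valid_letter_def)
    from l(2) obtain s where s: "s \<in> S" "snd (prod_decode l) = to_nat_on S s" by blast
    have "l = prod_encode (fst (prod_decode l), snd (prod_decode l))" by simp
    also have "\<dots> = letter_code S (fst (prod_decode l) = 1, s)"
      using l(1) s(2) unfolding letter_code_def by (auto simp: less_2_cases_iff)
    finally show "l \<in> letter_code S ` (UNIV \<times> S)" using s(1) by blast
  qed
  ultimately show ?thesis by (simp add: bij_betw_def)
qed

lemma cancelling_letter_code:
  assumes "finite S" "a \<in> UNIV \<times> S" "b \<in> UNIV \<times> S"
  shows "cancelling (letter_code S a) (letter_code S b) \<longleftrightarrow> b = letter_inv a"
proof -
  have "inj_on (to_nat_on S) S" using to_nat_on_finite[OF assms(1)] by (rule bij_betw_imp_inj_on)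
  with assms(2,3) show ?thesis
    by (cases a; cases b) (auto simp: cancelling_def letter_code_def letter_inv_def inj_on_eq_iff)
qed

lemma inj_on_map_letter_code:
  assumes "finite S" shows "inj_on (map (letter_code S)) (lists (UNIV \<times> S))"
proof (rule inj_on_mapI)
  show "inj_on (letter_code S) (\<Union> (set ` lists (UNIV \<times> S)))"
    by (rule inj_on_subset[OF bij_betw_imp_inj_on[OF bij_betw_letter_code[OF assms]]]) blast
qed

lemma valid_word_map_letter_code:
  assumes "finite S" "w \<in> lists (UNIV \<times> S)"
  shows "valid_word (card S) (map (letter_code S) w) \<longleftrightarrow> reduced w"
proof -
  have w: "w ! i \<in> UNIV \<times> S" if "i < length w" for i using assms(2) that nth_mem by blast
  have "valid_letter (card S) (letter_code S (w ! i))" if "i < length w" for i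
    using bspec[OF bij_betwE[OF bij_betw_letter_code[OF assms(1)]] w[OF that]] by simp
  moreover have "cancelling (letter_code S (w ! i)) (letter_code S (w ! Suc i)) \<longleftrightarrow> w ! Suc i =
      letter_inv (w ! i)"
    if "Suc i < length w" for i
    using that by (intro cancelling_letter_code[OF assms(1)] w) auto
  ultimately show ?thesis
    unfolding valid_word_def reduced_def successively_conv_nth
    by (simp add: nth0_def) (blast dest: Suc_lessD)
qed

lemma valid_words:
  assumes "finite S"
  shows "{ws. valid_word (card S) ws} = map (letter_code S) ` carrier (free_group S)"
proof (intro Set.set_eqI iffI)
  fix ws assume "ws \<in> map (letter_code S) ` carrier (free_group S)"
  then show "ws \<in> {ws. valid_word (card S) ws}"
    using valid_word_map_letter_code[OF assms] by (auto simp: free_group_def)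
next
  fix ws assume ws: "ws \<in> {ws. valid_word (card S) ws}"
  then have "set ws \<subseteq> {l. valid_letter (card S) l}"
    by (auto simp: valid_word_def nth0_def in_set_conv_nth)
  also have "\<dots> = letter_code S ` (UNIV \<times> S)"
    using bij_betw_letter_code[OF assms] by (simp add: bij_betw_def)
  finally have "ws \<in> map (letter_code S) ` lists (UNIV \<times> S)"
    unfolding lists_image[symmetric] by blast
  then obtain w where w: "w \<in> lists (UNIV \<times> S)" "ws = map (letter_code S) w" by blast
  with ws valid_word_map_letter_code[OF assms w(1)]
  show "ws \<in> map (letter_code S) ` carrier (free_group S)" by (auto simp: free_group_def)
qed

lemma word_code_inj:
  assumes "finite S" shows "inj_on (word_code S) (carrier (free_group S))"
proof -
  have "carrier (free_group S) \<subseteq> lists (UNIV \<times> S)" by (auto simp: free_group_def)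
  from inj_on_subset[OF inj_on_map_letter_code[OF assms] this] show ?thesis
    by (auto simp: inj_on_def word_code_conv list_encode_eq)
qed

lemma valid_word_iff_word_code:
  assumes "finite S"
  shows "valid_word (card S) (list_decode n) \<longleftrightarrow> n \<in> word_code S ` carrier (free_group S)"
proof
  assume "valid_word (card S) (list_decode n)"
  then obtain w where "w \<in> carrier (free_group S)" "list_decode n = map (letter_code S) w"
    using valid_words[OF assms] by blast
  then show "n \<in> word_code S ` carrier (free_group S)"
    by (metis image_eqI list_decode_inverse word_code_conv)
qed (use valid_words[OF assms] in \<open>auto simp: word_code_conv\<close>)

section \<open>Finite patterns and their codes\<close>

lemma finite_pattern_graph:
  assumes "p \<in> patterns S A"
  shows "finite {prod_encode (word_code S w, to_nat_on A a) | w a. p w = Some a}"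
proof (rule finite_subset)
  show "{prod_encode (word_code S w, to_nat_on A a) | w a. p w = Some a} \<subseteq>
    (\<lambda>w. prod_encode (word_code S w, to_nat_on A (the (p w)))) ` dom p" by force
  show "finite \<dots>" using assms by (simp add: patterns_def)
qed

lemma set_decode_pattern_code:
  assumes "p \<in> patterns S A"
  shows "set_decode (pattern_code S A p) = {prod_encode (word_code S w, to_nat_on A a) | w a. p w =
      Some a}"
  unfolding pattern_code_def by (rule set_encode_inverse[OF finite_pattern_graph[OF assms]])

lemma patternsD:
  assumes "p \<in> patterns S A" "p w = Some a"
  shows "w \<in> carrier (free_group S)" "a \<in> A"
  using assms by (auto simp: patterns_def dom_def ran_def)

lemma pattern_code_mem:
  assumes "finite S" "finite A" "p \<in> patterns S A" "w \<in> carrier (free_group S)" "a \<in> A"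
  shows "prod_encode (word_code S w, to_nat_on A a) \<in> set_decode (pattern_code S A p) \<longleftrightarrow> p w =
      Some a"
proof -
  have "inj_on (to_nat_on A) A" using to_nat_on_finite[OF assms(2)] by (rule bij_betw_imp_inj_on)
  then show ?thesis
    unfolding set_decode_pattern_code[OF assms(3)]
    using patternsD[OF assms(3)] inj_onD[OF word_code_inj[OF assms(1)]] assms(4,5)
    by (auto simp: inj_on_eq_iff) (metis inj_onD)
qed

lemma pattern_code_inj:
  assumes "finite S" "finite A"
  shows "inj_on (pattern_code S A) (patterns S A)"
proof (rule inj_onI, rule ext)
  fix p q w assume pq: "p \<in> patterns S A" "q \<in> patterns S A"
      "pattern_code S A p = pattern_code S A q"
  have "p w = Some a \<longleftrightarrow> q w = Some a" for a
    using pattern_code_mem[OF assms pq(1), of w a] pattern_code_mem[OF assms pq(2), of w a] pq(3)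
      patternsD[OF pq(1), of w a] patternsD[OF pq(2), of w a] by metis
  then show "p w = q w" by (metis option.exhaust)
qed

text \<open>The encoded set must be the graph of a function from reduced words to symbols; the last
  conjunct is single-valuedness. This test keeps arbitrary numbers out of the enumeration of
  forbidden patterns.\<close>

definition valid_pattern :: "nat \<Rightarrow> nat \<Rightarrow> nat \<Rightarrow> bool" where
  "valid_pattern k l c \<longleftrightarrow> (\<forall>n\<in>set_decode c.
     valid_word k (list_decode (fst (prod_decode n))) \<and> snd (prod_decode n) < l \<and>
     (\<forall>m\<in>set_decode c. fst (prod_decode m) = fst (prod_decode n) \<longrightarrow> m = n))"

lemma decidable_valid_pattern: "decidable (valid_pattern k l)"
proof -
  have "decidable (\<lambda>c. valid_pattern k l c)"
    unfolding valid_pattern_def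
    by (intro decidable_ball_set_decode decidable_conj decidable_imp decidable_eq decidable_less
        decidable_valid_word recursive_list_decode recursive_fst recursive_snd recursive_prod_decode
        recursive_id recursive_const)
  then show ?thesis by simp
qed

lemma valid_patterns:
  assumes S: "finite S" and A: "finite A"
  shows "{c. valid_pattern (card S) (card A) c} = pattern_code S A ` patterns S A"
proof (intro Set.set_eqI iffI)
  have bijA: "bij_betw (to_nat_on A) A {..<card A}" by (rule to_nat_on_finite[OF A])
  {
    fix c assume "c \<in> pattern_code S A ` patterns S A"
    then obtain p where p: "p \<in> patterns S A" and c: "c = pattern_code S A p" by blast
    have "w = w'" if "p w = Some a" "p w' = Some a'" "word_code S w = word_code S w'" for w w' a a'
      using word_code_inj[OF S] that patternsD[OF p] by (meson inj_onD)
    then show "c \<in> {c. valid_pattern (card S) (card A) c}"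
      unfolding c mem_Collect_eq valid_pattern_def set_decode_pattern_code[OF p]
      using patternsD[OF p] bij_betwE[OF bijA]
      by (auto simp: valid_word_iff_word_code[OF S]) (metis option.inject)
  next
    fix c assume "c \<in> {c. valid_pattern (card S) (card A) c}"
    then have c: "valid_word (card S) (list_decode (fst (prod_decode n)))"
        "snd (prod_decode n) < card A"
      and c2: "\<And>m. m \<in> set_decode c \<Longrightarrow> fst (prod_decode m) = fst (prod_decode n) \<Longrightarrow> m = n"
      if "n \<in> set_decode c" for n using that unfolding valid_pattern_def by blast+
    have c1: "\<exists>w\<in>carrier (free_group S). \<exists>a\<in>A. n = prod_encode (word_code S w, to_nat_on A a)"
      if "n \<in> set_decode c" for n
    proof -
      from c[OF that] have "fst (prod_decode n) \<in> word_code S ` carrier (free_group S)"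
        "snd (prod_decode n) \<in> to_nat_on A ` A"
        using bij_betw_imp_surj_on[OF bijA] by (simp_all add: valid_word_iff_word_code[OF S])
      then show ?thesis by (metis imageE prod.collapse prod_decode_inverse)
    qed
    \<comment> \<open>By \<open>c2\<close> at most one symbol qualifies, so the choice is forced;
      \<open>p_iff\<close> states this.\<close>
    define p where "p w = (if w \<in> carrier (free_group S) \<and>
        (\<exists>a\<in>A. prod_encode (word_code S w, to_nat_on A a) \<in> set_decode c)
      then Some (SOME a. a \<in> A \<and> prod_encode (word_code S w, to_nat_on A a) \<in> set_decode c) else
          None)" for w
    have p_iff: "p w = Some a \<longleftrightarrow> w \<in> carrier (free_group S) \<and> a \<in> A \<and>
      prod_encode (word_code S w, to_nat_on A a) \<in> set_decode c" for w a
    proof -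
      have "a = b" if "a \<in> A" "prod_encode (word_code S w, to_nat_on A a) \<in> set_decode c"
        "b \<in> A" "prod_encode (word_code S w, to_nat_on A b) \<in> set_decode c" for a b
        using c2[OF that(4) that(2)] bij_betw_imp_inj_on[OF bijA] that(1,3)
            by (auto simp: inj_on_eq_iff)
      note u = this
      show ?thesis
        unfolding p_def
            using someI_ex[of "\<lambda>a. a \<in> A \<and> prod_encode (word_code S w, to_nat_on A a) \<in> set_decode
            c"] u
        by (auto; blast)
    qed
    have graph: "{prod_encode (word_code S w, to_nat_on A a) | w a. p w = Some a} = set_decode c"
      unfolding p_iff using c1 by blast
    have "word_code S ` dom p \<subseteq> (\<lambda>n. fst (prod_decode n)) ` set_decode c"
      by (force simp: dom_def p_iff)
    moreover have "inj_on (word_code S) (dom p)"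
      by (rule inj_on_subset[OF word_code_inj[OF S]]) (auto simp: p_iff)
    ultimately have "finite (dom p)" by (meson finite_imageD finite_imageI finite_set_decode
        finite_subset)
    then have "p \<in> patterns S A" by (auto simp: patterns_def p_iff ran_def)
    moreover have "pattern_code S A p = c" unfolding pattern_code_def graph by simp
    ultimately show "c \<in> pattern_code S A ` patterns S A" by blast
  }
qed


section \<open>Recursively compact sets\<close>

text \<open>Joins finitely many unrelated programs, one for each \<open>a\<close>; in this way
  separately chosen enumerations for the letters enter one algorithm.\<close>

lemma semidecidable_finite_bex:
  "finite F \<Longrightarrow> (\<And>a. a \<in> F \<Longrightarrow> semidecidable (P a)) \<Longrightarrow> semidecidable (\<lambda>x. \<exists>a\<in>F. P a x)"
proof (induction F rule: finite_induct)
  case empty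
  show ?case by (simp add: semidecidable_dec decidable_const)
next
  case (insert a F)
  then show ?case by (simp add: semidecidable_disj)
qed

text \<open>
  \<open>R a k n\<close> will mean that the ball \<open>n\<close> belongs to an enumeration of the preimage of the ball \<open>k\<close>
  under the inverse of the letter \<open>a\<close>.
\<close>

fun chain :: "(nat \<Rightarrow> nat \<Rightarrow> nat \<Rightarrow> bool) \<Rightarrow> nat list \<Rightarrow> nat \<Rightarrow> nat \<Rightarrow> bool" where
  "chain R [] k n \<longleftrightarrow> n = k"
| "chain R (a # ws) k n \<longleftrightarrow> (\<exists>l. chain R ws k l \<and> R a l n)"

lemma nth0_Cons_0 [simp]: "nth0 (x # xs) 0 = x" and nth0_Cons_Suc [simp]: "nth0 (x # xs) (Suc i) =
    nth0 xs i"
  by (simp_all add: nth0_def)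

lemma nth0_tl: "nth0 (tl xs) i = nth0 xs (Suc i)"
  by (cases xs) (simp_all add: nth0_def)

text \<open>The intermediate balls form a finite certificate, a list leading from \<open>n\<close>
  at index 0 to \<open>k\<close> at index \<open>length ws\<close>. Recursion on the word thus
  becomes a search that preserves semidecidability.\<close>

lemma chain_iff:
  "chain R ws k n \<longleftrightarrow> (\<exists>ls. nth0 ls 0 = n \<and> nth0 ls (length ws) = k \<and>
     (\<forall>i<length ws. R (nth0 ws i) (nth0 ls (Suc i)) (nth0 ls i)))"
proof (induction ws arbitrary: n)
  case Nil
  show ?case by (auto intro: exI[of _ "[n]"])
next
  case (Cons a ws)
  show ?case
  proof
    assume "chain R (a # ws) k n"
    then obtain l ls where "R a l n" "nth0 ls 0 = l" "nth0 ls (length ws) = k"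
      "\<forall>i<length ws. R (nth0 ws i) (nth0 ls (Suc i)) (nth0 ls i)" by (auto simp: Cons.IH)
    then show "\<exists>ls. nth0 ls 0 = n \<and> nth0 ls (length (a # ws)) = k \<and>
      (\<forall>i<length (a # ws). R (nth0 (a # ws) i) (nth0 ls (Suc i)) (nth0 ls i))"
      by (intro exI[of _ "n # ls"]) (auto simp: less_Suc_eq_0_disj)
  next
    assume "\<exists>ls. nth0 ls 0 = n \<and> nth0 ls (length (a # ws)) = k \<and>
      (\<forall>i<length (a # ws). R (nth0 (a # ws) i) (nth0 ls (Suc i)) (nth0 ls i))"
    then obtain ls where ls0: "nth0 ls 0 = n" "nth0 ls (Suc (length ws)) = k"
      "\<And>i. i < Suc (length ws) \<Longrightarrow> R (nth0 (a # ws) i) (nth0 ls (Suc i)) (nth0 ls i)" by auto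
    from ls0(3)[of 0] ls0(3)[of "Suc _"] have ls: "nth0 ls 0 = n" "nth0 ls (Suc (length ws)) = k"
        "R a (nth0 ls 1) (nth0 ls 0)"
      "\<forall>i<length ws. R (nth0 ws i) (nth0 ls (Suc (Suc i))) (nth0 ls (Suc i))"
      using ls0 by simp_all
    then have "chain R ws k (nth0 ls 1)" unfolding Cons.IH
      by (intro exI[of _ "tl ls"]) (simp add: nth0_tl)
    with ls show "chain R (a # ws) k n" by auto
  qed
qed

lemma semidecidable_chain:
  assumes R: "semidecidable (\<lambda>p. R (fst p) (fst (snd p)) (snd (snd p)))" and "recursive f"
      "recursive g" "recursive h"
  shows "semidecidable (\<lambda>x. chain R (f x) (g x) (h x))"
proof -
  have R': "semidecidable (\<lambda>x. R (f' x) (g' x) (h' x))" if "recursive f'" "recursive g'"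
      "recursive h'" for f' g' h' :: "'x::coded \<Rightarrow> nat"
    using semidecidable_comp[OF R, of "\<lambda>x. (f' x, g' x, h' x)"] that by (simp add: recursive_Pair)
  show ?thesis
    unfolding chain_iff
    by (intro semidecidable_ex semidecidable_conj semidecidable_dec decidable_eq
        semidecidable_all_less R' recursive_nth0 recursive_length recursive_Suc recursive_snd
        recursive_fst recursive_id recursive_const recursive_comp[OF assms(2)]
        recursive_comp[OF assms(3)] recursive_comp[OF assms(4)])
qed

section \<open>Basic balls, their distances, and coverings of compact sets\<close>

definition ball_radius :: "nat \<Rightarrow> real" where
  "ball_radius n = (case prod_decode (snd (prod_decode n)) of (a, b) \<Rightarrow> real (Suc a) / real (Suc b))"

lemma basic_ball_conv: "basic_ball m s n = mball_of m (s (fst (prod_decode n))) (ball_radius n)"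
  by (simp add: basic_ball_def ball_radius_def split_beta)

text \<open>A sufficient condition for disjointness that approximation can confirm, being a strict
  inequality between computable reals.\<close>

definition far_balls :: "'x metric \<Rightarrow> (nat \<Rightarrow> 'x) \<Rightarrow> nat \<Rightarrow> nat \<Rightarrow> bool" where
  "far_balls m s n l \<longleftrightarrow>
     ball_radius n + ball_radius l < mdist m (s (fst (prod_decode n))) (s (fst (prod_decode l)))"

text \<open>Clearing denominators leaves a decidable comparison of naturals. An odd first component
  codes a negative integer, which cannot exceed the positive left side.\<close>

lemma rat_decode_greater_iff:
  "1 / 2 ^ t + real (Suc a) / real (Suc b) + real (Suc a') / real (Suc b') < of_rat (rat_decode c) \<longleftrightarrow>
   even (fst (prod_decode c)) \<and>
   Suc (snd (prod_decode c)) * (Suc b * Suc b' + Suc a * 2 ^ t * Suc b' + Suc a' * 2 ^ t * Suc b)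
     < fst (prod_decode c) div 2 * (2 ^ t * Suc b * Suc b')"
  (is "?lhs < _ \<longleftrightarrow> _ \<and> Suc ?q * ?Y < ?X * ?Z")
proof -
  have r: "real_of_rat (rat_decode c) = of_int (int_decode (fst (prod_decode c))) / real (Suc ?q)"
    by (simp add: rat_decode_def split_beta of_rat_divide of_rat_add)
  show ?thesis
  proof (cases "even (fst (prod_decode c))")
    case True
    have "1 / T + x / B + x' / B' = (B * B' + x * T * B' + x' * T * B) / (T * B * B')"
      if "T > 0" "B > 0" "B' > 0" for T B B' x x' :: real
      using that by (simp add: field_simps)
    from this[of "2 ^ t" "real (Suc b)" "real (Suc b')" "real (Suc a)" "real (Suc a')"]
    have "?lhs = real ?Y / real ?Z"
      by (simp only: of_nat_add of_nat_mult of_nat_power of_nat_numeral zero_less_power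
          zero_less_numeral
          of_nat_0_less_iff zero_less_Suc simp_thms)
    moreover have "int_decode (fst (prod_decode c)) = int ?X"
      using True by (simp add: int_decode_def sum_decode_def)
    then have "real_of_rat (rat_decode c) = real ?X / real (Suc ?q)" unfolding r by simp
    moreover have "real y / real z < real x / real q \<longleftrightarrow> q * y < x * z" if "q > 0" "z > 0" for x y z q
    proof -
      have "real y / real z < real x / real q \<longleftrightarrow> real (q * y) < real (x * z)"
        using that by (simp add: field_simps)
      then show ?thesis by (simp only: of_nat_less_iff)
    qed
    from this[of "Suc ?q" ?Z ?Y ?X]
    have "real ?Y / real ?Z < real ?X / real (Suc ?q) \<longleftrightarrow> Suc ?q * ?Y < ?X * ?Z"
      by (simp only: nat_0_less_mult_iff zero_less_power zero_less_numeral zero_less_Suc simp_thms)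
    ultimately show ?thesis using True by (simp only: simp_thms)
  next
    case False
    then have "int_decode (fst (prod_decode c)) \<le> 0" by (simp add: int_decode_def sum_decode_def)
    then have "real_of_rat (rat_decode c) \<le> 0" unfolding r by (simp add: divide_le_0_iff)
    moreover have "0 < ?lhs" by (intro add_pos_pos) auto
    ultimately have "\<not> ?lhs < of_rat (rat_decode c)" by linarith
    with False show ?thesis by blast
  qed
qed

lemma semidecidable_far_balls:
  assumes "computable_metric_space m s" "recursive f" "recursive g"
  shows "semidecidable (\<lambda>x. far_balls m s (f x) (g x))"
proof -
  from assms(1) obtain r where r: "\<And>i j n. \<exists>c. evals r [i, j, n] c \<and>
        \<bar>mdist m (s i) (s j) - of_rat (rat_decode c)\<bar> \<le> (1 / 2) ^ n"
    unfolding computable_metric_space_def by blast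
  \<comment> \<open>A finite certificate: the approximation at precision \<open>t\<close> exceeds
    the sum of the radii by more than its own error bound.\<close>
  define far where "far n l \<longleftrightarrow> (\<exists>t c. evals r [fst (prod_decode n), fst (prod_decode l), t] c \<and>
    1 / 2 ^ t + ball_radius n + ball_radius l < of_rat (rat_decode c))" for n l
  have "far_balls m s n l \<longleftrightarrow> far n l" for n l
  proof
    assume *: "far_balls m s n l"
    let ?d = "mdist m (s (fst (prod_decode n))) (s (fst (prod_decode l))) - (ball_radius n +
        ball_radius l)"
    from * have "?d > 0" by (simp add: far_balls_def)
    \<comment> \<open>Half of the gap, because one error term is lost in the approximation and
      \<open>far\<close> demands another as its margin.\<close>
    then obtain t where t: "(1 / 2) ^ t < ?d / 2"
      using real_arch_pow_inv[of "?d / 2" "1 / 2"] by auto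
    obtain c where c: "evals r [fst (prod_decode n), fst (prod_decode l), t] c"
       "\<bar>mdist m (s (fst (prod_decode n))) (s (fst (prod_decode l))) - of_rat (rat_decode c)\<bar> \<le> (1 /
         2) ^ t"
      using r by blast
    define e :: real where "e = (1 / 2) ^ t"
    have "1 / 2 ^ t = e" by (simp add: e_def power_one_over)
    moreover have "e + ball_radius n + ball_radius l < of_rat (rat_decode c)"
    proof -
      have "mdist m (s (fst (prod_decode n))) (s (fst (prod_decode l))) - of_rat (rat_decode c) \<le> e"
        using c(2) unfolding e_def by (rule abs_le_D1)
      moreover have "2 * e < ?d" using t unfolding e_def by simp
      ultimately show ?thesis by argo
    qed
    ultimately have "1 / 2 ^ t + ball_radius n + ball_radius l < of_rat (rat_decode c)" by simp
    with c(1) show "far n l" unfolding far_def by blast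
  next
    assume "far n l"
    then obtain t c where c: "evals r [fst (prod_decode n), fst (prod_decode l), t] c"
      "1 / 2 ^ t + ball_radius n + ball_radius l < of_rat (rat_decode c)" unfolding far_def by blast
    obtain c' where c': "evals r [fst (prod_decode n), fst (prod_decode l), t] c'"
       "\<bar>mdist m (s (fst (prod_decode n))) (s (fst (prod_decode l))) - of_rat (rat_decode c')\<bar> \<le> (1
         / 2) ^ t"
      using r by blast
    \<comment> \<open>The accuracy guarantee concerns some output of the program; determinism
      identifies it with the one found by the search.\<close>
    have "c' = c" by (rule evals_deterministic[OF c'(1) c(1)])
    moreover define e :: real where "e = (1 / 2) ^ t"
    moreover have "1 / 2 ^ t = e" by (simp add: e_def power_one_over)
    ultimately show "far_balls m s n l" unfolding far_balls_def using c(2) c'(2) by simp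
  qed
  moreover have "semidecidable (\<lambda>x. far (f x) (g x))"
    unfolding far_def ball_radius_def split_beta rat_decode_greater_iff
    by (intro semidecidable_ex semidecidable_conj semidecidable_evals semidecidable_dec
        decidable_conj decidable_less recursive_Cons recursive_mult recursive_add recursive_Suc
        recursive_power recursive_div recursive_snd recursive_fst recursive_id recursive_const
        recursive_prod_decode recursive_comp[OF assms(2)] recursive_comp[OF assms(3)])
      (simp only: even_iff_mod_2_eq_zero, intro decidable_eq recursive_mod recursive_const
          recursive_fst recursive_snd recursive_prod_decode recursive_id)
  ultimately show ?thesis by simp
qed

lemma openin_basic_ball: "openin (mtopology_of m) (basic_ball m s n)"
  unfolding basic_ball_conv mtopology_of_def mball_of_def
  by (rule Metric_space.openin_mball) simp

lemma small_basic_ball: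
  assumes "computable_metric_space m s" "x \<in> mspace m" "0 < \<epsilon>"
  obtains n where "x \<in> basic_ball m s n" "ball_radius n < \<epsilon>"
proof -
  interpret M: Metric_space "mspace m" "mdist m" by simp
  obtain b where b: "inverse (real (Suc b)) < \<epsilon>"
    using reals_Archimedean[OF assms(3)] by auto
  let ?e = "1 / real (Suc b)"
  have "x \<in> M.mtopology closure_of range s"
    using assms by (simp add: computable_metric_space_def mtopology_of_def)
  then obtain i where i: "s i \<in> M.mball x ?e"
    unfolding M.metric_closure_of by (auto dest!: spec[of _ ?e])
  show ?thesis
  proof (rule that[of "prod_encode (i, prod_encode (0, b))"])
    show "x \<in> basic_ball m s (prod_encode (i, prod_encode (0, b)))"
      using i by (auto simp: basic_ball_def mball_of_def M.commute)
    show "ball_radius (prod_encode (i, prod_encode (0, b))) < \<epsilon>"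
      using b by (simp add: ball_radius_def inverse_eq_divide)
  qed
qed

lemma basic_ball_subset_mball:
  assumes "x \<in> basic_ball m s n" "2 * ball_radius n \<le> \<epsilon>"
  shows "basic_ball m s n \<subseteq> mball_of m x \<epsilon>"
proof
  interpret M: Metric_space "mspace m" "mdist m" by simp
  fix y assume "y \<in> basic_ball m s n"
  with assms M.triangle[of x "s (fst (prod_decode n))" y] show "y \<in> mball_of m x \<epsilon>"
    by (auto simp: basic_ball_conv mball_of_def M.commute)
qed

lemma basic_ball_in_open:
  assumes "computable_metric_space m s" "openin (mtopology_of m) U" "x \<in> U"
  obtains n where "x \<in> basic_ball m s n" "basic_ball m s n \<subseteq> U"
proof -
  interpret M: Metric_space "mspace m" "mdist m" by simp
  have "U \<subseteq> mspace m" "\<exists>\<epsilon>>0. M.mball x \<epsilon> \<subseteq> U"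
    using assms(2,3) by (auto simp: mtopology_of_def M.openin_mtopology)
  with assms(3) obtain \<epsilon> where e: "\<epsilon> > 0" "M.mball x \<epsilon> \<subseteq> U" and x: "x \<in> mspace m"
    by blast
  obtain n where n: "x \<in> basic_ball m s n" "ball_radius n < \<epsilon> / 2"
    using small_basic_ball[OF assms(1) x, of "\<epsilon> / 2"] e(1) by auto
  with basic_ball_subset_mball[OF n(1), of \<epsilon>] e(2) that show ?thesis by (auto simp: mball_of_def)
qed

lemma compactin_basic_subcover:
  assumes "compactin (mtopology_of m) K" "K \<subseteq> basic_open m s J"
  obtains c where "set_decode c \<subseteq> J" "K \<subseteq> basic_open m s (set_decode c)"
proof -
  have "\<exists>F. finite F \<and> F \<subseteq> basic_ball m s ` J \<and> K \<subseteq> \<Union>F"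
    using assms by (intro compactinD) (auto simp: openin_basic_ball basic_open_def)
  then obtain J' where "finite J'" "J' \<subseteq> J" "K \<subseteq> basic_open m s J'"
    unfolding basic_open_def by (metis finite_subset_image)
  then show ?thesis using that[of "set_encode J'"] by simp
qed

text \<open>Recursive compactness tests finite families only. By compactness a covering by an
  enumerated family has a finite subcover \<open>c\<close>, whose members can be confirmed one by
  one.\<close>

lemma semidecidable_covered:
  assumes "recursively_compact m s K" "semidecidable (\<lambda>p. P (fst p) (snd p))"
  shows "semidecidable (\<lambda>x. K \<subseteq> basic_open m s {n. P x n})"
proof -
  from assms(1) obtain f where K: "compactin (mtopology_of m) K"
    and f: "\<And>I. finite I \<Longrightarrow> halts f [set_encode I] \<longleftrightarrow> K \<subseteq> basic_open m s I"
    unfolding recursively_compact_def by blast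
  have "K \<subseteq> basic_open m s {n. P x n} \<longleftrightarrow> (\<exists>c. halts f [c] \<and> (\<forall>n\<in>set_decode c. P x n))" for x
  proof
    assume "K \<subseteq> basic_open m s {n. P x n}"
    then obtain c where "set_decode c \<subseteq> {n. P x n}" "K \<subseteq> basic_open m s (set_decode c)"
      by (rule compactin_basic_subcover[OF K])
    with f[of "set_decode c"] show "\<exists>c. halts f [c] \<and> (\<forall>n\<in>set_decode c. P x n)" by auto
  next
    assume "\<exists>c. halts f [c] \<and> (\<forall>n\<in>set_decode c. P x n)"
    then obtain c where "K \<subseteq> basic_open m s (set_decode c)" "set_decode c \<subseteq> {n. P x n}"
      using f[OF finite_set_decode, unfolded set_decode_inverse] by blast
    then show "K \<subseteq> basic_open m s {n. P x n}" unfolding basic_open_def by blast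
  qed
  then show ?thesis
    by (simp only:) (intro semidecidable_ex semidecidable_conj semidecidable_halts recursive_Cons
        semidecidable_ball_set_decode semidecidable_comp2[OF assms(2)] recursive_const recursive_snd
        recursive_fst recursive_id)
qed

text \<open>
  If \<open>f\<close> is the given homeomorphism and \<open>g\<close> its inverse, a ball \<open>B\<^sub>n\<close> is put into the preimage of
  \<open>B\<^sub>k\<close> under \<open>g\<close> as soon as \<open>K\<close> is covered by \<open>B\<^sub>k\<close> and the preimages under \<open>f\<close> of balls far from
  \<open>B\<^sub>n\<close>.
\<close>

lemma computable_map_inverse:
  assumes cm: "computable_metric_space m s" and rc: "recursively_compact m s K"
    and f: "computable_map m s K m s f"
    and homeo: "homeomorphic_map (subtopology (mtopology_of m) K) (subtopology (mtopology_of m) K)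
        f"
    and g: "g \<in> K \<rightarrow> K" "\<And>x. x \<in> K \<Longrightarrow> g (f x) = x"
  shows "computable_map m s K m s g"
proof -
  interpret M: Metric_space "mspace m" "mdist m" by simp
  let ?T = "subtopology (mtopology_of m) K"
  have KM: "K \<subseteq> mspace m" using f by (simp add: computable_map_def)
  then have topK: "topspace ?T = K" by auto
  have img: "f ` K = K" using homeomorphic_imp_surjective_map[OF homeo] unfolding topK .
  obtain I where I: "semidecidable (\<lambda>p. snd p \<in> I (fst p))"
    "\<And>k. {y \<in> K. f y \<in> basic_ball m s k} = basic_open m s (I k) \<inter> K"
    using f by (auto simp: computable_map_def uniformly_re_iff_semidecidable)
  define Q where "Q k n r \<longleftrightarrow> r = k \<or> (\<exists>l. far_balls m s n l \<and> r \<in> I l)" for k n r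
  define J where "J k = {n. K \<subseteq> basic_open m s {r. Q k n r}}" for k
  have "semidecidable (\<lambda>p. Q (fst (fst p)) (snd (fst p)) (snd p))"
    unfolding Q_def
    by (intro semidecidable_disj semidecidable_ex semidecidable_conj semidecidable_dec decidable_eq
        semidecidable_far_balls[OF cm] semidecidable_comp2[OF I(1)] recursive_fst recursive_snd
        recursive_id)
  then have "semidecidable (\<lambda>p. K \<subseteq> basic_open m s {r. Q (fst p) (snd p) r})"
      by (rule semidecidable_covered[OF rc])
  then have "uniformly_re J" unfolding uniformly_re_iff_semidecidable J_def by simp
  moreover have "{y \<in> K. g y \<in> basic_ball m s k} = basic_open m s (J k) \<inter> K" for k
  proof (intro Set.set_eqI iffI)
    fix y assume "y \<in> basic_open m s (J k) \<inter> K"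
    then obtain n where n: "n \<in> J k" "y \<in> basic_ball m s n" and y: "y \<in> K"
      by (auto simp: basic_open_def)
    from y have "y \<in> f ` K" by (simp add: img)
    then obtain x where x: "x \<in> K" "f x = y" by blast
    from n(1) x(1) obtain r where r: "Q k n r" "x \<in> basic_ball m s r"
      unfolding J_def basic_open_def by blast
    \<comment> \<open>Otherwise \<open>y = f x\<close> would lie both in the ball \<open>n\<close>
      and in a ball far from it.\<close>
    have "r = k"
    proof (rule ccontr)
      assume "r \<noteq> k"
      with r(1) obtain l where l: "far_balls m s n l" "r \<in> I l" unfolding Q_def by blast
      with r(2) x I(2)[of l] have "y \<in> basic_ball m s l" unfolding basic_open_def by blast
      let ?i = "s (fst (prod_decode n))" and ?j = "s (fst (prod_decode l))"
      have "?i \<in> mspace m" "?j \<in> mspace m" "y \<in> mspace m"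
        "mdist m ?i y < ball_radius n" "mdist m ?j y < ball_radius l"
        using n(2) \<open>y \<in> basic_ball m s l\<close> by (auto simp: basic_ball_conv mball_of_def)
      moreover have "ball_radius n + ball_radius l < mdist m ?i ?j"
        using l(1) by (simp add: far_balls_def)
      ultimately show False
        using M.triangle[of ?i y ?j] by (simp add: M.commute[of y])
    qed
    with r(2) x g(2) y show "y \<in> {y \<in> K. g y \<in> basic_ball m s k}" by auto
  next
    fix y assume "y \<in> {y \<in> K. g y \<in> basic_ball m s k}"
    then have y: "y \<in> K" "g y \<in> basic_ball m s k" by auto
    have "openin ?T (basic_ball m s k \<inter> K)"
      using openin_basic_ball by (auto simp: openin_subtopology)
    \<comment> \<open>Since \<open>f\<close> is open and injective, \<open>y\<close> has a
      neighbourhood \<open>V\<close> that receives no point of \<open>K\<close> outside the ball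
      \<open>k\<close>; the images of such points keep a distance of at least
      \<open>\<delta>\<close> from \<open>y\<close>.\<close>
    then have "openin ?T (f ` (basic_ball m s k \<inter> K))"
      using homeo by (auto simp: homeomorphic_eq_everything_map open_map_def)
    then obtain V where V: "openin (mtopology_of m) V" "f ` (basic_ball m s k \<inter> K) = V \<inter> K"
      by (auto simp: openin_subtopology)
    from y have "y \<in> f ` K" by (simp add: img)
    then obtain x where x: "x \<in> K" "f x = y" by blast
    with g(2) y have "x \<in> basic_ball m s k" by auto
    with x V(2) have "y \<in> V" by blast
    moreover have yM: "y \<in> mspace m" using y KM by blast
    ultimately obtain \<delta> where d: "\<delta> > 0" "M.mball y \<delta> \<subseteq> V"
      using V(1) by (auto simp: mtopology_of_def M.openin_mtopology)
    \<comment> \<open>With both radii below \<open>\<delta> / 4\<close> and \<open>y\<close>,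
      \<open>f z\<close> at least \<open>\<delta>\<close> apart, the centres are more than
      \<open>\<delta> / 2\<close> apart, hence farther than the sum of the radii.\<close>
    obtain n where n: "y \<in> basic_ball m s n" "ball_radius n < \<delta> / 4"
      using small_basic_ball[OF cm yM, of "\<delta> / 4"] d(1) by auto
    have "n \<in> J k"
      unfolding J_def
    proof safe
      fix z assume z: "z \<in> K"
      show "z \<in> basic_open m s {r. Q k n r}"
      proof (cases "z \<in> basic_ball m s k")
        case True
        then show ?thesis unfolding basic_open_def Q_def by blast
      next
        case False
        have fz: "f z \<in> K" using imageI[OF z, of f] by (simp add: img)
        have "f z \<notin> V"
        proof
          assume "f z \<in> V"
          with fz V(2) have "f z \<in> f ` (basic_ball m s k \<inter> K)" by simp
          then show False
          proof (rule imageE)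
            fix z' assume z': "f z = f z'" "z' \<in> basic_ball m s k \<inter> K"
            have "z = g (f z')" using g(2)[OF z] z'(1) by simp
            also have "\<dots> = z'" using z'(2) by (intro g(2)) simp
            finally show False using z'(2) False by simp
          qed
        qed
        with d(2) fz KM yM have dz: "\<delta> \<le> mdist m y (f z)"
        proof -
          have "f z \<notin> M.mball y \<delta>" using d(2) \<open>f z \<notin> V\<close> by (rule contra_subsetD)
          moreover have "f z \<in> mspace m" using KM fz by (rule subsetD)
          ultimately show ?thesis using yM by simp
        qed
        obtain l where l: "f z \<in> basic_ball m s l" "ball_radius l < \<delta> / 4"
          using small_basic_ball[OF cm subsetD[OF KM fz], of "\<delta> / 4"] d(1) by auto
        let ?i = "s (fst (prod_decode n))" and ?j = "s (fst (prod_decode l))"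
        have "?i \<in> mspace m" "?j \<in> mspace m" "f z \<in> mspace m"
          "mdist m ?i y < ball_radius n" "mdist m ?j (f z) < ball_radius l"
          using n(1) l(1) by (auto simp: basic_ball_conv mball_of_def)
        then have "far_balls m s n l"
          using n(2) l(2) dz yM M.triangle[of y ?i "f z"] M.triangle[of ?i ?j "f z"]
          by (simp add: far_balls_def M.commute[of y])
        moreover have "z \<in> basic_open m s (I l)" using I(2)[of l] l(1) z by blast
        ultimately show ?thesis unfolding basic_open_def Q_def by blast
      qed
    qed
    with n(1) y(1) show "y \<in> basic_open m s (J k) \<inter> K" unfolding basic_open_def by blast
  qed
  moreover have "g \<in> K \<rightarrow> mspace m" using g(1) KM by auto
  ultimately show ?thesis using KM unfolding computable_map_def by (intro conjI exI[of _ J])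
      simp_all
qed


section \<open>Systems conjugate to computable actions are effective\<close>

locale subshift_setup = group G for G :: "('g, 'z) monoid_scheme" (structure) +
  fixes A :: "'b set" and X :: "('g \<Rightarrow> 'b) set" and S :: "'g set"
  assumes generating: "finite_generating_set G S"
    and finite_alphabet: "finite A"
    and subshift: "subshift G A X"
begin

abbreviation "F \<equiv> carrier (free_group S)"
abbreviation "\<phi> \<equiv> word_val G"

lemma finite_S: "finite S" and S_subset: "S \<subseteq> carrier G" and generate_S: "generate G S = carrier G"
  using generating by (auto simp: finite_generating_set_def)

lemma free_group_lists: "w \<in> F \<Longrightarrow> w \<in> lists (UNIV \<times> S)"
  by (simp add: free_group_def)

lemma word_val_in: "w \<in> lists (UNIV \<times> S) \<Longrightarrow> \<phi> w \<in> carrier G"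
  using S_subset by (intro word_val_closed) auto

lemma letter_val_in: "a \<in> UNIV \<times> S \<Longrightarrow> letter_val G a \<in> carrier G"
  using S_subset by (auto simp: letter_val_def)

lemma X_subset: "X \<subseteq> (\<Pi>\<^sub>E g\<in>carrier G. A)"
  using subshift closedin_subset by (fastforce simp: subshift_def full_shift_topology_def)

lemma X_value: "x \<in> X \<Longrightarrow> g \<in> carrier G \<Longrightarrow> x g \<in> A"
  using X_subset by auto

lemma topspace_X: "topspace (subshift_topology G A X) = X"
  using X_subset by (auto simp: subshift_topology_def full_shift_topology_def)

lemma shift_in: "x \<in> X \<Longrightarrow> g \<in> carrier G \<Longrightarrow> shift G g x \<in> X"
  using subshift by (simp add: subshift_def)

lemma shift_eval: "g \<in> carrier G \<Longrightarrow> h \<in> carrier G \<Longrightarrow> shift G g x h = x (inv g \<otimes> h)"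
  by (simp add: shift_def)

lemma openin_coordinate:
  assumes "g \<in> carrier G" shows "openin (subshift_topology G A X) {x \<in> X. x g \<in> B}"
proof -
  have "continuous_map (subshift_topology G A X) (discrete_topology A) (\<lambda>x. x g)"
    unfolding subshift_topology_def full_shift_topology_def
    using assms by (intro continuous_map_from_subtopology continuous_map_product_projection)
  then have "openin (subshift_topology G A X) {x \<in> topspace (subshift_topology G A X). x g \<in> B \<inter> A}"
    by (rule openin_continuous_map_preimage) simp
  also have "{x \<in> topspace (subshift_topology G A X). x g \<in> B \<inter> A} = {x \<in> X. x g \<in> B}"
    unfolding topspace_X using X_value assms by auto
  finally show ?thesis .
qed

text \<open>A condition on \<open>X\<close> itself instead of its pullback;
  \<open>effectively_closed_iff\<close> matches the two.\<close>

definition forbidden :: "('g word \<rightharpoonup> 'b) \<Rightarrow> bool" where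
  "forbidden p \<longleftrightarrow> \<not> (\<exists>x\<in>X. \<forall>w a. p w = Some a \<longrightarrow> x (\<phi> w) = a)"

lemma effectively_closed_iff:
  "effectively_closed S A (pullback G S X) \<longleftrightarrow>
     semidecidable (\<lambda>c. c \<in> pattern_code S A ` {p \<in> patterns S A. forbidden p})"
proof -
  have "(\<exists>y\<in>pullback G S X. (Some \<circ> y) |` dom p = p) \<longleftrightarrow> \<not> forbidden p" if p: "p \<in> patterns S A" for p
  proof -
    have "(Some \<circ> compose F x \<phi>) |` dom p = p \<longleftrightarrow> (\<forall>w a. p w = Some a \<longrightarrow> x (\<phi> w) = a)" for x
      using patternsD[OF p] by (auto simp: fun_eq_iff restrict_map_def compose_def dom_def split:
          if_splits)
    then show ?thesis by (auto simp: forbidden_def pullback_def)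
  qed
  then have "{p \<in> patterns S A. \<not> (\<exists>y\<in>pullback G S X. (Some \<circ> y) |` dom p = p)} =
      {p \<in> patterns S A. forbidden p}"
    by blast
  then show ?thesis unfolding effectively_closed_def re_set_iff_semidecidable by simp
qed

lemma effectively_closed_if_computable:
  fixes m :: "'y metric"
  assumes cm: "computable_metric_space m s" and rc: "recursively_compact m s K"
    and \<beta>: "homeo_action G (subtopology (mtopology_of m) K) \<beta>"
    and cmap: "\<forall>g\<in>S. computable_map m s K m s (\<beta> g)"
    and conj: "conjugate_actions G (subshift_topology G A X) (shift_action G X)
      (subtopology (mtopology_of m) K) \<beta>"
  shows "effectively_closed S A (pullback G S X)"
proof -
  let ?TX = "subshift_topology G A X" and ?TK = "subtopology (mtopology_of m) K"
  have Kc: "compactin (mtopology_of m) K" using rc by (simp add: recursively_compact_def)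
  then have "K \<subseteq> mspace m" using compactin_subset_topspace by fastforce
  then have topK: "topspace ?TK = K" by auto
  have act: "group_action G K \<beta>"
    and \<beta>_homeo: "\<And>g. g \<in> carrier G \<Longrightarrow> homeomorphic_map ?TK ?TK (\<beta> g)"
    using \<beta> unfolding homeo_action_def topK by auto
  interpret act: group_action G K \<beta> by (rule act)
  have \<beta>_in: "\<beta> g y \<in> K" if "g \<in> carrier G" "y \<in> K" for g y
    using act.element_image that by blast
  have \<beta>_mult: "\<beta> (g \<otimes> h) y = \<beta> g (\<beta> h y)" if "g \<in> carrier G" "h \<in> carrier G" "y \<in> K" for g h y
    using act.composition_rule that by blast
  have \<beta>_one: "\<beta> \<one> y = y" if "y \<in> K" for y
    using act.id_eq_one that by (metis restrict_apply')
  obtain h where h: "homeomorphic_map ?TX ?TK h"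
    and h_eq: "\<And>g x. g \<in> carrier G \<Longrightarrow> x \<in> X \<Longrightarrow> h (shift G g x) = \<beta> g (h x)"
    using conj unfolding conjugate_actions_def topspace_X by (auto simp: shift_action_def)
  have h_img: "h ` X = K" and h_inj: "inj_on h X"
    using homeomorphic_imp_surjective_map[OF h] homeomorphic_imp_injective_map[OF h]
    unfolding topspace_X topK by auto

  \<comment> \<open>Reading a coordinate requires shifting by the inverse of a word. The inverse of
    a formal inverse is a generator, computable by assumption; the inverse of a generator is the
    case for \<open>computable_map_inverse\<close>.\<close>
  have cmap_letter: "computable_map m s K m s (\<beta> (inv (letter_val G a)))" if a: "a \<in> UNIV \<times> S" for a
  proof (cases "fst a")
    case True
    then have "inv (letter_val G a) = snd a" using a S_subset by (auto simp: letter_val_def)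
    then show ?thesis using cmap a by auto
  next
    case False
    then have g: "letter_val G a = snd a" "snd a \<in> S" "snd a \<in> carrier G"
      using a S_subset by (auto simp: letter_val_def)
    show ?thesis unfolding g(1)
    proof (rule computable_map_inverse[OF cm rc])
      show "\<beta> (inv (snd a)) (\<beta> (snd a) x) = x" if "x \<in> K" for x
        using \<beta>_mult[of "inv (snd a)" "snd a" x] \<beta>_one that g(3) by simp
    qed (use g cmap \<beta>_homeo \<beta>_in in auto)
  qed
  have "\<exists>I. uniformly_re I \<and>
      (\<forall>k. {y \<in> K. \<beta> (inv (letter_val G a)) y \<in> basic_ball m s k} = basic_open m s (I k) \<inter> K)"
    if "a \<in> UNIV \<times> S" for a using cmap_letter[OF that] unfolding computable_map_def by blast
  then obtain I where I: "\<And>a. a \<in> UNIV \<times> S \<Longrightarrow> uniformly_re (I a)"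
    "\<And>a k. a \<in> UNIV \<times> S \<Longrightarrow>
      {y \<in> K. \<beta> (inv (letter_val G a)) y \<in> basic_ball m s k} = basic_open m s (I a k) \<inter> K"
    by metis
  \<comment> \<open>The enumerations \<open>I a\<close> are chosen independently; \<open>R\<close>
    joins them into one predicate on letter codes, semidecidable because there are finitely many
    letters.\<close>
  define R where "R l k n \<longleftrightarrow> (\<exists>a\<in>UNIV \<times> S. l = letter_code S a \<and> n \<in> I a k)" for l k n
  have R_sig: "semidecidable (\<lambda>p. R (fst p) (fst (snd p)) (snd (snd p)))"
    unfolding R_def
  proof (rule semidecidable_finite_bex)
    show "finite ((UNIV :: bool set) \<times> S)" using finite_S by simp
  qed (intro semidecidable_conj semidecidable_dec[OF decidable_eq]
      semidecidable_comp2[OF I(1)[unfolded uniformly_re_iff_semidecidable]] recursive_fst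
      recursive_snd recursive_id recursive_const)
  have R_iff: "R (letter_code S a) k n \<longleftrightarrow> n \<in> I a k" if "a \<in> UNIV \<times> S" for a k n
    using inj_on_eq_iff[OF bij_betw_imp_inj_on[OF bij_betw_letter_code[OF finite_S]] that] that
    unfolding R_def by metis
  \<comment> \<open>Inversion reverses products: the inverse of the leading letter acts on
    \<open>y\<close> first, so its preimage is taken last, as in the recursion of
    \<open>chain\<close>.\<close>
  have chain: "\<beta> (inv (\<phi> w)) y \<in> basic_ball m s k \<longleftrightarrow>
      (\<exists>n. chain R (map (letter_code S) w) k n \<and> y \<in> basic_ball m s n)"
    if "w \<in> lists (UNIV \<times> S)" "y \<in> K" for w y k
    using that
  proof (induction w arbitrary: y)
    case Nil
    then show ?case by (simp add: word_val_def \<beta>_one)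
  next
    case (Cons a w)
    have a: "letter_val G a \<in> carrier G" "\<phi> w \<in> carrier G"
      using Cons.hyps letter_val_in word_val_in by auto
    let ?y = "\<beta> (inv (letter_val G a)) y"
    have y: "?y \<in> K" using \<beta>_in a Cons.prems by simp
    have "\<beta> (inv (\<phi> (a # w))) y = \<beta> (inv (\<phi> w)) ?y"
      using a Cons.prems by (simp add: word_val_Cons inv_mult_group \<beta>_mult)
    then have "\<beta> (inv (\<phi> (a # w))) y \<in> basic_ball m s k \<longleftrightarrow>
        (\<exists>l. chain R (map (letter_code S) w) k l \<and> ?y \<in> basic_ball m s l)"
      using Cons.IH[OF y] by simp
    moreover have "?y \<in> basic_ball m s l \<longleftrightarrow> (\<exists>n. R (letter_code S a) l n \<and> y \<in> basic_ball m s n)"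
        for l
      using I(2)[OF Cons.hyps(1), of l] Cons.prems unfolding R_iff[OF Cons.hyps(1)] basic_open_def
          by blast
    ultimately show ?case by auto
  qed

  define C where "C b = h ` {x \<in> X. x \<one> = b}" for b
  \<comment> \<open>\<open>C b\<close> is clopen: openness provides balls whose trace on
    \<open>K\<close> stays in \<open>C b\<close>, and compactness selects finitely many. The choice
    is not effective, but only finitely many symbols occur.\<close>
  have "\<exists>c. basic_open m s (set_decode c) \<inter> K = C b" for b
  proof -
    have "openin ?TX {x \<in> X. x \<one> \<in> {b}}" "openin ?TX {x \<in> X. x \<one> \<in> - {b}}"
      by (rule openin_coordinate, simp)+
    then have op: "openin ?TK (h ` {x \<in> X. x \<one> \<in> {b}})" "openin ?TK (h ` {x \<in> X. x \<one> \<in> - {b}})"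
      using h by (auto simp: homeomorphic_eq_everything_map open_map_def)
    have "h ` (X - {x \<in> X. x \<one> \<in> - {b}}) = K - h ` {x \<in> X. x \<one> \<in> - {b}}"
      using inj_on_image_set_diff[OF h_inj, of X "{x \<in> X. x \<one> \<in> - {b}}"] by (simp add: h_img)
    moreover have "X - {x \<in> X. x \<one> \<in> - {b}} = {x \<in> X. x \<one> = b}" by auto
    ultimately have "K - h ` {x \<in> X. x \<one> \<in> - {b}} = C b" by (simp add: C_def)
    then have "closedin ?TK (C b)" using closedin_diff[OF closedin_topspace op(2)]
        by (simp only: topK)
    moreover have "compact_space ?TK" using Kc by (rule compact_space_subtopology)
    ultimately have "compactin ?TK (C b)" by (intro closedin_compact_space)
    then have "compactin (mtopology_of m) (C b)" by (simp add: compactin_subtopology)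
    moreover obtain V where V: "openin (mtopology_of m) V" "C b = V \<inter> K"
      using op(1) by (auto simp: openin_subtopology C_def)
    have "C b \<subseteq> basic_open m s {n. basic_ball m s n \<subseteq> V}"
    proof
      fix y assume "y \<in> C b"
      with V(2) have "y \<in> V" by blast
      then show "y \<in> basic_open m s {n. basic_ball m s n \<subseteq> V}"
        using basic_ball_in_open[OF cm V(1)] unfolding basic_open_def by blast
    qed
    ultimately obtain c where "set_decode c \<subseteq> {n. basic_ball m s n \<subseteq> V}"
        "C b \<subseteq> basic_open m s (set_decode c)"
      by (rule compactin_basic_subcover)
    with V(2) have "basic_open m s (set_decode c) \<inter> K = C b" unfolding basic_open_def by blast
    then show ?thesis ..
  qed
  then obtain c where c: "\<And>b. basic_open m s (set_decode (c b)) \<inter> K = C b" by metis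

  \<comment> \<open>A finite table, hence decidable, and the only trace of the conjugacy in the
    algorithm.\<close>
  define L where "L = (\<Union>b\<in>A. {to_nat_on A b} \<times> set_decode (c b))"
  have "finite L" unfolding L_def using finite_alphabet by auto
  have L_iff: "(to_nat_on A b, l) \<in> L \<longleftrightarrow> l \<in> set_decode (c b)" if "b \<in> A" for b l
    using that bij_betw_imp_inj_on[OF to_nat_on_finite[OF finite_alphabet]]
    unfolding L_def by (auto simp: inj_on_eq_iff)
  \<comment> \<open>Disagreement with an entry \<open>e\<close> is put positively, as carrying
    another symbol there, so that it describes a union of enumerable balls.\<close>
  define P where "P d n \<longleftrightarrow> (\<exists>e\<in>set_decode d. \<exists>b<card A. b \<noteq> snd (prod_decode e) \<and>
    (\<exists>l. (b, l) \<in> L \<and> chain R (list_decode (fst (prod_decode e))) l n))" for d n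
  have P_sig: "semidecidable (\<lambda>p. P (fst p) (snd p))"
    unfolding P_def
    by (intro semidecidable_bex_set_decode semidecidable_ex_less semidecidable_conj semidecidable_ex
        semidecidable_dec[OF decidable_not] semidecidable_chain[OF R_sig]
        semidecidable_dec[OF decidable_comp[OF decidable_finite[OF \<open>finite L\<close>]]] decidable_eq
        recursive_Pair recursive_list_decode recursive_prod_decode recursive_fst recursive_snd
        recursive_id recursive_const)
  have P_iff: "h x \<in> basic_open m s {n. P (pattern_code S A p) n} \<longleftrightarrow> (\<exists>w a. p w = Some a \<and>
      x (\<phi> w) \<noteq> a)"
    if x: "x \<in> X" and p: "p \<in> patterns S A" for x p
  proof -
    have hx: "h x \<in> K" using h_img x by blast
    have hC: "h x' \<in> C b \<longleftrightarrow> x' \<one> = b" if "x' \<in> X" for x' b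
      using h_inj that unfolding C_def by (auto simp: inj_on_eq_iff)
    \<comment> \<open>Equivariance turns the value of \<open>x\<close> at \<open>\<phi> w\<close>
      into the value of a shifted point at the identity, where the balls in \<open>c b\<close>
      recognise it.\<close>
    have *: "(\<exists>l\<in>set_decode (c b). \<exists>n. chain R (map (letter_code S) w) l n \<and> h x \<in> basic_ball m s n)
        \<longleftrightarrow> x (\<phi> w) = b" if w: "w \<in> F" for w b
    proof -
      have wG: "\<phi> w \<in> carrier G" using word_val_in free_group_lists w by blast
      then have K: "\<beta> (inv (\<phi> w)) (h x) \<in> K" using \<beta>_in hx by simp
      have "(\<exists>l\<in>set_decode (c b). \<exists>n. chain R (map (letter_code S) w) l n \<and>
          h x \<in> basic_ball m s n) \<longleftrightarrow>
        (\<exists>l\<in>set_decode (c b). \<beta> (inv (\<phi> w)) (h x) \<in> basic_ball m s l)"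
        using chain[OF free_group_lists[OF w] hx] by blast
      also have "\<dots> \<longleftrightarrow> \<beta> (inv (\<phi> w)) (h x) \<in> C b" using c[of b] K unfolding basic_open_def by blast
      also have "\<dots> \<longleftrightarrow> shift G (inv (\<phi> w)) x \<one> = b"
        using h_eq[of "inv (\<phi> w)" x] hC[OF shift_in, of x "inv (\<phi> w)"] wG x by simp
      also have "\<dots> \<longleftrightarrow> x (\<phi> w) = b" using wG by (simp add: shift_eval)
      finally show ?thesis .
    qed
    have bijA: "bij_betw (to_nat_on A) A {..<card A}" by (rule to_nat_on_finite[OF finite_alphabet])
    have alph: "(\<exists>b<card A. Q b) \<longleftrightarrow> (\<exists>b\<in>A. Q (to_nat_on A b))" for Q
      using bij_betw_imp_surj_on[OF bijA] by (metis imageE image_eqI lessThan_iff)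
    have "h x \<in> basic_open m s {n. P (pattern_code S A p) n} \<longleftrightarrow>
       (\<exists>w a. p w = Some a \<and> (\<exists>b\<in>A. b \<noteq> a \<and> (\<exists>l\<in>set_decode (c b). \<exists>n. chain R (map (letter_code S)
           w) l n \<and> h x \<in> basic_ball m s n)))"
    proof -
      have "(b \<in> A \<and> to_nat_on A b \<noteq> to_nat_on A a \<and> (\<exists>l. (to_nat_on A b, l) \<in> L \<and> Q l)) \<longleftrightarrow>
          (b \<in> A \<and> b \<noteq> a \<and> (\<exists>l\<in>set_decode (c b). Q l))" if "p w = Some a" for w a b Q
        using L_iff[of b] inj_on_eq_iff[OF bij_betw_imp_inj_on[OF bijA], of b a]
            patternsD(2)[OF p that] by blast
      note 1 = this
      have "P (pattern_code S A p) n \<longleftrightarrow> (\<exists>w a. p w = Some a \<and> (\<exists>b. b \<in> A \<and>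
          to_nat_on A b \<noteq> to_nat_on A a \<and>
          (\<exists>l. (to_nat_on A b, l) \<in> L \<and> chain R (map (letter_code S) w) l n)))" for n
      proof -
        have 2: "(\<exists>e\<in>{prod_encode (word_code S w, to_nat_on A a) | w a. p w = Some a}. Q e) \<longleftrightarrow>
            (\<exists>w a. p w = Some a \<and> Q (prod_encode (word_code S w, to_nat_on A a)))" for Q by blast
        show ?thesis unfolding P_def set_decode_pattern_code[OF p] alph 2
          by (simp only: prod_encode_inverse fst_conv snd_conv word_code_conv list_encode_inverse
              Bex_def)
      qed
      moreover have "(\<exists>w a. p w = Some a \<and> (\<exists>b. b \<in> A \<and> to_nat_on A b \<noteq> to_nat_on A a \<and>
          (\<exists>l. (to_nat_on A b, l) \<in> L \<and> chain R (map (letter_code S) w) l n))) \<longleftrightarrow> (\<exists>w a. p w = Some a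
              \<and> (\<exists>b. b \<in> A \<and> b \<noteq> a \<and>
          (\<exists>l\<in>set_decode (c b). chain R (map (letter_code S) w) l n)))" for n
        by (intro arg_cong[where f = Ex] ext conj_cong refl 1)
      ultimately have 3: "P (pattern_code S A p) n \<longleftrightarrow> (\<exists>w a. p w = Some a \<and> (\<exists>b. b \<in> A \<and> b \<noteq> a \<and>
          (\<exists>l\<in>set_decode (c b). chain R (map (letter_code S) w) l n)))" for n by simp
      show ?thesis unfolding basic_open_def UN_iff mem_Collect_eq 3 Bex_def by blast
    qed
    also have "\<dots> \<longleftrightarrow> (\<exists>w a. p w = Some a \<and> (\<exists>b\<in>A. b \<noteq> a \<and> x (\<phi> w) = b))"
      using * patternsD(1)[OF p] by blast
    also have "\<dots> \<longleftrightarrow> (\<exists>w a. p w = Some a \<and> x (\<phi> w) \<noteq> a)"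
      using patternsD(1)[OF p] X_value[OF x] word_val_in[OF free_group_lists] by blast
    finally show ?thesis .
  qed
  \<comment> \<open>A point of \<open>K\<close> is left uncovered exactly when it comes from a
    configuration that realises the pattern.\<close>
  have "c \<in> pattern_code S A ` {p \<in> patterns S A. forbidden p} \<longleftrightarrow>
      valid_pattern (card S) (card A) c \<and> K \<subseteq> basic_open m s {n. P c n}" for c
  proof -
    have forb: "K \<subseteq> basic_open m s {n. P (pattern_code S A p) n} \<longleftrightarrow> forbidden p" if
        "p \<in> patterns S A" for p
      unfolding h_img[symmetric] image_subset_iff forbidden_def using P_iff[OF _ that] by blast
    have "valid_pattern (card S) (card A) c \<longleftrightarrow> c \<in> pattern_code S A ` patterns S A"
      using valid_patterns[OF finite_S finite_alphabet] by blast
    then have "valid_pattern (card S) (card A) c \<and> K \<subseteq> basic_open m s {n. P c n} \<longleftrightarrow>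
        (\<exists>p\<in>patterns S A. c = pattern_code S A p \<and> K \<subseteq> basic_open m s {n. P (pattern_code S A p)
            n})"
      by auto
    also have "\<dots> \<longleftrightarrow> c \<in> pattern_code S A ` {p \<in> patterns S A. forbidden p}"
      using forb by blast
    finally show ?thesis ..
  qed
  then show ?thesis
    unfolding effectively_closed_iff
    by (simp only:) (intro semidecidable_conj semidecidable_dec decidable_valid_pattern
        semidecidable_covered[OF rc P_sig])
qed

end


section \<open>Transport of actions\<close>

text \<open>Continuity of all maps suffices for homeomorphisms, as \<open>\<alpha> (inv g)\<close>
  inverts \<open>\<alpha> g\<close>; extensionality is demanded because \<open>BijGroup\<close>
  consists of extensional maps.\<close>

lemma homeo_actionI:
  fixes G (structure)
  assumes "group G"
    and cont: "\<And>g. g \<in> carrier G \<Longrightarrow> continuous_map T T (\<alpha> g)"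
    and ext: "\<And>g. g \<in> carrier G \<Longrightarrow> \<alpha> g \<in> extensional (topspace T)"
    and mult: "\<And>g h x. g \<in> carrier G \<Longrightarrow> h \<in> carrier G \<Longrightarrow> x \<in> topspace T \<Longrightarrow>
      \<alpha> (g \<otimes> h) x = \<alpha> g (\<alpha> h x)"
    and one: "\<And>x. x \<in> topspace T \<Longrightarrow> \<alpha> \<one> x = x"
  shows "homeo_action G T \<alpha>"
proof -
  interpret group G by fact
  have in_T: "\<alpha> g x \<in> topspace T" if "g \<in> carrier G" "x \<in> topspace T" for g x
    using continuous_map_image_subset_topspace[OF cont[OF that(1)]] that(2) by blast
  have inv: "\<alpha> (inv g) (\<alpha> g x) = x" "\<alpha> g (\<alpha> (inv g) x) = x" if "g \<in> carrier G" "x \<in> topspace T"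
      for g x
    using mult[of "inv g" g x] mult[of g "inv g" x] one that by simp_all
  have homeo: "homeomorphic_map T T (\<alpha> g)" if "g \<in> carrier G" for g
    unfolding homeomorphic_map_maps homeomorphic_maps_def
    using cont inv that by (intro exI[of _ "\<alpha> (inv g)"]) auto
  have Bij: "\<alpha> g \<in> Bij (topspace T)" if "g \<in> carrier G" for g
    unfolding Bij_def bij_betw_def
    using ext[OF that] homeomorphic_imp_surjective_map[OF homeo[OF that]]
      homeomorphic_imp_injective_map[OF homeo[OF that]] by simp
  have "\<alpha> \<in> hom G (BijGroup (topspace T))"
  proof (rule homI)
    fix g h assume gh: "g \<in> carrier G" "h \<in> carrier G"
    have "\<alpha> (g \<otimes> h) = compose (topspace T) (\<alpha> g) (\<alpha> h)"
      using ext[of "g \<otimes> h"] mult gh by (intro extensionalityI[of _ "topspace T"])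
          (auto simp: compose_def)
    then show "\<alpha> (g \<otimes> h) = \<alpha> g \<otimes>\<^bsub>BijGroup (topspace T)\<^esub> \<alpha> h"
      using Bij gh by (simp add: BijGroup_def)
  qed (use Bij in \<open>simp add: BijGroup_def\<close>)
  then show ?thesis
    unfolding homeo_action_def using homeo group_BijGroup
    by (auto simp: group_action_def group_hom_def group_hom_axioms_def is_group)
qed

lemma homeo_action_transport:
  fixes G (structure)
  assumes "homeo_action G T \<alpha>" and h: "homeomorphic_map T T' h"
  obtains \<beta> where "homeo_action G T' \<beta>"
    "\<And>g x. g \<in> carrier G \<Longrightarrow> x \<in> topspace T \<Longrightarrow> \<beta> g (h x) = h (\<alpha> g x)"
proof -
  have act: "group_action G (topspace T) \<alpha>" and homeo:
      "\<And>g. g \<in> carrier G \<Longrightarrow> homeomorphic_map T T (\<alpha> g)"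
    using assms(1) by (auto simp: homeo_action_def)
  interpret act: group_action G "topspace T" \<alpha> by (rule act)
  have G: "group G" using act.group_hom by (simp add: group_hom_def)
  then interpret group G .
  obtain k where k: "homeomorphic_maps T T' h k" using h by (auto simp: homeomorphic_map_maps)
  then have kh: "k (h x) = x" if "x \<in> topspace T" for x using that
      by (auto simp: homeomorphic_maps_def)
  have hk: "h (k y) = y" if "y \<in> topspace T'" for y using k that
      by (auto simp: homeomorphic_maps_def)
  have cont: "continuous_map T T' h" "continuous_map T' T k" using k
      by (auto simp: homeomorphic_maps_def)
  have h_in: "h x \<in> topspace T'" if "x \<in> topspace T" for x
    using continuous_map_image_subset_topspace[OF cont(1)] that by blast
  have k_in: "k y \<in> topspace T" if "y \<in> topspace T'" for y
    using continuous_map_image_subset_topspace[OF cont(2)] that by blast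
  define \<beta> where "\<beta> g = restrict (h \<circ> \<alpha> g \<circ> k) (topspace T')" for g
  have \<beta>h: "\<beta> g (h x) = h (\<alpha> g x)" if "x \<in> topspace T" for g x
    using that by (simp add: \<beta>_def h_in kh)
  have "homeo_action G T' \<beta>"
  proof (rule homeo_actionI[OF G])
    fix g assume g: "g \<in> carrier G"
    have "continuous_map T' T' (h \<circ> \<alpha> g \<circ> k)"
      using homeomorphic_imp_continuous_map[OF homeo[OF g]] cont
          by (auto intro: continuous_map_compose)
    then show "continuous_map T' T' (\<beta> g)" by (rule continuous_map_eq) (simp add: \<beta>_def)
    show "\<beta> g \<in> extensional (topspace T')" by (simp add: \<beta>_def)
  next
    fix g g' y assume g: "g \<in> carrier G" "g' \<in> carrier G" and y: "y \<in> topspace T'"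
    from k_in[OF y] hk[OF y] obtain x where x: "x \<in> topspace T" "y = h x" by metis
    have "\<alpha> g' x \<in> topspace T" using act.element_image[OF g(2) x(1)] by blast
    with x g show "\<beta> (g \<otimes> g') y = \<beta> g (\<beta> g' y)"
      by (simp add: \<beta>h act.composition_rule)
  next
    fix y assume y: "y \<in> topspace T'"
    from k_in[OF y] hk[OF y] obtain x where x: "x \<in> topspace T" "y = h x" by metis
    have "\<alpha> \<one> x = x" using act.id_eq_one x(1) by (metis restrict_apply')
    with x show "\<beta> \<one> y = y" by (simp add: \<beta>h)
  qed
  with \<beta>h that show ?thesis by blast
qed

section \<open>Baire space as a computable metric space\<close>

text \<open>Nonzero distances are unit fractions, so a program can output distances between points
  of the dense sequence exactly.\<close>

definition baire_dist :: "(nat \<Rightarrow> nat) \<Rightarrow> (nat \<Rightarrow> nat) \<Rightarrow> real" where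
  "baire_dist x y = (if x = y then 0 else 1 / real (Suc (LEAST k. x k \<noteq> y k)))"

text \<open>Balls become agreement on an initial segment. Transitivity of agreement gives the
  ultrametric inequality, from which the triangle inequality is drawn.\<close>

lemma baire_dist_less_iff:
  assumes "r > 0" shows "baire_dist x y < r \<longleftrightarrow> (\<forall>k. r \<le> 1 / real (Suc k) \<longrightarrow> x k = y k)"
proof (cases "x = y")
  case True
  then show ?thesis using assms by (simp add: baire_dist_def)
next
  case False
  define l where "l = (LEAST k. x k \<noteq> y k)"
  from False have "\<exists>k. x k \<noteq> y k" by (simp add: fun_eq_iff)
  then have l: "x l \<noteq> y l" unfolding l_def by (rule LeastI_ex)
  have less: "x k = y k" if "k < l" for k using that not_less_Least unfolding l_def by blast
  have d: "baire_dist x y = 1 / real (Suc l)" using False by (simp add: baire_dist_def l_def)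
  show ?thesis unfolding d
  proof
    assume r: "1 / real (Suc l) < r"
    show "\<forall>k. r \<le> 1 / real (Suc k) \<longrightarrow> x k = y k"
    proof (intro allI impI)
      fix k assume "r \<le> 1 / real (Suc k)"
      with r have "1 / real (Suc l) < 1 / real (Suc k)" by linarith
      then have "k < l" by (simp add: field_simps)
      then show "x k = y k" by (rule less)
    qed
  next
    assume "\<forall>k. r \<le> 1 / real (Suc k) \<longrightarrow> x k = y k"
    with l show "1 / real (Suc l) < r" by (meson not_le)
  qed
qed

definition baire :: "(nat \<Rightarrow> nat) metric" where
  "baire = metric (UNIV, baire_dist)"

lemma Metric_space_baire: "Metric_space UNIV baire_dist"
proof
  fix x y :: "nat \<Rightarrow> nat"
  show "0 \<le> baire_dist x y" by (simp add: baire_dist_def)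
  have "(LEAST k. x k \<noteq> y k) = (LEAST k. y k \<noteq> x k)" by (rule arg_cong[where f = Least]) auto
  then show "baire_dist x y = baire_dist y x" by (auto simp: baire_dist_def)
  show "baire_dist x y = 0 \<longleftrightarrow> x = y" by (simp add: baire_dist_def)
  fix z :: "nat \<Rightarrow> nat"
  show "baire_dist x z \<le> baire_dist x y + baire_dist y z"
  proof (rule dense_ge)
    fix r assume r: "baire_dist x y + baire_dist y z < r"
    have "0 \<le> baire_dist x y" "0 \<le> baire_dist y z" by (simp_all add: baire_dist_def)
    with r have "r > 0" "baire_dist x y < r" "baire_dist y z < r" by linarith+
    then have "baire_dist x z < r" by (simp add: baire_dist_less_iff)
    then show "baire_dist x z \<le> r" by simp
  qed
qed

lemma mspace_baire [simp]: "mspace baire = UNIV" and mdist_baire [simp]: "mdist baire = baire_dist"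
  unfolding baire_def
  by (simp_all add: Metric_space.mspace_metric[OF Metric_space_baire]
      Metric_space.mdist_metric[OF Metric_space_baire])

interpretation baire: Metric_space UNIV baire_dist by (rule Metric_space_baire)

lemma mtopology_of_baire: "mtopology_of baire = baire.mtopology"
  by (simp add: mtopology_of_def)

section \<open>The dense sequence of finitely supported points, and computability of the
  metric\<close>

definition baire_point :: "nat \<Rightarrow> nat \<Rightarrow> nat" where
  "baire_point i = nth0 (list_decode i)"

lemma recursive_baire_point: "recursive f \<Longrightarrow> recursive g \<Longrightarrow> recursive (\<lambda>x. baire_point (f x) (g x))"
  unfolding baire_point_def by (intro recursive_nth0 recursive_list_decode)

lemma baire_point_prefix: "\<exists>i. \<forall>k<n. baire_point i k = x k"
  by (rule exI[of _ "list_encode (map x [0..<n])"]) (simp add: baire_point_def nth0_def)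

text \<open>Ball membership without reals: radius \<open>(a + 1) / (b + 1)\<close> constrains the
  coordinates \<open>k\<close> with \<open>(a + 1) * (k + 1) \<le> b + 1\<close>. These are at most
  \<open>b\<close>, so the quantifier can be bounded.\<close>

definition in_ball :: "nat \<Rightarrow> (nat \<Rightarrow> nat) \<Rightarrow> bool" where
  "in_ball n x \<longleftrightarrow> (case prod_decode n of (i, l) \<Rightarrow> case prod_decode l of (a, b) \<Rightarrow>
     \<forall>k<Suc b. Suc a * Suc k \<le> Suc b \<longrightarrow> x k = baire_point i k)"

lemma basic_ball_baire: "x \<in> basic_ball baire baire_point n \<longleftrightarrow> in_ball n x"
proof -
  obtain i a b where n: "n = prod_encode (i, prod_encode (a, b))"
    by (metis prod_decode_inverse surj_pair)
  let ?r = "real (Suc a) / real (Suc b)"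
  have "?r > 0" by simp
  have *: "?r \<le> 1 / real (Suc k) \<longleftrightarrow> Suc a * Suc k \<le> Suc b" for k
  proof -
    have "?r \<le> 1 / real (Suc k) \<longleftrightarrow> real (Suc a) * real (Suc k) \<le> real (Suc b)"
      by (simp add: field_simps)
    also have "\<dots> \<longleftrightarrow> Suc a * Suc k \<le> Suc b" by (simp only: of_nat_mult[symmetric] of_nat_le_iff)
    finally show ?thesis .
  qed
  have **: "k < Suc b" if "Suc a * Suc k \<le> Suc b" for k
  proof -
    have "Suc k \<le> Suc a * Suc k" by simp
    with that show ?thesis by linarith
  qed
  have "x \<in> basic_ball baire baire_point n \<longleftrightarrow> baire_dist (baire_point i) x < ?r"
    by (simp add: n basic_ball_def mball_of_def del: of_nat_Suc)
  also have "\<dots> \<longleftrightarrow> (\<forall>k. Suc a * Suc k \<le> Suc b \<longrightarrow> baire_point i k = x k)"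
    unfolding baire_dist_less_iff[OF \<open>?r > 0\<close>] * ..
  also have "\<dots> \<longleftrightarrow> in_ball n x"
    unfolding in_ball_def n prod_encode_inverse prod.case using ** by metis
  finally show ?thesis .
qed

lemma baire_mballI:
  assumes "1 / real (Suc n) < r" "\<And>k. k < n \<Longrightarrow> x k = y k"
  shows "baire_dist x y < r"
proof -
  have "0 < 1 / real (Suc n)" by simp
  with assms(1) have "r > 0" by linarith
  moreover have "k < n" if "r \<le> 1 / real (Suc k)" for k
  proof -
    have "1 / real (Suc n) < 1 / real (Suc k)" using assms(1) that by linarith
    then show ?thesis by (simp add: field_simps)
  qed
  ultimately show ?thesis using assms(2) by (simp add: baire_dist_less_iff)
qed

lemma ex_inverse_Suc_less: "r > 0 \<Longrightarrow> \<exists>n. 1 / real (Suc n) < r"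
  using reals_Archimedean[of r] by (simp add: inverse_eq_divide)

lemma recursive3_evals:
  assumes "recursive (\<lambda>p :: nat \<times> nat \<times> nat. f (fst p) (fst (snd p)) (snd (snd p)) :: nat)"
  obtains r where "\<And>i j n. evals r [i, j, n] (f i j n)"
proof -
  let ?F = "\<lambda>p :: nat \<times> nat \<times> nat. f (fst p) (fst (snd p)) (snd (snd p))"
  have d: "(dcd (prod_encode (i, prod_encode (j, n))) :: nat \<times> nat \<times> nat) = (i, j, n)" for i j n
    by (subst enc_eq_iff[symmetric]) (simp del: enc_eq_iff)
  have "recursive_nary 3 (\<lambda>xs. enc (?F (dcd (prod_encode (xs ! 0, prod_encode (xs ! 1, xs ! 2))))))"
    by (rule recursive_nary_comp1[OF assms[unfolded recursive_iff_nary]])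
        (intro recursive_nary_comp2[OF recursive_nary_prod_encode] recursive_nary_proj; simp)
  then obtain r where r: "\<And>xs. length xs = 3 \<Longrightarrow>
      evals r xs (enc (?F (dcd (prod_encode (xs ! 0, prod_encode (xs ! 1, xs ! 2))))))"
    unfolding recursive_nary_def by blast
  have "evals r [i, j, n] (f i j n)" for i j n
    using r[of "[i, j, n]"] by (simp add: d)
  then show ?thesis by (rule that)
qed

lemma length_list_decode_le: "length (list_decode n) \<le> n"
  using length_le_enc[of "list_decode n"] by (simp add: enc_nat_list)

lemma baire_point_eq_0: "n \<le> k \<Longrightarrow> baire_point n k = 0"
  using length_list_decode_le[of n] by (simp add: baire_point_def nth0_def)

lemma computable_metric_space_baire: "computable_metric_space baire baire_point"
  unfolding computable_metric_space_def
proof (intro conjI)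
  show "range baire_point \<subseteq> mspace baire" by simp
  have "\<exists>y\<in>range baire_point. y \<in> baire.mball x r" if r: "r > 0" for x r
  proof -
    from ex_inverse_Suc_less[OF r] obtain n where n: "1 / real (Suc n) < r" ..
    from baire_point_prefix obtain i where "\<And>k. k < n \<Longrightarrow> baire_point i k = x k" by blast
    then have "baire_dist x (baire_point i) < r" by (intro baire_mballI[OF n]) simp
    then show ?thesis by auto
  qed
  then show "mtopology_of baire closure_of range baire_point = mspace baire"
    unfolding mtopology_of_baire baire.metric_closure_of by auto
next
  define agree where "agree i j l \<longleftrightarrow> (\<forall>k<l. baire_point i k = baire_point j k)" for i j l
  \<comment> \<open>The points numbered \<open>i\<close> and \<open>j\<close> vanish from
    \<open>i\<close> and from \<open>j\<close> onwards, so agreement below \<open>i + j\<close> is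
    equality. The sum counts the coordinates before the first disagreement, and the component 2
    codes the integer 1; the output is the exact distance at every precision.\<close>
  define f where "f i j n = (if agree i j (i + j) then 0
    else prod_encode (2, \<Sum>k<i + j. of_bool (agree i j (Suc k))))" for i j n :: nat
  have "decidable (\<lambda>x. agree (f x) (g x) (l x))" if "recursive f" "recursive g" "recursive l"
      for f g l :: "'x::coded \<Rightarrow> nat"
    unfolding agree_def
    by (intro decidable_all_less decidable_eq recursive_baire_point that recursive_snd recursive_id
        recursive_comp[OF that(1)] recursive_comp[OF that(2)] recursive_fst)
  note decidable_agree = this
  have "recursive (\<lambda>p :: nat \<times> nat \<times> nat. f (fst p) (fst (snd p)) (snd (snd p)))"
    unfolding f_def
    by (intro recursive_if decidable_agree recursive_prod_encode recursive_Pair recursive_sum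
        decidable_agree[unfolded decidable_def] recursive_add recursive_Suc recursive_const
        recursive_fst recursive_snd recursive_id)
  then obtain r where r: "\<And>i j n. evals r [i, j, n] (f i j n)" by (rule recursive3_evals[of f])
      blast
  have "of_rat (rat_decode (f i j n)) = baire_dist (baire_point i) (baire_point j)" for i j n
  proof (cases "agree i j (i + j)")
    case True
    have "baire_point i k = baire_point j k" for k
      using True baire_point_eq_0[of i k] baire_point_eq_0[of j k]
      by (cases "k < i + j") (auto simp: agree_def)
    then have "baire_point i = baire_point j" by auto
    moreover have "prod_decode 0 = (0, 0)"
      using prod_encode_inverse[of "(0, 0)"] by (simp add: prod_encode_def)
    ultimately show ?thesis using True
      by (simp add: f_def baire_dist_def rat_decode_def int_decode_def sum_decode_def)
  next
    case False
    define l where "l = (LEAST k. baire_point i k \<noteq> baire_point j k)"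
    from False obtain k where k: "k < i + j" "baire_point i k \<noteq> baire_point j k"
      by (auto simp: agree_def)
    from k(2) have l: "baire_point i l \<noteq> baire_point j l" "l \<le> k"
      unfolding l_def by (rule LeastI, rule Least_le)
    have less: "baire_point i k = baire_point j k" if "k < l" for k
      using that not_less_Least unfolding l_def by blast
    have "agree i j (Suc k) \<longleftrightarrow> k < l" for k
    proof
      assume "agree i j (Suc k)"
      then show "k < l" using l(1) unfolding agree_def by (meson not_less_eq)
    qed (auto simp: agree_def less)
    moreover have "{..<i + j} \<inter> {k. k < l} = {..<l}" using l(2) k(1) by auto
    ultimately have "(\<Sum>k<i + j. of_bool (agree i j (Suc k))) = l" by (simp add: sum_of_bool_eq)
    moreover have "baire_dist (baire_point i) (baire_point j) = 1 / real (Suc l)"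
      using l(1) by (auto simp: baire_dist_def l_def)
    ultimately show ?thesis using False
      by (simp add: f_def rat_decode_def int_decode_def sum_decode_def of_rat_divide of_rat_add)
  qed
  with r show "\<exists>f. \<forall>i j n. \<exists>c. evals f [i, j, n] c \<and>
      \<bar>mdist baire (baire_point i) (baire_point j) - of_rat (rat_decode c)\<bar> \<le> (1 / 2) ^ n"
    by (intro exI[of _ r] allI exI[of _ "f _ _ _"] conjI) auto
qed

text \<open>A ball constrains finitely many coordinates of \<open>f y\<close>, hence finitely many
  of \<open>y\<close>; where \<open>V\<close> fails, the constraint concerns the ball alone.\<close>

lemma computable_map_reindexing:
  assumes V: "decidable V" and c: "recursive c" and f:
      "\<And>y n. y \<in> K \<Longrightarrow> f y n = (if V n then y (c n) else 0)"
  shows "computable_map baire baire_point K baire baire_point f"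
proof -
  \<comment> \<open>Numerator code 0 means radius \<open>1 / (b' + 1)\<close>, which fixes exactly
    the coordinates up to \<open>b'\<close>. Such a ball is listed when these include every relevant
    \<open>c j\<close> and its centre has the prescribed entries there.\<close>
  define I where "I k = {n. fst (prod_decode (snd (prod_decode n))) = 0 \<and>
    (\<forall>j<Suc (snd (prod_decode (snd (prod_decode k)))).
      Suc (fst (prod_decode (snd (prod_decode k)))) * Suc j \<le> Suc (snd (prod_decode (snd
          (prod_decode k)))) \<longrightarrow>
      (V j \<longrightarrow> c j \<le> snd (prod_decode (snd (prod_decode n))) \<and>
        baire_point (fst (prod_decode n)) (c j) = baire_point (fst (prod_decode k)) j) \<and>
      (\<not> V j \<longrightarrow> baire_point (fst (prod_decode k)) j = 0))}" for k
  have "decidable (\<lambda>p. snd p \<in> I (fst p))"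
    unfolding I_def mem_Collect_eq
    by (intro decidable_conj decidable_eq decidable_all_less decidable_imp decidable_not
        decidable_le decidable_comp[OF V] recursive_comp[OF c] recursive_mult recursive_Suc
        recursive_baire_point recursive_prod_decode recursive_fst recursive_snd recursive_id
        recursive_const)
  then have "uniformly_re I" unfolding uniformly_re_iff_semidecidable by (rule semidecidable_dec)
  moreover have "{y \<in> K. f y \<in> basic_ball baire baire_point k} =
      basic_open baire baire_point (I k) \<inter> K" for k
  proof -
    obtain i a b where k: "k = prod_encode (i, prod_encode (a, b))"
      by (metis prod_decode_inverse surj_pair)
    have "f y \<in> basic_ball baire baire_point k \<longleftrightarrow> (\<exists>n\<in>I k. in_ball n y)" if y: "y \<in> K" for y
    proof
      assume "f y \<in> basic_ball baire baire_point k"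
      then have *: "f y j = baire_point i j" if "j < Suc b" "Suc a * Suc j \<le> Suc b" for j
        using that unfolding basic_ball_baire in_ball_def k by simp
      \<comment> \<open>Large enough to fix every coordinate that \<open>f\<close> reads for a
        coordinate the ball \<open>k\<close> can constrain.\<close>
      define b' where "b' = Max (c ` {..<Suc b})"
      have b': "c j \<le> b'" if "j < Suc b" for j using that unfolding b'_def by (intro Max_ge) auto
      obtain i' where i': "\<And>j. j < Suc b' \<Longrightarrow> baire_point i' j = y j" using baire_point_prefix
          by blast
      let ?n = "prod_encode (i', prod_encode (0, b'))"
      have "?n \<in> I k"
        unfolding I_def k mem_Collect_eq prod_encode_inverse fst_conv snd_conv
      proof (intro conjI allI impI refl)
        fix j assume j: "j < Suc b" "Suc a * Suc j \<le> Suc b"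
        show "c j \<le> b'" by (rule b'[OF j(1)])
        then show "baire_point i' (c j) = baire_point i j" if "V j"
          using *[OF j] f[OF y, of j] that i'[of "c j"] by simp
        show "baire_point i j = 0" if "\<not> V j"
          using *[OF j] f[OF y, of j] that by simp
      qed
      moreover have "in_ball ?n y" using i' by (simp add: in_ball_def)
      ultimately show "\<exists>n\<in>I k. in_ball n y" by blast
    next
      assume "\<exists>n\<in>I k. in_ball n y"
      then obtain n where n: "n \<in> I k" "in_ball n y" by blast
      obtain i' a' b' where n': "n = prod_encode (i', prod_encode (a', b'))"
        by (metis prod_decode_inverse surj_pair)
      from n have y': "y j = baire_point i' j" if "j \<le> b'" for j
        using that by (simp add: I_def n' in_ball_def)
      have "f y j = baire_point i j" if "j < Suc b" "Suc a * Suc j \<le> Suc b" for j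
        using n(1) that y'[of "c j"] f[OF y, of j] by (simp add: I_def n' k)
      then show "f y \<in> basic_ball baire baire_point k"
        unfolding basic_ball_baire in_ball_def k by simp
    qed
    then show ?thesis by (auto simp: basic_open_def basic_ball_baire)
  qed
  ultimately show ?thesis unfolding computable_map_def by (intro conjI exI[of _ I]) auto
qed


section \<open>Effective subshifts are effective dynamical systems\<close>

text \<open>Turns a quantifier over all words of length \<open>n\<close> in \<open>N\<close> symbols
  into a bounded quantifier over numbers.\<close>

lemma ex_digits: "(\<And>k. k < n \<Longrightarrow> f k < N) \<Longrightarrow> \<exists>u<N ^ n. \<forall>k<n. u div N ^ k mod N = (f k :: nat)"
proof (induction n arbitrary: f)
  case (Suc n)
  have "\<exists>u<N ^ n. \<forall>k<n. u div N ^ k mod N = f (Suc k)"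
    by (rule Suc.IH) (use Suc.prems in simp)
  then obtain u where u: "u < N ^ n" "\<And>k. k < n \<Longrightarrow> u div N ^ k mod N = f (Suc k)" by blast
  have f0: "f 0 < N" using Suc.prems by simp
  then have N: "N > 0" by simp
  let ?u = "f 0 + N * u"
  have "?u < N * (u + 1)" using f0 by simp
  also have "\<dots> \<le> N * N ^ n" using u(1) by (intro mult_le_mono2) simp
  finally have "?u < N ^ Suc n" by simp
  moreover have "?u div N ^ k mod N = f k" if "k < Suc n" for k
  proof (cases k)
    case (Suc j)
    have "?u div N = u" using f0 N by simp
    then show ?thesis using u(2)[of j] that Suc by (simp add: div_mult2_eq)
  qed (use f0 in simp)
  ultimately show ?case by blast
qed simp

text \<open>Left multiplication by a letter, computed on codes: the reindexing by which a generator
  will act.\<close>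

definition push_code :: "nat \<Rightarrow> nat list \<Rightarrow> nat list" where
  "push_code l ws = (if ws \<noteq> [] \<and> cancelling l (hd0 ws) then tl ws else l # ws)"

lemma recursive_push_code: "recursive f \<Longrightarrow> recursive (\<lambda>x. push_code l (f x))"
  unfolding push_code_def
  by (intro recursive_if decidable_conj decidable_not decidable_eq decidable_cancelling
      recursive_const recursive_hd0 recursive_tl recursive_Cons)

lemma map_letter_code_push:
  assumes "finite S" "a \<in> UNIV \<times> S" "w \<in> lists (UNIV \<times> S)"
  shows "map (letter_code S) (push a w) = push_code (letter_code S a) (map (letter_code S) w)"
proof (cases w)
  case (Cons b v)
  then have "b \<in> UNIV \<times> S" using assms(3) by simp
  then show ?thesis
    using cancelling_letter_code[OF assms(1,2)] by (simp add: Cons push_code_def)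
qed (simp add: push_code_def)

section \<open>The embedding of a subshift into Baire space\<close>

context subshift_setup
begin

lemma inj_code_A: "inj_on (to_nat_on A) A"
  using bij_betw_imp_inj_on[OF to_nat_on_finite[OF finite_alphabet]] .

lemma compact_space_X: "compact_space (subshift_topology G A X)"
proof -
  have "compact_space (full_shift_topology G A)"
    unfolding full_shift_topology_def compact_space_product_topology
    using finite_alphabet by (simp add: compact_space_discrete_topology)
  then show ?thesis
    unfolding subshift_topology_def using subshift
    by (intro compact_space_subtopology closedin_compact_space) (auto simp: subshift_def)
qed

lemma homeo_action_shift: "homeo_action G (subshift_topology G A X) (shift_action G X)"
proof (rule homeo_actionI)
  show "group G" by (rule is_group)
next
  fix g assume g: "g \<in> carrier G"
  let ?T = "subshift_topology G A X"
  have "continuous_map ?T (full_shift_topology G A) (shift G g)"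
    unfolding full_shift_topology_def continuous_map_componentwise
  proof (intro conjI ballI)
    show "shift G g ` topspace ?T \<subseteq> extensional (carrier G)" by (auto simp: shift_def)
    fix k assume k: "k \<in> carrier G"
    have "continuous_map ?T (discrete_topology A) (\<lambda>x. x (inv g \<otimes> k))"
      unfolding subshift_topology_def full_shift_topology_def
      using g k by (intro continuous_map_from_subtopology continuous_map_product_projection) simp
    then show "continuous_map ?T (discrete_topology A) (\<lambda>x. shift G g x k)"
      using g k by (simp add: shift_eval)
  qed
  then have "continuous_map ?T ?T (shift G g)"
    using shift_in g topspace_X
    by (subst (2) subshift_topology_def) (auto simp: continuous_map_in_subtopology)
  then show "continuous_map ?T ?T (shift_action G X g)"
    by (rule continuous_map_eq) (simp add: shift_action_def topspace_X)
  show "shift_action G X g \<in> extensional (topspace ?T)"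
    by (simp add: shift_action_def topspace_X)
next
  fix g h x assume g: "g \<in> carrier G" "h \<in> carrier G" and "x \<in> topspace (subshift_topology G A X)"
  then have x: "x \<in> X" by (simp add: topspace_X)
  have "shift G (g \<otimes> h) x = shift G g (shift G h x)"
    unfolding shift_def using g by (intro restrict_ext) (simp add: inv_mult_group m_assoc)
  then show "shift_action G X (g \<otimes> h) x = shift_action G X g (shift_action G X h x)"
    using g x by (simp add: shift_action_def shift_in)
next
  fix x assume "x \<in> topspace (subshift_topology G A X)"
  then have x: "x \<in> X" by (simp add: topspace_X)
  then have "x \<in> extensional (carrier G)" using X_subset by (auto simp: PiE_def)
  then have "shift G \<one> x = x"
    unfolding shift_def by (intro extensionalityI[of _ "carrier G"]) auto
  with x show "shift_action G X \<one> x = x" by (simp add: shift_action_def)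
qed

definition valid_code :: "nat \<Rightarrow> bool" where
  "valid_code n \<longleftrightarrow> valid_word (card S) (list_decode n)"

lemma valid_code_iff: "valid_code n \<longleftrightarrow> n \<in> word_code S ` F"
  unfolding valid_code_def by (rule valid_word_iff_word_code[OF finite_S])

lemma decidable_valid_code: "recursive f \<Longrightarrow> decidable (\<lambda>x. valid_code (f x))"
  unfolding valid_code_def by (intro decidable_valid_word recursive_list_decode)

definition word_of :: "nat \<Rightarrow> 'g word" where
  "word_of = inv_into F (word_code S)"

lemma word_of_word_code: "w \<in> F \<Longrightarrow> word_of (word_code S w) = w"
  unfolding word_of_def by (rule inv_into_f_f[OF word_code_inj[OF finite_S]])

text \<open>Numbers that code no reduced word receive the entry 0, a decidable convention that lets
  sequences be indexed by all naturals.\<close>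

definition encode_point :: "('g \<Rightarrow> 'b) \<Rightarrow> nat \<Rightarrow> nat" where
  "encode_point x n = (if valid_code n then to_nat_on A (x (\<phi> (word_of n))) else 0)"

lemma encode_point_word_code: "w \<in> F \<Longrightarrow> encode_point x (word_code S w) = to_nat_on A (x (\<phi> w))"
  by (simp add: encode_point_def valid_code_iff word_of_word_code)

lemma encode_point_invalid: "\<not> valid_code n \<Longrightarrow> encode_point x n = 0"
  by (simp add: encode_point_def)

lemma encode_point_less:
  assumes "x \<in> X" shows "encode_point x n < card A"
proof -
  have bij: "bij_betw (to_nat_on A) A {..<card A}" by (rule to_nat_on_finite[OF finite_alphabet])
  have "x \<one> \<in> A" using X_value[OF assms] by simp
  then have "card A > 0" using finite_alphabet by (auto simp: card_gt_0_iff)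
  moreover have "to_nat_on A (x (\<phi> w)) < card A" if "w \<in> F" for w
    using bij_betwE[OF bij] X_value[OF assms word_val_in[OF free_group_lists[OF that]]] by blast
  ultimately show ?thesis
    by (cases "valid_code n") (auto simp: encode_point_invalid valid_code_iff
        encode_point_word_code)
qed

text \<open>Every group element is the value of a reduced word, so the encoding determines all of
  \<open>x\<close>.\<close>

lemma inj_on_encode_point: "inj_on encode_point X"
proof (rule inj_onI)
  fix x y assume xy: "x \<in> X" "y \<in> X" "encode_point x = encode_point y"
  show "x = y"
  proof (rule extensionalityI[of _ "carrier G"])
    show "x \<in> extensional (carrier G)" "y \<in> extensional (carrier G)"
      using xy X_subset by (auto simp: PiE_def)
    fix g assume g: "g \<in> carrier G"
    then have "g \<in> \<phi> ` F" using word_val_surj[OF S_subset generate_S] by simp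
    then obtain w where w: "w \<in> F" "g = \<phi> w" by blast
    have "to_nat_on A (x g) = to_nat_on A (y g)"
      using fun_cong[OF xy(3), of "word_code S w"] w by (simp add: encode_point_word_code)
    then show "x g = y g" using inj_on_eq_iff[OF inj_code_A] X_value xy g by simp
  qed
qed

text \<open>It suffices to control a finite prefix, and each of its entries is constant or depends
  on one coordinate of the configuration.\<close>

lemma continuous_encode_point:
  "continuous_map (subshift_topology G A X) (mtopology_of baire) encode_point"
  unfolding mtopology_of_baire baire.continuous_map_to_metric
proof (intro ballI allI impI)
  let ?T = "subshift_topology G A X"
  fix x and \<epsilon> :: real assume "x \<in> topspace ?T" and \<epsilon>: "\<epsilon> > 0"
  then have x: "x \<in> X" by (simp add: topspace_X)
  have coord: "openin ?T {y \<in> X. encode_point y k = encode_point x k}" for k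
  proof (cases "valid_code k")
    case True
    then obtain w where w: "w \<in> F" "k = word_code S w" by (auto simp: valid_code_iff)
    have "openin ?T {y \<in> X. y (\<phi> w) \<in> {b. to_nat_on A b = encode_point x k}}"
      by (rule openin_coordinate) (rule word_val_in[OF free_group_lists[OF w(1)]])
    then show ?thesis using w by (simp add: encode_point_word_code)
  next
    case False
    then have "{y \<in> X. encode_point y k = encode_point x k} = topspace ?T"
      by (simp add: encode_point_invalid topspace_X)
    then show ?thesis by (metis openin_topspace)
  qed
  have op: "openin ?T {y \<in> X. \<forall>k<n. encode_point y k = encode_point x k}" for n
  proof (induction n)
    case 0
    have "{y \<in> X. \<forall>k<0. encode_point y k = encode_point x k} = topspace ?T"
        by (simp add: topspace_X)
    then show ?case by (metis openin_topspace)
  next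
    case (Suc n)
    have "{y \<in> X. \<forall>k<Suc n. encode_point y k = encode_point x k} =
        {y \<in> X. \<forall>k<n. encode_point y k = encode_point x k} \<inter> {y \<in> X. encode_point y n = encode_point
            x n}"
      by (auto simp: less_Suc_eq)
    then show ?case using openin_Int[OF Suc coord[of n]] by simp
  qed
  from ex_inverse_Suc_less[OF \<epsilon>] obtain n where n: "1 / real (Suc n) < \<epsilon>" ..
  show "\<exists>U. openin ?T U \<and> x \<in> U \<and> (\<forall>y\<in>U. encode_point y \<in> baire.mball (encode_point x) \<epsilon>)"
  proof (intro exI conjI)
    show "openin ?T {y \<in> X. \<forall>k<n. encode_point y k = encode_point x k}" by (rule op)
    show "x \<in> {y \<in> X. \<forall>k<n. encode_point y k = encode_point x k}" using x by simp
    show "\<forall>y\<in>{y \<in> X. \<forall>k<n. encode_point y k = encode_point x k}. encode_point y \<in> baire.mball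
        (encode_point x) \<epsilon>"
      using baire_mballI[OF n] by simp
  qed
qed

definition encoded_shift :: "(nat \<Rightarrow> nat) set" where "encoded_shift = encode_point ` X"

lemma compactin_encoded_shift: "compactin (mtopology_of baire) encoded_shift"
  unfolding encoded_shift_def using compact_space_X continuous_encode_point
  by (metis compact_space_def image_compactin topspace_X)

text \<open>A continuous injection of a compact space into a Hausdorff space.\<close>

lemma homeomorphic_encode_point:
  "homeomorphic_map (subshift_topology G A X) (subtopology (mtopology_of baire) encoded_shift)
    encode_point"
proof (rule continuous_imp_homeomorphic_map)
  show "continuous_map (subshift_topology G A X) (subtopology (mtopology_of baire) encoded_shift)
      encode_point"
    using continuous_encode_point by (auto simp: continuous_map_in_subtopology encoded_shift_def
        topspace_X)
  show "Hausdorff_space (subtopology (mtopology_of baire) encoded_shift)"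
    unfolding mtopology_of_baire by (intro Hausdorff_space_subtopology
        baire.Hausdorff_space_mtopology)
  show "encode_point ` topspace (subshift_topology G A X) =
      topspace (subtopology (mtopology_of baire) encoded_shift)"
    by (simp add: topspace_X encoded_shift_def)
qed (simp_all add: compact_space_X inj_on_encode_point topspace_X)

text \<open>The shifted point at \<open>\<phi> w\<close> is \<open>x\<close> at
  \<open>inv g \<otimes> \<phi> w\<close>, and \<open>(True, g)\<close> is the letter with value
  \<open>inv g\<close>; the coordinate to read therefore does not depend on
  \<open>x\<close>.\<close>

lemma encode_point_shift:
  assumes g: "g \<in> S" and x: "x \<in> X"
  shows "encode_point (shift G g x) n = (if valid_code n
    then encode_point x (list_encode (push_code (letter_code S (True, g)) (list_decode n))) else 0)"
proof (cases "valid_code n")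
  case True
  then obtain w where w: "w \<in> F" "n = word_code S w" by (auto simp: valid_code_iff)
  have wS: "w \<in> lists (UNIV \<times> S)" by (rule free_group_lists[OF w(1)])
  have gG: "g \<in> carrier G" using g S_subset by blast
  have wG: "w \<in> lists (UNIV \<times> carrier G)" using wS S_subset by auto
  have p: "push (True, g) w \<in> F"
    using w(1) g set_push[of "(True, g)" w] reduced_push[of w] by (auto simp: free_group_def)
  have "encode_point (shift G g x) n = to_nat_on A (x (inv g \<otimes> \<phi> w))"
    unfolding w(2) encode_point_word_code[OF w(1)] using gG word_val_in[OF wS]
        by (simp add: shift_eval)
  also have "inv g \<otimes> \<phi> w = \<phi> (push (True, g) w)"
    using word_val_push[of "(True, g)" w] gG wG by (simp add: letter_val_def)
  also have "to_nat_on A (x (\<phi> (push (True, g) w))) = encode_point x (word_code S (push (True, g)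
      w))"
    by (rule encode_point_word_code[OF p, symmetric])
  also have "word_code S (push (True, g) w) = list_encode (push_code (letter_code S (True, g))
      (list_decode n))"
    using map_letter_code_push[OF finite_S _ wS, of "(True, g)"] g by (simp add: word_code_conv
        w(2))
  finally show ?thesis using True by simp
qed (simp add: encode_point_invalid)

text \<open>Covering is tested on finitely many prefixes: each must break the convention at an
  invalid code, carry a forbidden pattern or lie in a ball. Forbidden refers to whole
  configurations, so a prefix that passes the first two tests extends to a point of the encoded
  shift.\<close>

lemma recursively_compact_encoded_shift:
  assumes "effectively_closed S A (pullback G S X)"
  shows "recursively_compact baire baire_point encoded_shift"
proof -
  let ?N = "card A"
  define Forb where "Forb c \<longleftrightarrow> c \<in> pattern_code S A ` {p \<in> patterns S A. forbidden p}" for c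
  have Forb_sig: "semidecidable Forb" using assms unfolding effectively_closed_iff Forb_def[abs_def]
      .
  have Forb_iff: "Forb (pattern_code S A p) \<longleftrightarrow> forbidden p" if "p \<in> patterns S A" for p
    using inj_onD[OF pattern_code_inj[OF finite_S finite_alphabet]] that unfolding Forb_def by blast
  define dig where "dig u k = u div ?N ^ k mod ?N" for u k
  \<comment> \<open>\<open>set_encode\<close> adds powers of two over the graph, so the code of the
    prefix pattern is directly a sum.\<close>
  define patc :: "nat \<Rightarrow> nat \<Rightarrow> nat" where
    "patc u c = (\<Sum>k<Suc c. if valid_code k then 2 ^ prod_encode (k, dig u k) else 0)" for u c
  \<comment> \<open>The number \<open>u\<close> stands for the prefix whose entries are its digits in base \<open>?N\<close>;
    membership in a ball \<open>n \<in> set_decode c\<close> only depends on the entries up to \<open>c\<close>.\<close>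
  define Cov where "Cov c \<longleftrightarrow> (\<forall>u<?N ^ Suc c. (\<exists>k<Suc c. \<not> valid_code k \<and> dig u k \<noteq> 0) \<or>
      Forb (patc u c) \<or>
    (\<exists>n\<in>set_decode c. in_ball n (dig u)))" for c
  have recursive_dig: "recursive (\<lambda>x. dig (f x) (g x))" if "recursive f" "recursive g" for f g ::
      "'x::coded \<Rightarrow> nat"
    unfolding dig_def by (intro recursive_mod recursive_div recursive_power recursive_const that)
  have recursive_patc: "recursive (\<lambda>x. patc (f x) (g x))" if "recursive f" "recursive g" for f g ::
      "'x::coded \<Rightarrow> nat"
    unfolding patc_def
    by (intro recursive_sum recursive_if decidable_valid_code recursive_power recursive_prod_encode
        recursive_Pair recursive_dig recursive_const recursive_Suc recursive_comp[OF that(1)]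
        that(2) recursive_fst recursive_snd recursive_id)
  have decidable_in_ball: "decidable (\<lambda>x. in_ball (f x) (dig (g x)))" if "recursive f" "recursive g"
      for f g :: "'x::coded \<Rightarrow> nat"
    unfolding in_ball_def split_beta
    by (intro decidable_all_less decidable_imp decidable_le decidable_eq recursive_mult
        recursive_Suc recursive_prod_decode recursive_dig recursive_baire_point recursive_const
        recursive_comp[OF that(1)] recursive_comp[OF that(2)] that recursive_fst recursive_snd
        recursive_id)
  have "semidecidable (\<lambda>c. Cov c)"
    unfolding Cov_def
    by (intro semidecidable_all_less semidecidable_disj semidecidable_comp[OF Forb_sig]
        semidecidable_dec[OF decidable_ex_less] semidecidable_dec[OF decidable_bex_set_decode]
        decidable_in_ball decidable_conj decidable_not decidable_eq decidable_valid_code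
        recursive_dig recursive_patc recursive_power recursive_Suc recursive_const recursive_fst
        recursive_snd recursive_id)
  then obtain r where r: "\<And>c. Cov c \<longleftrightarrow> halts r [enc c]" by (rule semidecidable_imp_halts) blast

  define pat where "pat u c w = (if w \<in> F \<and> word_code S w \<le> c
    then Some (inv_into A (to_nat_on A) (dig u (word_code S w))) else None)" for u c w
  have bijA: "bij_betw (to_nat_on A) A {..<?N}" by (rule to_nat_on_finite[OF finite_alphabet])
  \<comment> \<open>With a nonempty alphabet each digit in base \<open>?N\<close> numbers a symbol.
    For an empty alphabet \<open>?N ^ Suc c\<close> is 0, so no \<open>u\<close> occurs.\<close>
  have dig_A: "inv_into A (to_nat_on A) (dig u k) \<in> A"
      "to_nat_on A (inv_into A (to_nat_on A) (dig u k)) = dig u k"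
    if "?N > 0" for u k
  proof -
    have "dig u k \<in> to_nat_on A ` A"
      using that bij_betw_imp_surj_on[OF bijA] by (simp add: dig_def)
    then show "inv_into A (to_nat_on A) (dig u k) \<in> A"
        "to_nat_on A (inv_into A (to_nat_on A) (dig u k)) = dig u k"
      by (rule inv_into_into, rule f_inv_into_f)
  qed
  have pat: "pat u c \<in> patterns S A" and pat_code: "pattern_code S A (pat u c) = patc u c" if N:
      "?N > 0" for u c
  proof -
    have "inj_on (word_code S) (dom (pat u c))"
      by (rule inj_on_subset[OF word_code_inj[OF finite_S]]) (auto simp: pat_def dom_def split:
          if_splits)
    moreover have "word_code S ` dom (pat u c) \<subseteq> {..c}" by (auto simp: pat_def dom_def split:
        if_splits)
    ultimately have "finite (dom (pat u c))" by (meson finite_atMost finite_imageD finite_subset)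
    then show "pat u c \<in> patterns S A"
      using dig_A[OF N] by (auto simp: patterns_def pat_def dom_def ran_def split: if_splits)
    have "{prod_encode (word_code S w, to_nat_on A a) | w a. pat u c w = Some a} =
        (\<lambda>k. prod_encode (k, dig u k)) ` {k. k < Suc c \<and> valid_code k}" (is "?L = ?R")
    proof (intro Set.set_eqI iffI)
      fix n assume "n \<in> ?L"
      then obtain w where "w \<in> F" "word_code S w \<le> c"
          "n = prod_encode (word_code S w, dig u (word_code S w))"
        using dig_A[OF N] by (auto simp: pat_def split: if_splits)
      then show "n \<in> ?R" by (auto simp: valid_code_iff)
    next
      fix n assume "n \<in> ?R"
      then obtain w where "w \<in> F" "word_code S w \<le> c"
          "n = prod_encode (word_code S w, dig u (word_code S w))"
        by (auto simp: valid_code_iff)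
      then have "pat u c w = Some (inv_into A (to_nat_on A) (dig u (word_code S w)))"
        "n = prod_encode (word_code S w, to_nat_on A (inv_into A (to_nat_on A) (dig u (word_code S
          w))))"
        using dig_A[OF N] by (auto simp: pat_def)
      then show "n \<in> ?L" by blast
    qed
    then have "pattern_code S A (pat u c) = (\<Sum>k\<in>{k. k < Suc c \<and>
        valid_code k}. 2 ^ prod_encode (k, dig u k))"
      unfolding pattern_code_def set_encode_def
      by (simp only:) (subst sum.reindex, auto simp: inj_on_def)
    also have "\<dots> = patc u c"
      unfolding patc_def by (subst sum.inter_filter[symmetric]) (auto intro!: sum.cong)
    finally show "pattern_code S A (pat u c) = patc u c" .
  qed
  have pat_agree: "(\<forall>w a. pat u c w = Some a \<longrightarrow> x (\<phi> w) = a) \<longleftrightarrow>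
      (\<forall>k<Suc c. valid_code k \<longrightarrow> encode_point x k = dig u k)" if x: "x \<in> X" and N: "?N > 0" for x u c
  proof -
    have eq: "x (\<phi> w) = inv_into A (to_nat_on A) d \<longleftrightarrow> encode_point x (word_code S w) = d"
      if "w \<in> F" "d = dig u k" for w d k
      unfolding encode_point_word_code[OF that(1)]
      using dig_A[OF N, of u k] that inj_on_eq_iff[OF inj_code_A]
          X_value[OF x word_val_in[OF free_group_lists[OF that(1)]]]
      by metis
    show ?thesis
      unfolding pat_def valid_code_iff using eq[OF _ refl] by (auto simp: less_Suc_eq_le)
  qed
  have ball_cong: "in_ball n y \<longleftrightarrow> in_ball n z" if "n \<in> set_decode c" "\<forall>k<Suc c. y k = z k"
      for n c y z
  proof -
    obtain i a b where n: "n = prod_encode (i, prod_encode (a, b))"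
      by (metis prod_decode_inverse surj_pair)
    \<comment> \<open>Pairing dominates its components and members of a decoded set lie below the
      code, so the ball looks at no coordinate beyond \<open>c\<close>.\<close>
    have "b \<le> n" unfolding n using le_prod_encode_2 order_trans by metis
    moreover have "n < c" by (rule less_of_set_decode[OF that(1)])
    ultimately have "y k = z k" if "k < Suc b" for k using that \<open>\<forall>k<Suc c. y k = z k\<close> by simp
    then show ?thesis by (simp add: in_ball_def n)
  qed
  have "Cov c \<longleftrightarrow> encoded_shift \<subseteq> basic_open baire baire_point (set_decode c)" for c
  proof
    assume cov: "Cov c"
    show "encoded_shift \<subseteq> basic_open baire baire_point (set_decode c)"
    proof
      fix y assume "y \<in> encoded_shift"
      then obtain x where x: "x \<in> X" "y = encode_point x" by (auto simp: encoded_shift_def)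
      have N: "?N > 0" using encode_point_less[OF x(1), of 0] by simp
      obtain u where u: "u < ?N ^ Suc c" "\<forall>k<Suc c. dig u k = y k"
        using ex_digits[of "Suc c" y ?N] encode_point_less[OF x(1)] unfolding x(2) dig_def by blast
      have "\<not> Forb (patc u c)"
        unfolding pat_code[OF N, symmetric] Forb_iff[OF pat[OF N]] forbidden_def
        using x pat_agree[OF x(1) N, of u c] u(2) by auto
      moreover have "\<not> (\<exists>k<Suc c. \<not> valid_code k \<and> dig u k \<noteq> 0)"
        using u(2) encode_point_invalid[of _ x] unfolding x(2) by metis
      ultimately obtain n where "n \<in> set_decode c" "in_ball n (dig u)" using cov u(1) unfolding
          Cov_def by blast
      with ball_cong[of n c "dig u" y] u(2) show "y \<in> basic_open baire baire_point (set_decode c)"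
        by (auto simp: basic_open_def basic_ball_baire)
    qed
  next
    assume cov: "encoded_shift \<subseteq> basic_open baire baire_point (set_decode c)"
    show "Cov c"
      unfolding Cov_def
    proof (intro allI impI)
      fix u assume u: "u < ?N ^ Suc c"
      then have N: "?N > 0" by (cases "?N = 0") auto
      show "(\<exists>k<Suc c. \<not> valid_code k \<and> dig u k \<noteq> 0) \<or> Forb (patc u c) \<or>
          (\<exists>n\<in>set_decode c. in_ball n (dig u))"
      proof (cases "(\<exists>k<Suc c. \<not> valid_code k \<and> dig u k \<noteq> 0) \<or> Forb (patc u c)")
        case False
        then have "\<not> forbidden (pat u c)"
          using Forb_iff[OF pat[OF N], of u c] pat_code[OF N] by simp
        then obtain x where x: "x \<in> X" "\<forall>k<Suc c. valid_code k \<longrightarrow> encode_point x k = dig u k"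
          using pat_agree[OF _ N] unfolding forbidden_def by blast
        then have eq: "\<forall>k<Suc c. encode_point x k = dig u k"
          using False encode_point_invalid by metis
        from x(1) cov obtain n where "n \<in> set_decode c" "in_ball n (encode_point x)"
          unfolding encoded_shift_def basic_open_def image_subset_iff UN_iff basic_ball_baire
              by blast
        with ball_cong[OF _ eq] show ?thesis by blast
      qed blast
    qed
  qed
  then have "halts r [set_encode I] \<longleftrightarrow> encoded_shift \<subseteq> basic_open baire baire_point I" if "finite I"
      for I
    using r[of "set_encode I"] that by simp
  with compactin_encoded_shift show ?thesis unfolding recursively_compact_def by blast
qed

lemma EDS_if_effective:
  assumes "effectively_closed S A (pullback G S X)"
  shows "EDS G (subshift_topology G A X) (shift_action G X)"
proof -
  let ?TK = "subtopology (mtopology_of baire) encoded_shift"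
  obtain \<beta> where \<beta>: "homeo_action G ?TK \<beta>"
    and \<beta>_eq: "\<And>g x. g \<in> carrier G \<Longrightarrow> x \<in> topspace (subshift_topology G A X) \<Longrightarrow>
      \<beta> g (encode_point x) = encode_point (shift_action G X g x)"
    by (rule homeo_action_transport[OF homeo_action_shift homeomorphic_encode_point]) blast
  have "computable_map baire baire_point encoded_shift baire baire_point (\<beta> g)" if g: "g \<in> S" for g
  \<comment> \<open>The reindexing of \<open>encode_point_shift\<close> depends on \<open>g\<close>
    only through the code of one letter, a constant of the program.\<close>
  proof (rule computable_map_reindexing)
    show "decidable valid_code" using decidable_valid_code[OF recursive_id] by simp
    show "recursive (\<lambda>n. list_encode (push_code (letter_code S (True, g)) (list_decode n)))"
      by (intro recursive_list_encode recursive_push_code recursive_list_decode recursive_id)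
    fix y n assume "y \<in> encoded_shift"
    then obtain x where x: "x \<in> X" "y = encode_point x" by (auto simp: encoded_shift_def)
    have "\<beta> g y = encode_point (shift G g x)"
      using \<beta>_eq[of g x] x g S_subset by (auto simp: topspace_X shift_action_def)
    then show "\<beta> g y n = (if valid_code n then y (list_encode (push_code (letter_code S (True, g))
        (list_decode n))) else 0)"
      using encode_point_shift[OF g x(1)] by (simp add: x(2))
  qed
  then have "computable_action G baire baire_point encoded_shift \<beta>"
    unfolding computable_action_def
    using computable_metric_space_baire recursively_compact_encoded_shift[OF assms] \<beta> generating
        by blast
  moreover have "conjugate_actions G (subshift_topology G A X) (shift_action G X) ?TK \<beta>"
    unfolding conjugate_actions_def using homeomorphic_encode_point \<beta>_eq
        by (metis (no_types, lifting))
  moreover have "metrizable_space (subshift_topology G A X)"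
  proof -
    \<comment> \<open>The subshift inherits metrizability from its image in Baire space.\<close>
    have "metrizable_space ?TK"
      unfolding mtopology_of_baire by (intro metrizable_space_subtopology
          baire.metrizable_space_mtopology)
    then show ?thesis
      using homeomorphic_metrizable_space[OF homeomorphic_map_imp_homeomorphic_space[OF homeomorphic_encode_point]] by simp
  qed
  ultimately show ?thesis using compact_space_X homeo_action_shift by (intro EDS_I)
qed

end

theorem proposition7p1:
  fixes G :: "('g, 'z) monoid_scheme"
    and A :: "'b set"
    and X :: "('g \<Rightarrow> 'b) set"
  assumes "group G"
    and "finitely_generated G"
    and "finite A"
    and "subshift G A X"
  shows "EDS G (subshift_topology G A X) (shift_action G X) \<longleftrightarrow> effective_subshift G A X"
proof -
  have loc: "subshift_setup G A X S" if "finite_generating_set G S" for S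
    using assms that by (simp add: subshift_setup_def subshift_setup_axioms_def)
  show ?thesis
  proof
    assume "EDS G (subshift_topology G A X) (shift_action G X)"
    then obtain m :: "nat set metric" and s K \<beta> where act: "computable_action G m s K \<beta>"
      and conj: "conjugate_actions G (subshift_topology G A X) (shift_action G X) (subtopology
          (mtopology_of m) K) \<beta>"
      unfolding EDS_def by blast
    \<comment> \<open>Effectiveness is shown for the very generating set whose elements act
      computably; the converse direction likewise keeps its own set.\<close>
    from act obtain S where S: "finite_generating_set G S" "\<forall>g\<in>S. computable_map m s K m s (\<beta> g)"
      and K: "computable_metric_space m s" "recursively_compact m s K"
        "homeo_action G (subtopology (mtopology_of m) K) \<beta>"
      unfolding computable_action_def by blast
    have "effectively_closed S A (pullback G S X)"
      by (rule subshift_setup.effectively_closed_if_computable[OF loc[OF S(1)] K S(2) conj])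
    then show "effective_subshift G A X"
      unfolding effective_subshift_def using S(1) assms(4) by blast
  next
    assume "effective_subshift G A X"
    then obtain S where "finite_generating_set G S" "effectively_closed S A (pullback G S X)"
      unfolding effective_subshift_def by blast
    then show "EDS G (subshift_topology G A X) (shift_action G X)"
      using subshift_setup.EDS_if_effective[OF loc] by blast
  qed
qed

end
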